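(* Let $f$ denote the second-order correlation function of the characteristic polynomial of an unrescaled complex sample covariance matrix, and let $b^*:=2\left(b-\tfrac34\right)$. For any $\alpha\in\mathbb{N}$, $\mu,\nu\in\mathbb{R}$, put $n:=N$, $m:=N-\alpha$, and $$ Z_N(\mu,\nu):=\left(16N^2+4(\mu+\nu)N^{4/3}+\mu\nu N^{2/3}\right)^{\alpha/2}\exp\left(-4N-\tfrac12(\mu+\nu)N^{1/3}\right). $$ Then $$ \lim_{N\to\infty}\left(2^{4/3}\,N^{1/3}\,Z_N(2^{4/3}\mu,2^{4/3}\nu)\cdot\frac{f\big(n,m;4N+2^{4/3}\mu N^{1/3},4N+2^{4/3}\nu N^{1/3}\big)}{n!\,m!}\right)=\exp(b^* )\,\mathbb{A}(\mu,\nu). $$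
   Context: Here $\mathbb{N}=\{0,1,2,\dots\}$ and $\alpha$ is fixed as $N\to\infty$ ($N\ge\alpha$). Let $Q$ be a probability distribution on the real line with expectation $0$, variance $1/2$ and finite fourth moment $b$ (i.e. $b=\int x^4\,dQ(x)<\infty$). For $n\ge m$, let $X=X(n,m)$ be the $n\times m$ random matrix whose entries are i.i.d. complex random variables whose real and imaginary parts are independent, each with distribution $Q$, and let $X^*$ be its conjugate transpose. The $m\times m$ matrix $X(n,m)^*X(n,m)$ is the unrescaled complex sample covariance matrix. For $\mu,\nu\in\mathbb{C}$, $$ f(n,m;\mu,\nu):=\mathbb{E}\big(\det(X(n,m)^*X(n,m)-\mu)\,\det(X(n,m)^*X(n,m)-\nu)\big), $$ where $\mu,\nu$ inside the determinants stand for $\mu I_m,\nu I_m$. With $\mathrm{Ai}$ the Airy function, the Airy kernel is $$ \mathbb{A}(x,y):=\frac{\mathrm{Ai}(x)\,\mathrm{Ai}'(y)-\mathrm{Ai}'(x)\,\mathrm{Ai}(y)}{x-y}, $$ understood for $x=y$ as its continuous extension. The base of the power $\alpha/2$ in $Z_N$ is positive for all sufficiently large $N$. *)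

theory Defs
  imports
    "HOL-Probability.Probability"
    "Jordan_Normal_Form.Schur_Decomposition"
begin

(* The names det and mat exist both for matrices indexed by finite types (HOL-Analysis) and for
   matrices with explicit dimensions (Jordan_Normal_Form); the latter are used here, because the
   size of the matrices varies with N. *)

text \<open>
  An \<open>n \<times> m\<close> random matrix on \<open>M\<close> with i.i.d. complex entries whose real and imaginary parts are
  independent with distribution \<open>Q\<close>.  That the entries are identically distributed, and that each
  entry is measurable, is implied by the conditions below.
\<close>

definition iid_complex_random_matrix ::
    "real measure \<Rightarrow> nat \<Rightarrow> nat \<Rightarrow> 'a measure \<Rightarrow> ('a \<Rightarrow> complex mat) \<Rightarrow> bool" where
  "iid_complex_random_matrix Q n m M X \<longleftrightarrow>
     prob_space M \<and>
     (\<forall>\<omega>\<in>space M. X \<omega> \<in> carrier_mat n m) \<and>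
     prob_space.indep_vars M (\<lambda>_. borel) (\<lambda>ij \<omega>. X \<omega> $$ ij) ({..<n} \<times> {..<m}) \<and>
     (\<forall>ij \<in> {..<n} \<times> {..<m}.
        prob_space.indep_var M borel (\<lambda>\<omega>. Re (X \<omega> $$ ij)) borel (\<lambda>\<omega>. Im (X \<omega> $$ ij)) \<and>
        distr M borel (\<lambda>\<omega>. Re (X \<omega> $$ ij)) = Q \<and>
        distr M borel (\<lambda>\<omega>. Im (X \<omega> $$ ij)) = Q)"

definition sample_covariance :: "complex mat \<Rightarrow> complex mat" where
  "sample_covariance A = mat_adjoint A * A"

definition char_det :: "complex mat \<Rightarrow> complex \<Rightarrow> complex" where
  "char_det A \<mu> = Determinant.det (A - \<mu> \<cdot>\<^sub>m 1\<^sub>m (dim_row A))"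

definition second_order_correlation ::
    "'a measure \<Rightarrow> ('a \<Rightarrow> complex mat) \<Rightarrow> complex \<Rightarrow> complex \<Rightarrow> complex" where
  "second_order_correlation M X \<mu> \<nu> =
     (LINT \<omega>|M. char_det (sample_covariance (X \<omega>)) \<mu> * char_det (sample_covariance (X \<omega>)) \<nu>)"

text \<open>
  The Airy function on the real line.  The integral of \<open>cos (t\<^sup>3 / 3 + x t)\<close> over \<open>[0, \<infinity>)\<close> converges
  only conditionally, so it is written as an improper integral.
\<close>

definition Airy_Ai :: "real \<Rightarrow> real" where
  "Airy_Ai x = (1 / pi) * Lim at_top (\<lambda>R. integral {0..R} (\<lambda>t. cos (t ^ 3 / 3 + x * t)))"

definition Airy_quotient :: "real \<Rightarrow> real \<Rightarrow> real" where
  "Airy_quotient x y =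
     (Airy_Ai x * deriv Airy_Ai y - deriv Airy_Ai x * Airy_Ai y) / (x - y)"

text \<open>On the diagonal the value is the limit of the quotient along off-diagonal points.\<close>

definition Airy_kernel :: "real \<Rightarrow> real \<Rightarrow> real" where
  "Airy_kernel x y =
     (if x \<noteq> y then Airy_quotient x y
      else Lim (at (x, y) within {(s, t). s \<noteq> t}) (\<lambda>(s, t). Airy_quotient s t))"

definition Z_factor :: "nat \<Rightarrow> nat \<Rightarrow> real \<Rightarrow> real \<Rightarrow> real" where
  "Z_factor \<alpha> N \<mu> \<nu> =
     (16 * real N ^ 2 + 4 * (\<mu> + \<nu>) * real N powr (4/3) + \<mu> * \<nu> * real N powr (2/3)) powr (real \<alpha> / 2)
     * exp (- 4 * real N - 1/2 * (\<mu> + \<nu>) * real N powr (1/3))"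

end

theory Submission
  imports Defs "HOL-Real_Asymp.Real_Asymp" "HOL-Complex_Analysis.Complex_Analysis"
begin

text \<open>
  Adding a row to \<open>X\<close> is a rank one update of \<open>X\<^sup>*X\<close>, so conditioning on the other rows only involves moments of
  order at most four of the new entries. Their Gaussian part applies the operator
  \<open>(1 - \<partial>\<^sub>\<mu>) (1 - \<partial>\<^sub>\<nu>)\<close> to \<open>(\<mu> - \<nu>) f\<close>, and the excess \<open>b\<^sup>*\<close> contributes the same function for one column
  less. The recursion is solved by \<open>f / (n! m!) = (\<Sum>t\<le>m. b\<^sup>*\<^sup>t / t! K (m - t))\<close> with the Laguerre kernels \<open>K\<close>.
  At the edge Laguerre polynomials are Cauchy integrals over the unit circle, that is, oscillatory integrals
  with phase \<open>tan t - t\<close>, whose rescaling near \<open>t = 0\<close> gives the Airy function. By Christoffel-Darboux each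
  rescaled kernel tends to the Airy kernel, and the factor \<open>exp b\<^sup>*\<close> is the limit of the series by dominated
  convergence, the kernels being bounded by their diagonals.
\<close>

section \<open>The Airy function and the diagonal of the Airy kernel\<close>

text \<open>Averaging a new row produces the sum over a, b of the products of cofactor (a, b) at
  \<mu> with cofactor (b, a) at \<nu>, which is not expressed by the two determinants alone. After
  multiplication by \<open>\<mu> - \<nu>\<close> a resolvent identity expresses it through the
  determinants and their derivatives; hence the recursion runs for
  \<open>(\<mu> - \<nu>) * f\<close>, and \<mu> = \<nu> is recovered by continuity. The excess term
  contains diagonal cofactors, i.e. Gram determinants with one column removed, so the induction
  covers all selections of columns. Removing t rows and t columns is possible in t! (n choose t) (m
  choose t) ways, and the normalisation by n! m! leaves 1 / t!, the origin of the exponential. The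
  edge lies at 4 N because there the two stationary points of the phase x/2 tan t - 2 n t merge at t
  = 0, leaving a cubic. The Airy integrals converge only conditionally, so no integrable majorant
  exists: the integrals are truncated, and the tails are bounded uniformly by the second mean value
  theorem.\<close>

lemma oscillatory_integral_bound:
  fixes g f F :: "real \<Rightarrow> real"
  assumes "a \<le> b"
    and mono: "\<And>x y. a \<le> x \<Longrightarrow> x \<le> y \<Longrightarrow> y \<le> b \<Longrightarrow> g y \<le> g x"
    and nonneg: "0 \<le> g b"
    and F: "\<And>x. x \<in> {a..b} \<Longrightarrow> (F has_real_derivative f x) (at x)"
    and bd: "\<And>x. \<bar>F x\<bar> \<le> 1"
  shows "\<bar>integral {a..b} (\<lambda>x. g x * f x)\<bar> \<le> 4 * g a"
proof -
  have FTC: "(f has_integral (F d - F c)) {c..d}" if "a \<le> c" "c \<le> d" "d \<le> b" for c d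
  proof (rule fundamental_theorem_of_calculus[OF that(2)])
    fix x assume "x \<in> {c..d}"
    then have "(F has_real_derivative f x) (at x within {c..d})"
      using that by (auto intro: has_field_derivative_at_within[OF F])
    then show "(F has_vector_derivative f x) (at x within {c..d})"
      by (simp add: has_real_derivative_iff_has_vector_derivative)
  qed
  have int: "f integrable_on {a..b}" using FTC[of a b] \<open>a \<le> b\<close> by (auto simp: integrable_on_def)
  \<comment> \<open>The second mean value theorem asks for a nondecreasing weight, hence
    \<open>- g\<close>. Only endpoint values of \<open>g\<close> times increments of
    \<open>F\<close> remain, each increment being at most 2, so the length of the interval does not
    matter.\<close>
  obtain c where c: "c \<in> {a..b}" and eq: "integral {a..b} (\<lambda>x. (- g x) * f x)
      = (- g a) * integral {a..c} f + (- g b) * integral {c..b} f"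
    using second_mean_value_theorem[OF int \<open>a \<le> b\<close>, of "\<lambda>x. - g x"] mono by auto
  have "integral {a..b} (\<lambda>x. g x * f x) = g a * (F c - F a) + g b * (F b - F c)"
    using eq FTC[of a c, THEN integral_unique] FTC[of c b, THEN integral_unique] c by simp
  also have "\<bar>\<dots>\<bar> \<le> g a * 2 + g b * 2"
  proof -
    have "g b \<le> g a" using mono[of a b] \<open>a \<le> b\<close> by simp
    then have "\<bar>g a * (F c - F a)\<bar> \<le> g a * 2" "\<bar>g b * (F b - F c)\<bar> \<le> g b * 2"
      unfolding abs_mult using nonneg bd[of a] bd[of b] bd[of c]
      by (auto intro!: mult_mono)
    then show ?thesis by linarith
  qed
  also have "\<dots> \<le> 4 * g a" using mono[of a b] \<open>a \<le> b\<close> by simp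
  finally show ?thesis .
qed

section \<open>Truncated Airy integrals and their tails, uniformly for bounded x\<close>

definition airy_phase :: "real \<Rightarrow> real \<Rightarrow> real" where
  "airy_phase x t = t ^ 3 / 3 + x * t"

definition airy_cos :: "real \<Rightarrow> real \<Rightarrow> real" where
  "airy_cos x A = integral {0..A} (\<lambda>t. cos (airy_phase x t))"

text \<open>Minus the x-derivative of \<open>airy_cos\<close>; its limit will be \<open>- pi\<close>
  times the derivative of the Airy function.\<close>

definition airy_sin :: "real \<Rightarrow> real \<Rightarrow> real" where
  "airy_sin x A = integral {0..A} (\<lambda>t. t * sin (airy_phase x t))"

lemma airy_phase_deriv: "(airy_phase x has_real_derivative t\<^sup>2 + x) (at t within S)"
  unfolding airy_phase_def by (auto intro!: derivative_eq_intros)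

text \<open>Beyond \<open>1 + 2 * R\<close> the phase has no stationary point, whatever x in the
  range: t \<ge> 1 gives t^2 \<ge> t \<ge> 2 R, so x takes away at most half of t^2.\<close>

lemma airy_phase_pos:
  assumes "\<bar>x\<bar> \<le> R" "1 + 2 * R \<le> A" "A \<le> (t::real)"
  shows "t\<^sup>2 / 2 \<le> t\<^sup>2 + x" "0 < t" "0 < t\<^sup>2 + x" "1 \<le> t"
proof -
  have R: "0 \<le> R" using assms by linarith
  then show t: "1 \<le> t" "0 < t" using assms by linarith+
  have "t * 1 \<le> t * t" using t by (intro mult_left_mono) auto
  then have "2 * R \<le> t\<^sup>2" using assms unfolding power2_eq_square by linarith
  then show *: "t\<^sup>2 / 2 \<le> t\<^sup>2 + x" using assms by auto
  have "0 < t\<^sup>2" using t by simp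
  then show "0 < t\<^sup>2 + x" using * by linarith
qed

lemma airy_phase_continuous [continuous_intros]:
  "continuous_on S f \<Longrightarrow> continuous_on S g \<Longrightarrow> continuous_on S (\<lambda>x. airy_phase (f x) (g x))"
  unfolding airy_phase_def by (intro continuous_intros) auto

lemma airy_cos_tail:
  assumes R: "\<bar>x\<bar> \<le> R" "1 + 2 * R \<le> A" "A \<le> B"
  shows "\<bar>airy_cos x B - airy_cos x A\<bar> \<le> 8 / A"
proof -
  note pos = airy_phase_pos[OF R(1,2)]
  have A: "1 \<le> A" using pos[of A] by simp
  have "airy_cos x A + integral {A..B} (\<lambda>t. cos (airy_phase x t)) = airy_cos x B"
    unfolding airy_cos_def by (rule Henstock_Kurzweil_Integration.integral_combine)
      (use A R in \<open>auto intro!: integrable_continuous_interval continuous_intros\<close>)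
  then have "airy_cos x B - airy_cos x A = integral {A..B} (\<lambda>t. cos (airy_phase x t))" by simp
  also have "\<dots> = integral {A..B} (\<lambda>t. 1 / (t\<^sup>2 + x) * ((t\<^sup>2 + x) * cos (airy_phase x t)))"
  proof (rule integral_cong)
    fix t assume "t \<in> {A..B}"
    then have "t\<^sup>2 + x \<noteq> 0" using pos(3)[of t] by auto
    then show "cos (airy_phase x t) = 1 / (t\<^sup>2 + x) * ((t\<^sup>2 + x) * cos (airy_phase x t))" by simp
  qed
  also have "\<bar>\<dots>\<bar> \<le> 4 * (1 / (A\<^sup>2 + x))"
  proof (rule oscillatory_integral_bound[where F = "\<lambda>t. sin (airy_phase x t)"])
    fix s t assume st: "A \<le> s" "s \<le> t"
    then have At: "A \<le> t" by simp
    have "s\<^sup>2 \<le> t\<^sup>2" using st pos[of s] by (intro power_mono) auto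
    then show "1 / (t\<^sup>2 + x) \<le> 1 / (s\<^sup>2 + x)"
      using pos[OF st(1)] pos[OF At] st by (intro divide_left_mono mult_pos_pos) auto
  next
    fix t
    show "((\<lambda>t. sin (airy_phase x t)) has_real_derivative (t\<^sup>2 + x) * cos (airy_phase x t)) (at t)"
      using DERIV_fun_sin[OF airy_phase_deriv[of x t UNIV]] by (simp add: mult.commute)
  qed (use R pos[of B] in auto)
  also have "\<dots> \<le> 4 * (1 / (A\<^sup>2 / 2))"
    using pos[of A] A by (intro mult_left_mono divide_left_mono) auto
  also have "\<dots> \<le> 8 / A" using A by (simp add: field_simps power2_eq_square)
  finally show ?thesis .
qed

text \<open>The amplitude \<open>t / (t\<^sup>2 + x)\<close> decays only like 1/t. This fixes the
  rate 8/A, to which \<open>airy_cos_tail\<close> is weakened so that both tails share it.\<close>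

lemma airy_sin_tail:
  assumes R: "\<bar>x\<bar> \<le> R" "1 + 2 * R \<le> A" "A \<le> B"
  shows "\<bar>airy_sin x B - airy_sin x A\<bar> \<le> 8 / A"
proof -
  note pos = airy_phase_pos[OF R(1,2)]
  have A: "1 \<le> A" using pos[of A] by simp
  have "airy_sin x A + integral {A..B} (\<lambda>t. t * sin (airy_phase x t)) = airy_sin x B"
    unfolding airy_sin_def by (rule Henstock_Kurzweil_Integration.integral_combine)
      (use A R in \<open>auto intro!: integrable_continuous_interval continuous_intros\<close>)
  then have "airy_sin x B - airy_sin x A = integral {A..B} (\<lambda>t. t * sin (airy_phase x t))" by simp
  also have "\<dots> = integral {A..B} (\<lambda>t. t / (t\<^sup>2 + x) * ((t\<^sup>2 + x) * sin (airy_phase x t)))"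
  proof (rule integral_cong)
    fix t assume "t \<in> {A..B}"
    then have "t\<^sup>2 + x \<noteq> 0" using pos(3)[of t] by auto
    then show "t * sin (airy_phase x t) = t / (t\<^sup>2 + x) * ((t\<^sup>2 + x) * sin (airy_phase x t))" by simp
  qed
  also have "\<bar>\<dots>\<bar> \<le> 4 * (A / (A\<^sup>2 + x))"
  proof (rule oscillatory_integral_bound[where F = "\<lambda>t. - cos (airy_phase x t)"])
    fix s t assume st: "A \<le> s" "s \<le> t"
    \<comment> \<open>\<open>airy_phase_pos\<close> at the extreme value \<open>- R\<close> of x:
      half of s^2 is at most s^2 - R.\<close>
    have "2 * R \<le> s\<^sup>2"
      using airy_phase_pos[of "- R" R A s] R st by auto
    then have "x \<le> s\<^sup>2" using R by linarith
    moreover have "s * s \<le> s * t" using st pos[of s] by (intro mult_left_mono) auto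
    \<comment> \<open>This product is s (t^2 + x) - t (s^2 + x), the cross-multiplied form of the
      monotonicity claim.\<close>
    ultimately have "0 \<le> (t - s) * (s * t - x)" using st by (intro mult_nonneg_nonneg)
       (auto simp: power2_eq_square)
    then show "t / (t\<^sup>2 + x) \<le> s / (s\<^sup>2 + x)"
      using pos(3)[of s] pos(3)[of t] st by (simp add: field_simps power2_eq_square)
  next
    fix t
    show "((\<lambda>t. - cos (airy_phase x t)) has_real_derivative (t\<^sup>2 + x) * sin (airy_phase x t)) (at t)"
      using DERIV_minus[OF DERIV_fun_cos[OF airy_phase_deriv[of x t UNIV]]] by (simp add: mult.commute)
  qed (use R pos[of B] in auto)
  also have "\<dots> \<le> 4 * (A / (A\<^sup>2 / 2))"
    using pos[of A] A by (intro mult_left_mono divide_left_mono) auto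
  also have "\<dots> \<le> 8 / A" using A by (simp add: field_simps power2_eq_square)
  finally show ?thesis .
qed

text \<open>A Cauchy criterion with a rate. It gives meaning to the \<open>Lim\<close> that defines
  the Airy function, and the rate, independent of x on bounded sets, is what permits differentiation
  of the limit.\<close>

lemma tendsto_at_top_if_tail_bound:
  fixes h :: "real \<Rightarrow> real"
  assumes "A0 > 0" and tail: "\<And>A B. A0 \<le> A \<Longrightarrow> A \<le> B \<Longrightarrow> \<bar>h B - h A\<bar> \<le> C / A"
  shows "(h \<longlongrightarrow> Lim at_top h) at_top" "\<And>A. A0 \<le> A \<Longrightarrow> \<bar>Lim at_top h - h A\<bar> \<le> C / A"
proof -
  have C: "0 \<le> C" using tail[of A0 A0] \<open>A0 > 0\<close> by (auto simp: zero_le_divide_iff)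
  have "\<exists>l. (h \<longlongrightarrow> l) at_top"
  proof -
    have "convergent (\<lambda>n. h (A0 + real n))"
    proof (rule Cauchy_convergent, rule metric_CauchyI)
      fix e :: real assume "e > 0"
      obtain n0 where n0: "C / e < real n0" using reals_Archimedean2 by blast
      have *: "\<bar>h (A0 + real m) - h (A0 + real n)\<bar> < e" if "n0 \<le> n" "n \<le> m" for m n
      proof -
        have "\<bar>h (A0 + real m) - h (A0 + real n)\<bar> \<le> C / (A0 + real n)" using tail that by simp
        also have "\<dots> < e"
        proof -
          have "C / e < A0 + real n" using n0 that \<open>A0 > 0\<close> by linarith
          then show ?thesis using \<open>e > 0\<close> \<open>A0 > 0\<close> by (simp add: field_simps)
        qed
        finally show ?thesis .
      qed
      show "\<exists>M. \<forall>m\<ge>M. \<forall>n\<ge>M. dist (h (A0 + real m)) (h (A0 + real n)) < e"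
      proof (intro exI allI impI)
        fix m n assume "n0 \<le> m" "n0 \<le> n"
        then show "dist (h (A0 + real m)) (h (A0 + real n)) < e"
          using *[of n m] *[of m n] by (cases "n \<le> m") (auto simp: dist_real_def abs_minus_commute)
      qed
    qed
    then obtain l where l: "(\<lambda>n. h (A0 + real n)) \<longlonglongrightarrow> l" by (auto simp: convergent_def)
    have bound: "\<bar>l - h A\<bar> \<le> C / A" if "A0 \<le> A" for A
    proof (rule tendsto_upperbound)
      show "(\<lambda>n. \<bar>h (A0 + real n) - h A\<bar>) \<longlonglongrightarrow> \<bar>l - h A\<bar>" by (intro tendsto_intros l)
      have "eventually (\<lambda>n. A \<le> A0 + real n) sequentially"
        by (rule eventually_sequentiallyI[of "nat \<lceil>A - A0\<rceil>"]) linarith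
      then show "eventually (\<lambda>n. \<bar>h (A0 + real n) - h A\<bar> \<le> C / A) sequentially"
        by eventually_elim (use tail that in auto)
    qed simp
    have "((\<lambda>A. h A - l) \<longlongrightarrow> 0) at_top"
    proof (rule Lim_null_comparison)
      show "\<forall>\<^sub>F A in at_top. norm (h A - l) \<le> C / A"
        using eventually_ge_at_top[of A0] by eventually_elim (use bound in \<open>auto simp: abs_minus_commute\<close>)
      show "((\<lambda>A. C / A) \<longlongrightarrow> 0) at_top" by real_asymp
    qed
    then show ?thesis using LIM_zero_cancel by blast
  qed
  then show lim: "(h \<longlongrightarrow> Lim at_top h) at_top"
    by (metis tendsto_Lim trivial_limit_at_top_linorder)
  show "\<bar>Lim at_top h - h A\<bar> \<le> C / A" if "A0 \<le> A" for A
  proof (rule tendsto_upperbound)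
    show "((\<lambda>B. \<bar>h B - h A\<bar>) \<longlongrightarrow> \<bar>Lim at_top h - h A\<bar>) at_top" by (intro tendsto_intros lim)
    show "\<forall>\<^sub>F B in at_top. \<bar>h B - h A\<bar> \<le> C / A"
      using eventually_ge_at_top[of A] by eventually_elim (use tail that in auto)
  qed simp
qed

definition airy_cos_inf :: "real \<Rightarrow> real" where "airy_cos_inf x = Lim at_top (airy_cos x)"
definition airy_sin_inf :: "real \<Rightarrow> real" where "airy_sin_inf x = Lim at_top (airy_sin x)"

lemma airy_inf_tail:
  assumes R: "\<bar>x\<bar> \<le> R" "1 + 2 * R \<le> A"
  shows "\<bar>airy_cos_inf x - airy_cos x A\<bar> \<le> 8 / A" "\<bar>airy_sin_inf x - airy_sin x A\<bar> \<le> 8 / A"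
proof -
  have pos: "0 < 1 + 2 * R" using R by linarith
  show "\<bar>airy_cos_inf x - airy_cos x A\<bar> \<le> 8 / A"
    unfolding airy_cos_inf_def
    by (rule tendsto_at_top_if_tail_bound(2)[OF pos airy_cos_tail[OF R(1)] R(2)])
  show "\<bar>airy_sin_inf x - airy_sin x A\<bar> \<le> 8 / A"
    unfolding airy_sin_inf_def
    by (rule tendsto_at_top_if_tail_bound(2)[OF pos airy_sin_tail[OF R(1)] R(2)])
qed

lemma tendsto_airy_cos: "(airy_cos x \<longlongrightarrow> airy_cos_inf x) at_top"
  and tendsto_airy_sin: "(airy_sin x \<longlongrightarrow> airy_sin_inf x) at_top"
proof -
  have pos: "0 < 1 + 2 * \<bar>x\<bar>" by linarith
  show "(airy_cos x \<longlongrightarrow> airy_cos_inf x) at_top" "(airy_sin x \<longlongrightarrow> airy_sin_inf x) at_top"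
    unfolding airy_cos_inf_def airy_sin_inf_def
    by (rule tendsto_at_top_if_tail_bound(1)[OF pos airy_cos_tail[OF order_refl]]
        tendsto_at_top_if_tail_bound(1)[OF pos airy_sin_tail[OF order_refl]]; assumption)+
qed

section \<open>Derivatives of the Airy integrals and the Airy equation\<close>

lemma has_real_derivative_uniform_limit:
  fixes f f' :: "nat \<Rightarrow> real \<Rightarrow> real"
  assumes S: "open S" "convex S" "x \<in> S"
    and der: "\<And>n y. y \<in> S \<Longrightarrow> (f n has_real_derivative f' n y) (at y)"
    and unif: "uniform_limit S f' g' sequentially"
    and lim: "\<And>y. y \<in> S \<Longrightarrow> (\<lambda>n. f n y) \<longlonglongrightarrow> g y"
  shows "(g has_real_derivative g' x) (at x)"
proof -
  have "\<exists>G. \<forall>y\<in>S. (\<lambda>n. f n y) \<longlonglongrightarrow> G y \<and> (G has_derivative (\<lambda>h. g' y * h)) (at y within S)"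
  proof (rule has_derivative_sequence[where f = f and ?x0.0 = x and l = "g x" and f' = "\<lambda>n y h. f' n y * h"])
    show "(f n has_derivative (\<lambda>h. f' n y * h)) (at y within S)" if "y \<in> S" for n y
      using der[OF that, of n] by (simp add: has_field_derivative_def has_derivative_at_withinI)
    fix e :: real assume "e > 0"
    then have "\<forall>\<^sub>F n in sequentially. \<forall>y\<in>S. dist (f' n y) (g' y) < e"
      using unif by (simp add: uniform_limit_iff)
    then show "\<forall>\<^sub>F n in sequentially. \<forall>y\<in>S. \<forall>h. norm (f' n y * h - g' y * h) \<le> e * norm h"
    proof eventually_elim
      case (elim n)
      have "norm (f' n y * h - g' y * h) \<le> e * norm h" if "y \<in> S" for y h
        using mult_right_mono[of "\<bar>f' n y - g' y\<bar>" e "\<bar>h\<bar>"] elim that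
        by (force simp: left_diff_distrib[symmetric] abs_mult dist_real_def)
      then show ?case by blast
    qed
  qed (use S lim in auto)
  then obtain G where G: "\<And>y. y \<in> S \<Longrightarrow> (\<lambda>n. f n y) \<longlonglongrightarrow> G y"
    "\<And>y. y \<in> S \<Longrightarrow> (G has_derivative (\<lambda>h. g' y * h)) (at y within S)" by blast
  have eq: "G y = g y" if "y \<in> S" for y using LIMSEQ_unique[OF G(1) lim] that by blast
  have "(G has_real_derivative g' x) (at x)"
    using G(2)[OF S(3)] S by (simp add: has_field_derivative_def at_within_open[OF S(3,1)])
  then show ?thesis
    by (rule has_field_derivative_transform_within_open[OF _ S(1,3)]) (use eq in auto)
qed

lemma airy_cos_deriv: "((\<lambda>x. airy_cos x A) has_real_derivative - airy_sin x A) (at x)"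
proof -
  have "((\<lambda>x. integral (cbox 0 A) (\<lambda>t. cos (airy_phase x t))) has_real_derivative
      integral (cbox 0 A) (\<lambda>t. - (t * sin (airy_phase x t)))) (at x within UNIV)"
    by (rule leibniz_rule_field_derivative)
      (auto simp: airy_phase_def split_beta intro!: derivative_eq_intros continuous_intros
         integrable_continuous_interval)
  then show ?thesis by (simp add: airy_cos_def airy_sin_def)
qed

text \<open>Differentiation produces t^2 times the cosine, whose integral has no limit. Completing
  t^2 to t^2 + x, the derivative of the phase, makes it exact and leaves a boundary term and
  \<open>x * airy_cos x A\<close>.\<close>

lemma airy_sin_deriv:
  assumes "A \<ge> 0"
  shows "((\<lambda>x. airy_sin x A) has_real_derivative sin (airy_phase x A) - x * airy_cos x A) (at x)"
proof -
  have "((\<lambda>x. integral (cbox 0 A) (\<lambda>t. t * sin (airy_phase x t))) has_real_derivative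
      integral (cbox 0 A) (\<lambda>t. t\<^sup>2 * cos (airy_phase x t))) (at x within UNIV)"
    by (rule leibniz_rule_field_derivative)
      (auto simp: airy_phase_def split_beta power2_eq_square intro!: derivative_eq_intros continuous_intros
         integrable_continuous_interval)
  moreover have "((\<lambda>t. (t\<^sup>2 + x) * cos (airy_phase x t)) has_integral
      sin (airy_phase x A) - sin (airy_phase x 0)) {0..A}"
    by (rule fundamental_theorem_of_calculus[OF assms])
      (auto simp: mult.commute has_real_derivative_iff_has_vector_derivative[symmetric]
         intro: has_field_derivative_at_within[OF DERIV_fun_sin[OF airy_phase_deriv]])
  then have "integral {0..A} (\<lambda>t. (t\<^sup>2 + x) * cos (airy_phase x t)) = sin (airy_phase x A)"
    by (simp add: integral_unique airy_phase_def)
  then have "integral {0..A} (\<lambda>t. t\<^sup>2 * cos (airy_phase x t)) + x * airy_cos x A = sin (airy_phase x A)"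
    unfolding airy_cos_def integral_mult_right[symmetric]
    by (subst Henstock_Kurzweil_Integration.integral_add[symmetric])
      (auto simp: distrib_right intro!: integrable_continuous_interval continuous_intros)
  then have "integral {0..A} (\<lambda>t. t\<^sup>2 * cos (airy_phase x t)) = sin (airy_phase x A) - x * airy_cos x A"
    by linarith
  ultimately show ?thesis by (simp add: airy_sin_def)
qed

lemma airy_cos_inf_deriv: "(airy_cos_inf has_real_derivative - airy_sin_inf x) (at x)"
proof (rule has_real_derivative_uniform_limit[where S = "ball x 1" and
    f = "\<lambda>n x. airy_cos x (real n)" and f' = "\<lambda>n x. - airy_sin x (real n)"])
  show "uniform_limit (ball x 1) (\<lambda>n x. - airy_sin x (real n)) (\<lambda>a. - airy_sin_inf a) sequentially"
  proof (rule uniform_limitI)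
    fix e :: real assume "e > 0"
    have "eventually (\<lambda>n. 1 + 2 * (\<bar>x\<bar> + 1) \<le> real n) sequentially"
      "eventually (\<lambda>n. 8 / real n < e) sequentially"
      using \<open>e > 0\<close> by real_asymp+
    then show "\<forall>\<^sub>F n in sequentially. \<forall>y\<in>ball x 1. dist (- airy_sin y (real n)) (- airy_sin_inf y) < e"
    proof eventually_elim
      case (elim n)
      show ?case
      proof
        fix y assume "y \<in> ball x 1"
        then have "\<bar>y\<bar> \<le> \<bar>x\<bar> + 1" by (auto simp: dist_real_def)
        from airy_inf_tail(2)[OF this elim(1)] elim(2)
        show "dist (- airy_sin y (real n)) (- airy_sin_inf y) < e" by (simp add: dist_real_def)
      qed
    qed
  qed
  show "(\<lambda>n. airy_cos y (real n)) \<longlonglongrightarrow> airy_cos_inf y" for y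
    by (rule filterlim_compose[OF tendsto_airy_cos filterlim_real_sequentially])
qed (auto intro: airy_cos_deriv)

text \<open>The boundary term \<open>sin (airy_phase x A)\<close> of \<open>airy_sin_deriv\<close>
  oscillates as A grows. Adding \<open>cos (airy_phase x A) / A\<close> cancels it exactly, since
  the x-derivative of the phase at A is A, and does not change the limit of the functions.
  \<open>Suc n\<close> keeps the divisor nonzero.\<close>

lemma airy_sin_inf_deriv: "(airy_sin_inf has_real_derivative - (x * airy_cos_inf x)) (at x)"
proof (rule has_real_derivative_uniform_limit[where S = "ball x 1" and
    f = "\<lambda>n x. airy_sin x (real (Suc n)) + cos (airy_phase x (real (Suc n))) / real (Suc n)" and
    f' = "\<lambda>n x. - (x * airy_cos x (real (Suc n)))"])
  show "uniform_limit (ball x 1) (\<lambda>n x. - (x * airy_cos x (real (Suc n)))) (\<lambda>a. - (a * airy_cos_inf a)) sequentially"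
  proof (rule uniform_limitI)
    fix e :: real assume "e > 0"
    have "eventually (\<lambda>n. 1 + 2 * (\<bar>x\<bar> + 1) \<le> real (Suc n)) sequentially"
      "eventually (\<lambda>n. (\<bar>x\<bar> + 1) * (8 / real (Suc n)) < e) sequentially"
      using \<open>e > 0\<close> by real_asymp+
    then show "\<forall>\<^sub>F n in sequentially. \<forall>y\<in>ball x 1. dist (- (y * airy_cos y (real (Suc n)))) (- (y * airy_cos_inf y)) < e"
    proof eventually_elim
      case (elim n)
      show ?case
      proof
        fix y assume "y \<in> ball x 1"
        then have y: "\<bar>y\<bar> \<le> \<bar>x\<bar> + 1" by (auto simp: dist_real_def)
        have "dist (- (y * airy_cos y (real (Suc n)))) (- (y * airy_cos_inf y))
            = \<bar>y\<bar> * \<bar>airy_cos_inf y - airy_cos y (real (Suc n))\<bar>"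
          by (simp add: dist_real_def abs_mult[symmetric] algebra_simps)
        also have "\<dots> \<le> (\<bar>x\<bar> + 1) * (8 / real (Suc n))"
          by (rule mult_mono) (use y airy_inf_tail(1)[OF y elim(1)] in auto)
        also have "\<dots> < e" by (rule elim(2))
        finally show "dist (- (y * airy_cos y (real (Suc n)))) (- (y * airy_cos_inf y)) < e" .
      qed
    qed
  qed
  show "(\<lambda>n. airy_sin y (real (Suc n)) + cos (airy_phase y (real (Suc n))) / real (Suc n)) \<longlonglongrightarrow> airy_sin_inf y" for y
  proof -
    have "(\<lambda>n. cos (airy_phase y (real (Suc n))) / real (Suc n)) \<longlonglongrightarrow> 0"
      by (rule Lim_null_comparison[where g = "\<lambda>n. 1 / real (Suc n)"])
        (auto intro!: always_eventually divide_right_mono simp: abs_divide, real_asymp)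
    then show ?thesis
      using tendsto_add[OF LIMSEQ_Suc[OF filterlim_compose[OF tendsto_airy_sin[of y] filterlim_real_sequentially]],
          where b = 0] by simp
  qed
  show "((\<lambda>x. airy_sin x (real (Suc n)) + cos (airy_phase x (real (Suc n))) / real (Suc n)) has_real_derivative
          - (y * airy_cos y (real (Suc n)))) (at y)" for n y
  proof -
    have "((\<lambda>x. cos (airy_phase x (real (Suc n))) / real (Suc n)) has_real_derivative
      - sin (airy_phase y (real (Suc n)))) (at y)"
      unfolding airy_phase_def by (auto intro!: derivative_eq_intros)
    from DERIV_add[OF airy_sin_deriv[of "real (Suc n)" y] this] show ?thesis by simp
  qed
qed auto

lemma Airy_Ai_eq: "Airy_Ai x = airy_cos_inf x / pi"
  by (simp add: Airy_Ai_def airy_cos_inf_def airy_cos_def[abs_def] airy_phase_def)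

lemma Airy_Ai_deriv: "(Airy_Ai has_real_derivative - airy_sin_inf x / pi) (at x)"
  unfolding Airy_Ai_eq[abs_def] by (auto intro!: derivative_eq_intros airy_cos_inf_deriv)

lemma deriv_Airy_Ai: "deriv Airy_Ai x = - airy_sin_inf x / pi"
  by (rule DERIV_imp_deriv[OF Airy_Ai_deriv])

lemma Airy_Ai_has_deriv: "(Airy_Ai has_real_derivative deriv Airy_Ai x) (at x)"
  using Airy_Ai_deriv deriv_Airy_Ai by metis

lemma Airy_equation: "(deriv Airy_Ai has_real_derivative x * Airy_Ai x) (at x)"
proof -
  have "((\<lambda>x. - airy_sin_inf x / pi) has_real_derivative x * airy_cos_inf x / pi) (at x)"
    by (auto intro!: derivative_eq_intros airy_sin_inf_deriv)
  then show ?thesis by (simp add: deriv_Airy_Ai[abs_def] Airy_Ai_eq)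
qed

text \<open>For fixed t the numerator of the quotient vanishes at s = t, and by the Airy equation
  its derivative in s contains no second derivative. The mean value theorem thus writes the quotient
  at an intermediate point, which tends to x whenever both arguments do.\<close>

lemma Airy_kernel_diagonal: "Airy_kernel x x = (deriv Airy_Ai x)\<^sup>2 - x * (Airy_Ai x)\<^sup>2"
proof -
  define A where "A = Airy_Ai"
  define B where "B = deriv Airy_Ai"
  have contA: "isCont A y" for y unfolding A_def by (rule DERIV_isCont[OF Airy_Ai_has_deriv])
  have contB: "isCont B y" for y unfolding B_def by (rule DERIV_isCont[OF Airy_equation])
  define L where "L = (B x)\<^sup>2 - x * (A x)\<^sup>2"
  have ex: "\<exists>z. \<bar>z - x\<bar> \<le> max \<bar>s - x\<bar> \<bar>t - x\<bar> \<and> Airy_quotient s t = B z * B t - z * A z * A t"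
    if "s \<noteq> t" for s t
  proof -
    define G where "G u = A u * B t - B u * A t" for u
    have G: "(G has_real_derivative B u * B t - u * A u * A t) (at u)" for u
      unfolding G_def A_def B_def
      by (auto intro!: derivative_eq_intros Airy_Ai_has_deriv Airy_equation)
    have G0: "G t = 0" by (simp add: G_def)
    have quot: "Airy_quotient s t = G s / (s - t)" by (simp add: Airy_quotient_def G_def A_def B_def)
    from that have "s < t \<or> t < s" by linarith
    then show ?thesis
    proof
      assume 1: "s < t"
      from MVT2[OF 1 G] obtain z where "s < z" "z < t" "G t - G s = (t - s) * (B z * B t - z * A z * A t)" by blast
      then show ?thesis using 1 G0 by (intro exI[of _ z]) (auto simp: quot field_simps)
    next
      assume 2: "t < s"
      from MVT2[OF 2 G] obtain z where "t < z" "z < s" "G s - G t = (s - t) * (B z * B t - z * A z * A t)" by blast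
      then show ?thesis using 2 G0 by (intro exI[of _ z]) (auto simp: quot field_simps)
    qed
  qed
  \<comment> \<open>A choice function for the intermediate point, so that its convergence along the
    two-variable filter can be stated.\<close>
  define Z where "Z p = (SOME z. \<bar>z - x\<bar> \<le> max \<bar>fst p - x\<bar> \<bar>snd p - x\<bar> \<and>
     Airy_quotient (fst p) (snd p) = B z * B (snd p) - z * A z * A (snd p))" for p
  have Z: "\<bar>Z p - x\<bar> \<le> max \<bar>fst p - x\<bar> \<bar>snd p - x\<bar>"
    "Airy_quotient (fst p) (snd p) = B (Z p) * B (snd p) - Z p * A (Z p) * A (snd p)"
    if "fst p \<noteq> snd p" for p
    using someI_ex[OF ex[OF that]] unfolding Z_def by auto
  let ?F = "at (x, x) within {(s, t). s \<noteq> t}"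
  have ne: "eventually (\<lambda>p. fst p \<noteq> snd p) ?F"
    by (auto simp: eventually_at_filter split_beta)
  have s: "(snd \<longlongrightarrow> x) ?F" "(fst \<longlongrightarrow> x) ?F"
    using tendsto_snd[OF tendsto_ident_at[of "(x,x)" "{(s, t). s \<noteq> t}"]]
      tendsto_fst[OF tendsto_ident_at[of "(x,x)" "{(s, t). s \<noteq> t}"]] by auto
  have "((\<lambda>p. Z p - x) \<longlongrightarrow> 0) ?F"
  proof (rule Lim_null_comparison)
    show "\<forall>\<^sub>F p in ?F. norm (Z p - x) \<le> max \<bar>fst p - x\<bar> \<bar>snd p - x\<bar>"
      using ne by eventually_elim (use Z in auto)
    have "((\<lambda>p. max \<bar>fst p - x\<bar> \<bar>snd p - x\<bar>) \<longlongrightarrow> max \<bar>x - x\<bar> \<bar>x - x\<bar>) ?F"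
      by (intro tendsto_intros s)
    then show "((\<lambda>p. max \<bar>fst p - x\<bar> \<bar>snd p - x\<bar>) \<longlongrightarrow> 0) ?F" by simp
  qed
  then have z: "(Z \<longlongrightarrow> x) ?F" using LIM_zero_cancel by blast
  have "((\<lambda>p. B (Z p) * B (snd p) - Z p * A (Z p) * A (snd p)) \<longlongrightarrow> B x * B x - x * A x * A x) ?F"
    by (intro tendsto_intros isCont_tendsto_compose[OF contA] isCont_tendsto_compose[OF contB] z s)
  then have "((\<lambda>p. Airy_quotient (fst p) (snd p)) \<longlongrightarrow> B x * B x - x * A x * A x) ?F"
    by (rule Lim_transform_eventually) (use ne Z in \<open>auto elim!: eventually_mono\<close>)
  then have lim: "((\<lambda>(s, t). Airy_quotient s t) \<longlongrightarrow> L) ?F"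
    by (simp add: case_prod_beta' L_def power2_eq_square mult.assoc)
  \<comment> \<open>Uniqueness of the limit, and with it the value of \<open>Lim\<close>, rests on
    off-diagonal points accumulating at (x, x).\<close>
  have "\<not> trivial_limit ?F"
  proof -
    have "(x, x) islimpt {(s, t). s \<noteq> t}"
      unfolding islimpt_approachable
    proof (intro allI impI)
      fix e :: real assume "e > 0"
      then show "\<exists>x'\<in>{(s, t). s \<noteq> t}. x' \<noteq> (x, x) \<and> dist x' (x, x) < e"
        by (intro bexI[of _ "(x + e / 2, x)"]) (auto simp: dist_Pair_Pair dist_real_def)
    qed
    then show ?thesis by (simp add: trivial_limit_within)
  qed
  from tendsto_Lim[OF this lim] show ?thesis
    by (simp add: Airy_kernel_def L_def A_def B_def)
qed

section \<open>Oscillatory integrals with phase \<open>tan t - t\<close>\<close>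

text \<open>The substitute for dominated convergence on an unbounded range: n tends to infinity at a
  fixed cutoff A, then A does. The tail bound has to be uniform in n only eventually, with a
  threshold that may depend on A.\<close>

lemma tendsto_via_truncation:
  fixes T :: "nat \<Rightarrow> real" and head :: "real \<Rightarrow> nat \<Rightarrow> real"
  assumes head: "\<And>A. A > 0 \<Longrightarrow> head A \<longlonglongrightarrow> H A" and lim: "(H \<longlongrightarrow> I) at_top"
    and tail: "\<And>A. A \<ge> A0 \<Longrightarrow> eventually (\<lambda>n. \<bar>T n - head A n\<bar> \<le> C / A) sequentially"
  shows "T \<longlonglongrightarrow> I"
proof (rule tendstoI)
  fix e :: real assume e: "e > 0"
  have "eventually (\<lambda>A. dist (H A) I < e / 3) at_top"
    using lim e by (intro tendstoD) auto
  moreover have "((\<lambda>A. C / A) \<longlongrightarrow> 0) at_top" by real_asymp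
  then have "eventually (\<lambda>A. dist (C / A) 0 < e / 3) at_top"
    using e by (intro tendstoD) auto
  ultimately have "eventually (\<lambda>A. dist (H A) I < e / 3 \<and> C / A < e / 3 \<and> A \<ge> A0 \<and> A > 0) at_top"
    using eventually_ge_at_top[of A0] eventually_gt_at_top[of 0]
  proof eventually_elim
    case (elim A)
    then show ?case using abs_ge_self[of "C / A"] unfolding dist_real_def by linarith
  qed
  then obtain A where A: "dist (H A) I < e / 3" "C / A < e / 3" "A \<ge> A0" "A > 0"
    using eventually_happens'[OF trivial_limit_at_top_linorder] by blast
  have "eventually (\<lambda>n. dist (head A n) (H A) < e / 3) sequentially"
    using head[OF A(4)] e by (intro tendstoD) auto
  with tail[OF A(3)] show "eventually (\<lambda>n. dist (T n) I < e) sequentially"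
  proof eventually_elim
    case (elim n)
    then show ?case using A unfolding dist_real_def by linarith
  qed
qed

text \<open>With \<open>L = d powr (-3)\<close> this is \<open>L (tan t - t) + c L\<^sup>1\<^sup>/\<^sup>3 t\<close>; rescaling \<open>t = d s\<close> turns it into the
  Airy phase \<open>s\<^sup>3 / 3 + c s\<close> as \<open>d\<close> tends to 0.\<close>

definition tan_phase :: "real \<Rightarrow> real \<Rightarrow> real \<Rightarrow> real" where
  "tan_phase d c t = (tan t - t) / d ^ 3 + c * t / d"

definition tan_phase' :: "real \<Rightarrow> real \<Rightarrow> real \<Rightarrow> real" where
  "tan_phase' d c t = (tan t)\<^sup>2 / d ^ 3 + c / d"

lemma tan_phase_deriv:
  assumes "0 \<le> t" "t < pi / 2"
  shows "(tan_phase d c has_real_derivative tan_phase' d c t) (at t)"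
proof -
  have cos: "cos t \<noteq> 0" using assms cos_gt_zero_pi[of t] pi_gt_zero by simp
  have "((\<lambda>t. (tan t - t) * k + t * e) has_real_derivative
      (inverse ((cos t)\<^sup>2) - 1) * k + e) (at t)" for k e
    using cos by (auto intro!: derivative_eq_intros)
  from this[of "inverse (d ^ 3)" "c / d"]
  have "((\<lambda>t. (tan t - t) * inverse (d ^ 3) + t * (c / d)) has_real_derivative
      (inverse ((cos t)\<^sup>2) - 1) * inverse (d ^ 3) + c / d) (at t)" .
  moreover have "inverse ((cos t)\<^sup>2) - 1 = (tan t)\<^sup>2"
    using tan_sec[OF cos] by (simp add: power_inverse)
  ultimately show ?thesis
    by (simp add: tan_phase_def[abs_def] tan_phase'_def divide_inverse mult_ac)
qed

lemma continuous_on_tan_phase: "continuous_on {0..<pi / 2} (tan_phase d c)"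
  by (rule continuous_at_imp_continuous_on) (auto intro!: DERIV_isCont tan_phase_deriv)

text \<open>The cosine power removes the essential discontinuity of the phase at \<open>\<pi> / 2\<close>.\<close>

lemma continuous_on_cos_power_mult:
  fixes h :: "real \<Rightarrow> real"
  assumes "p \<ge> 1" "continuous_on {0..<pi / 2} h" "\<And>t. \<bar>h t\<bar> \<le> 1"
  shows "continuous_on {0..pi / 2} (\<lambda>t. cos t ^ p * h t)"
  unfolding continuous_on_eq_continuous_within
proof
  fix x assume x: "x \<in> {0..pi / 2}"
  show "continuous (at x within {0..pi / 2}) (\<lambda>t. cos t ^ p * h t)"
  proof (cases "x = pi / 2")
    case True
    have "((\<lambda>t. cos t ^ p * h t) \<longlongrightarrow> 0) (at x within {0..pi / 2})"
    proof (rule Lim_null_comparison)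
      show "\<forall>\<^sub>F t in at x within {0..pi / 2}. norm (cos t ^ p * h t) \<le> \<bar>cos t\<bar> ^ p"
        using assms(3) by (intro always_eventually) (auto simp: abs_mult power_abs intro!: mult_left_le)
      have "((\<lambda>t. \<bar>cos t\<bar> ^ p) \<longlongrightarrow> \<bar>cos x\<bar> ^ p) (at x within {0..pi / 2})"
        by (intro tendsto_intros)
      moreover have "cos x = 0" unfolding True by (rule cos_pi_half)
      ultimately show "((\<lambda>t. \<bar>cos t\<bar> ^ p) \<longlongrightarrow> 0) (at x within {0..pi / 2})"
        using assms(1) by (simp add: zero_power)
    qed
    moreover have "cos x ^ p * h x = 0" using assms(1) unfolding True by (simp add: zero_power)
    ultimately show ?thesis by (simp only: continuous_within)
  next
    case False
    then have "x \<in> {0..<pi / 2}" using x by auto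
    then have "continuous (at x within {0..<pi / 2}) h"
      using assms(2) by (simp add: continuous_on_eq_continuous_within)
    moreover have "at x within {0..<pi / 2} = at x within {0..pi / 2}"
      by (rule at_within_nhd[of x "{..<pi / 2}"]) (use False x in auto)
    ultimately have "continuous (at x within {0..pi / 2}) h" by (simp add: continuous_within)
    then show ?thesis by (intro continuous_intros)
  qed
qed

text \<open>The phase is differentiable only below \<pi>/2, so tails are estimated on shorter
  intervals and the bound passes to the endpoint by continuity of the indefinite integral.\<close>

lemma abs_integral_le_if_abs_integral_subinterval_le:
  fixes f :: "real \<Rightarrow> real"
  assumes "a < b" "continuous_on {a..b} f"
    and le: "\<And>x. a \<le> x \<Longrightarrow> x < b \<Longrightarrow> \<bar>integral {a..x} f\<bar> \<le> K"
  shows "\<bar>integral {a..b} f\<bar> \<le> K"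
proof (rule tendsto_upperbound)
  have "continuous_on {a..b} (\<lambda>x. integral {a..x} f)"
    by (intro indefinite_integral_continuous_1 integrable_continuous_interval assms)
  then have "((\<lambda>x. integral {a..x} f) \<longlongrightarrow> integral {a..b} f) (at b within {a..b})"
    using assms(1) by (auto simp: continuous_on_def)
  then show "((\<lambda>x. \<bar>integral {a..x} f\<bar>) \<longlongrightarrow> \<bar>integral {a..b} f\<bar>) (at b within {a..b})"
    by (rule tendsto_rabs)
  show "\<forall>\<^sub>F x in at b within {a..b}. \<bar>integral {a..x} f\<bar> \<le> K"
    unfolding eventually_at_filter using le by (intro always_eventually) auto
  show "at b within {a..b} \<noteq> bot" using assms(1) by (simp add: at_within_Icc_at_left)
qed

section \<open>Tail bounds for the tangent phase, uniformly in the scale\<close>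

locale tan_phase_tail =
  fixes d c R A a :: real
  assumes d: "d > 0" and c: "\<bar>c\<bar> \<le> R" and A: "1 + 2 * R \<le> A" and a: "a = A * d" and api: "a < pi / 2"
begin

text \<open>In the variable s = t / d the cutoff \<open>a\<close> becomes \<open>A\<close>, and the
  threshold on \<open>A\<close> is the one used for the Airy phase in \<open>airy_phase_pos\<close>.
  The estimates below are the trigonometric counterparts of those for the Airy tails.\<close>

lemma A_ge: "1 \<le> A" "2 * R \<le> A\<^sup>2"
proof -
  have R: "0 \<le> R" using c by linarith
  then show 1: "1 \<le> A" using A by linarith
  have "A * 1 \<le> A * A" using 1 by (intro mult_left_mono) auto
  then show "2 * R \<le> A\<^sup>2" using A unfolding power2_eq_square by linarith
qed

lemma a_pos: "0 < a" using A_ge d a by simp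

lemma trig_pos:
  assumes "a \<le> t" "t < pi / 2"
  shows "0 < cos t" "0 < sin t" "a \<le> tan t" "0 < tan t"
proof -
  have t: "0 < t" using a_pos assms by linarith
  show "0 < cos t" using t assms by (intro cos_gt_zero_pi) auto
  show "0 < sin t" using t assms by (intro sin_gt_zero) auto
  have "t \<le> tan t"
  proof -
    \<comment> \<open>With d = 1 and c = 0 the phase is tan t - t, whose derivative is the
      nonnegative tan^2.\<close>
    have "tan_phase 1 0 0 \<le> tan_phase 1 0 t"
    proof (rule DERIV_nonneg_imp_nondecreasing[where f = "tan_phase 1 0"])
      show "\<exists>y. (tan_phase 1 0 has_real_derivative y) (at x) \<and> 0 \<le> y" if "0 \<le> x" "x \<le> t" for x
        using that assms by (intro exI[of _ "tan_phase' 1 0 x"] conjI tan_phase_deriv)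
          (auto simp: tan_phase'_def)
    qed (use t in auto)
    then show ?thesis by (simp add: tan_phase_def)
  qed
  then show "a \<le> tan t" using assms by linarith
  then show "0 < tan t" using a_pos by linarith
qed

text \<open>Since tan t \<ge> a = A d and A^2 \<ge> 2 R, the linear part of the phase takes away at
  most half of the derivative of its main part; no stationary point lies beyond the cutoff.\<close>

lemma c_le:
  assumes "a \<le> t" "t < pi / 2"
  shows "\<bar>c / d\<bar> \<le> (tan t)\<^sup>2 / d ^ 3 / 2"
proof -
  have "a\<^sup>2 \<le> (tan t)\<^sup>2" using trig_pos[OF assms] a_pos by (intro power_mono) auto
  then have "A\<^sup>2 * d\<^sup>2 \<le> (tan t)\<^sup>2" using a by (simp add: power_mult_distrib)
  moreover have "2 * \<bar>c\<bar> * d\<^sup>2 \<le> A\<^sup>2 * d\<^sup>2" using A_ge c by (intro mult_right_mono) auto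
  ultimately have "2 * \<bar>c\<bar> * d\<^sup>2 \<le> (tan t)\<^sup>2" by linarith
  then show ?thesis using d by (simp add: field_simps abs_divide power2_eq_square power3_eq_cube)
qed

lemma phase'_ge:
  assumes "a \<le> t" "t < pi / 2"
  shows "(tan t)\<^sup>2 / d ^ 3 / 2 \<le> tan_phase' d c t" "0 < tan_phase' d c t"
proof -
  show 1: "(tan t)\<^sup>2 / d ^ 3 / 2 \<le> tan_phase' d c t"
    using c_le[OF assms] unfolding tan_phase'_def by linarith
  have "0 < (tan t)\<^sup>2 / d ^ 3 / 2" using trig_pos[OF assms] d by simp
  with 1 show "0 < tan_phase' d c t" by linarith
qed

lemma trig_mono:
  assumes "a \<le> s" "s \<le> t" "t < pi / 2"
  shows "cos t \<le> cos s" "sin s \<le> sin t" "sin t * tan s \<le> sin s * tan t" "tan s \<le> tan t"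
proof -
  have s: "0 < s" using a_pos assms by linarith
  note ts = trig_pos[of s] trig_pos[of t]
  show cos: "cos t \<le> cos s" using s assms by (intro cos_monotone_0_pi_le) auto
  show "sin s \<le> sin t" using s assms by (intro sin_monotone_2pi_le) auto
  show "sin t * tan s \<le> sin s * tan t"
    using ts assms cos by (simp add: tan_def field_simps)
  show "tan s \<le> tan t" using s assms by (cases "s = t") (auto intro!: less_imp_le tan_monotone)
qed

lemma phase'_mono:
  assumes "a \<le> s" "s \<le> t" "t < pi / 2"
  shows "tan_phase' d c s \<le> tan_phase' d c t"
proof -
  have "(tan s)\<^sup>2 \<le> (tan t)\<^sup>2" using trig_mono[OF assms] trig_pos[of s] assms by (intro power_mono) auto
  then show ?thesis using d by (simp add: tan_phase'_def divide_right_mono)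
qed

text \<open>If the sine grows by a factor k \<ge> 1, the tangent grows by at least k, as the cosine
  decreases, and its square by k^2. With y = tan^2 s / d^3 the claim becomes k^2 y + c/d \<ge> k (y
  + c/d), that is, (k - 1) (k y - c/d) \<ge> 0.\<close>

lemma sin_over_phase'_mono:
  assumes "a \<le> s" "s \<le> t" "t < pi / 2"
  shows "sin t / tan_phase' d c t \<le> sin s / tan_phase' d c s"
proof -
  have s: "a \<le> s" "s < pi / 2" and t: "a \<le> t" "t < pi / 2" using assms by auto
  define k where "k = sin t / sin s"
  have k: "1 \<le> k" using trig_mono[OF assms] trig_pos[OF s] by (simp add: k_def)
  have sint: "sin t = k * sin s" using trig_pos[OF s] by (simp add: k_def)
  define x where "x = (tan s)\<^sup>2 / d ^ 3"
  have x: "0 < x" using trig_pos[OF s] d by (simp add: x_def)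
  have "\<bar>c / d\<bar> \<le> x / 2" using c_le[OF s] by (simp add: x_def)
  with x have cx: "c / d \<le> x" by linarith
  have "k * tan s \<le> tan t" using trig_mono(3)[OF assms] trig_pos[OF s] by (simp add: k_def field_simps)
  then have "(k * tan s)\<^sup>2 \<le> (tan t)\<^sup>2" using k trig_pos[OF s] by (intro power_mono) auto
  then have "k\<^sup>2 * x \<le> (tan t)\<^sup>2 / d ^ 3"
    using d by (simp add: x_def power_mult_distrib divide_right_mono)
  moreover have "0 \<le> (k - 1) * (k * x - c / d)"
  proof (rule mult_nonneg_nonneg)
    have "1 * x \<le> k * x" using k x by (intro mult_right_mono) auto
    then show "0 \<le> k * x - c / d" using cx by linarith
  qed (use k in auto)
  ultimately have "k * (x + c / d) \<le> (tan t)\<^sup>2 / d ^ 3 + c / d"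
    by (simp only: left_diff_distrib right_diff_distrib distrib_left power2_eq_square mult_1 mult.assoc)
  then have "k * tan_phase' d c s \<le> tan_phase' d c t" by (simp add: tan_phase'_def x_def)
  then have "sin s * (k * tan_phase' d c s) \<le> sin s * tan_phase' d c t"
    using trig_pos[OF s] by (intro mult_left_mono) auto
  then show ?thesis
    using phase'_ge(2)[OF s] phase'_ge(2)[OF t] by (simp add: sint field_simps)
qed

text \<open>The factor \<open>d\<close> is the Jacobian of t = d s: after division by it the bound
  8/A no longer depends on the scale. The amplitude at the cutoff is at most 2 d / A^2.\<close>

lemma cos_tail:
  assumes p: "p \<ge> 1"
  shows "\<bar>integral {a..pi / 2} (\<lambda>t. cos t ^ p * cos (tan_phase d c t))\<bar> \<le> 8 / A * d"
proof (rule abs_integral_le_if_abs_integral_subinterval_le[OF api])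
  have "continuous_on {0..pi / 2} (\<lambda>t. cos t ^ p * cos (tan_phase d c t))"
    by (rule continuous_on_cos_power_mult[OF p]) (auto intro!: continuous_intros continuous_on_tan_phase)
  then show "continuous_on {a..pi / 2} (\<lambda>t. cos t ^ p * cos (tan_phase d c t))"
    by (rule continuous_on_subset) (use a_pos in auto)
next
  fix b assume b: "a \<le> b" "b < pi / 2"
  have "integral {a..b} (\<lambda>t. cos t ^ p * cos (tan_phase d c t)) =
    integral {a..b} (\<lambda>t. cos t ^ p / tan_phase' d c t * (tan_phase' d c t * cos (tan_phase d c t)))"
  proof (rule integral_cong)
    fix t assume "t \<in> {a..b}"
    then have "tan_phase' d c t \<noteq> 0" using phase'_ge(2)[of t] b by auto
    then show "cos t ^ p * cos (tan_phase d c t) =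
        cos t ^ p / tan_phase' d c t * (tan_phase' d c t * cos (tan_phase d c t))" by simp
  qed
  also have "\<bar>\<dots>\<bar> \<le> 4 * (cos a ^ p / tan_phase' d c a)"
  proof (rule oscillatory_integral_bound[OF b(1), where F = "\<lambda>t. sin (tan_phase d c t)"])
    fix s t assume st: "a \<le> s" "s \<le> t" "t \<le> b"
    have s: "a \<le> s" "s < pi / 2" and t: "a \<le> t" "t < pi / 2" using st b by auto
    show "cos t ^ p / tan_phase' d c t \<le> cos s ^ p / tan_phase' d c s"
      using trig_pos[OF s] trig_pos[OF t] trig_mono[OF st(1,2) t(2)] phase'_mono[OF st(1,2) t(2)] phase'_ge(2)[OF s]
      by (intro frac_le power_mono) auto
  next
    fix t assume "t \<in> {a..b}"
    then have "0 \<le> t" "t < pi / 2" using a_pos b by auto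
    from DERIV_fun_sin[OF tan_phase_deriv[OF this]]
    show "((\<lambda>t. sin (tan_phase d c t)) has_real_derivative tan_phase' d c t * cos (tan_phase d c t)) (at t)"
      by (simp add: mult.commute)
  qed (use trig_pos[OF b] phase'_ge[OF b] in auto)
  also have "\<dots> \<le> 4 * (1 / (a\<^sup>2 / d ^ 3 / 2))"
  proof (rule mult_left_mono[OF frac_le])
    have aa: "a \<le> a" by simp
    have "a\<^sup>2 \<le> (tan a)\<^sup>2" using trig_pos[OF aa api] a_pos by (intro power_mono) auto
    then have "a\<^sup>2 / d ^ 3 / 2 \<le> (tan a)\<^sup>2 / d ^ 3 / 2" using d by (intro divide_right_mono) auto
    then show "a\<^sup>2 / d ^ 3 / 2 \<le> tan_phase' d c a" using phase'_ge(1)[OF aa api] by linarith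
    show "cos a ^ p \<le> 1" using trig_pos[OF aa api] by (intro power_le_one) auto
  qed (use a_pos d in auto)
  also have "\<dots> = 8 / A\<^sup>2 * d" using d A_ge by (simp add: a field_simps power2_eq_square power3_eq_cube)
  also have "\<dots> \<le> 8 / A * d"
    using d A_ge by (intro mult_right_mono divide_left_mono) (auto simp: power2_eq_square)
  finally show "\<bar>integral {a..b} (\<lambda>t. cos t ^ p * cos (tan_phase d c t))\<bar> \<le> 8 / A * d" .
qed

text \<open>The second factor \<open>d\<close> comes from sin t, which has size d s in the rescaled
  variable.\<close>

lemma sin_tail:
  assumes p: "p \<ge> 1"
  shows "\<bar>integral {a..pi / 2} (\<lambda>t. cos t ^ p * (sin t * sin (tan_phase d c t)))\<bar> \<le> 8 / A * d\<^sup>2"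
proof (rule abs_integral_le_if_abs_integral_subinterval_le[OF api])
  have "continuous_on {0..pi / 2} (\<lambda>t. cos t ^ p * (sin t * sin (tan_phase d c t)))"
    by (rule continuous_on_cos_power_mult[OF p])
      (auto intro!: continuous_intros continuous_on_tan_phase mult_le_one simp: abs_mult)
  then show "continuous_on {a..pi / 2} (\<lambda>t. cos t ^ p * (sin t * sin (tan_phase d c t)))"
    by (rule continuous_on_subset) (use a_pos in auto)
next
  fix b assume b: "a \<le> b" "b < pi / 2"
  have "integral {a..b} (\<lambda>t. cos t ^ p * (sin t * sin (tan_phase d c t))) =
    integral {a..b} (\<lambda>t. cos t ^ p * (sin t / tan_phase' d c t) * (tan_phase' d c t * sin (tan_phase d c t)))"
  proof (rule integral_cong)
    fix t assume "t \<in> {a..b}"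
    then have "tan_phase' d c t \<noteq> 0" using phase'_ge(2)[of t] b by auto
    then show "cos t ^ p * (sin t * sin (tan_phase d c t)) =
        cos t ^ p * (sin t / tan_phase' d c t) * (tan_phase' d c t * sin (tan_phase d c t))" by simp
  qed
  also have "\<bar>\<dots>\<bar> \<le> 4 * (cos a ^ p * (sin a / tan_phase' d c a))"
  proof (rule oscillatory_integral_bound[OF b(1), where F = "\<lambda>t. - cos (tan_phase d c t)"])
    fix s t assume st: "a \<le> s" "s \<le> t" "t \<le> b"
    have s: "a \<le> s" "s < pi / 2" and t: "a \<le> t" "t < pi / 2" using st b by auto
    show "cos t ^ p * (sin t / tan_phase' d c t) \<le> cos s ^ p * (sin s / tan_phase' d c s)"
      using trig_pos[OF s] trig_pos[OF t] trig_mono[OF st(1,2) t(2)] sin_over_phase'_mono[OF st(1,2) t(2)]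
        phase'_ge(2)[OF t]
      by (intro mult_mono power_mono) auto
  next
    fix t assume "t \<in> {a..b}"
    then have "0 \<le> t" "t < pi / 2" using a_pos b by auto
    from DERIV_minus[OF DERIV_fun_cos[OF tan_phase_deriv[OF this]]]
    show "((\<lambda>t. - cos (tan_phase d c t)) has_real_derivative tan_phase' d c t * sin (tan_phase d c t)) (at t)"
      by (simp add: mult.commute)
  qed (use trig_pos[OF b] phase'_ge[OF b] in auto)
  also have "\<dots> \<le> 4 * (1 * (a / (a\<^sup>2 / d ^ 3 / 2)))"
  proof (rule mult_left_mono[OF mult_mono[OF _ frac_le]])
    have aa: "a \<le> a" by simp
    have "a\<^sup>2 \<le> (tan a)\<^sup>2" using trig_pos[OF aa api] a_pos by (intro power_mono) auto
    then have "a\<^sup>2 / d ^ 3 / 2 \<le> (tan a)\<^sup>2 / d ^ 3 / 2" using d by (intro divide_right_mono) auto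
    then show "a\<^sup>2 / d ^ 3 / 2 \<le> tan_phase' d c a" using phase'_ge(1)[OF aa api] by linarith
    show "cos a ^ p \<le> 1" using trig_pos[OF aa api] by (intro power_le_one) auto
    show "sin a \<le> a" using a_pos by (intro sin_x_le_x) auto
    show "0 \<le> sin a / tan_phase' d c a" using trig_pos[OF aa api] phase'_ge(2)[OF aa api] by simp
  qed (use a_pos d in auto)
  also have "\<dots> = 8 / A * d\<^sup>2" using d A_ge by (simp add: a field_simps power2_eq_square power3_eq_cube)
  finally show "\<bar>integral {a..b} (\<lambda>t. cos t ^ p * (sin t * sin (tan_phase d c t)))\<bar> \<le> 8 / A * d\<^sup>2" .
qed

end

lemma integral_stretch_0:
  fixes f :: "real \<Rightarrow> real"
  assumes "continuous_on {0..A * d} f" "d > 0"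
  shows "integral {0..A * d} f = d * integral {0..A} (\<lambda>s. f (d * s))"
proof -
  have "(f has_integral integral {0..A * d} f) {0..A * d}"
    using integrable_integral[OF integrable_continuous_interval[OF assms(1)]] by simp
  from has_integral_stretch_real[OF this, of d]
  have "((\<lambda>s. f (d * s)) has_integral (1 / d) * integral {0..A * d} f) ((\<lambda>x. x / d) ` {0..A * d})"
    using assms by simp
  moreover have "(\<lambda>x. x / d) ` {0..A * d} = {0..A}"
  proof -
    have "x \<in> (\<lambda>x. x / d) ` {0..A * d}" if "x \<in> {0..A}" for x
      using that assms by (intro image_eqI[of _ _ "x * d"]) (auto intro!: mult_right_mono)
    then show ?thesis using assms by (auto simp: field_simps)
  qed
  ultimately show ?thesis using assms by (simp add: integral_unique)
qed

text \<open>The cubic term stems from tan h - h being asymptotic to h^3 / 3 at h = d s; the case s =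
  0 is separate because the quotient by h^3 is used.\<close>

lemma tan_phase_scaled_tendsto:
  assumes d: "d \<longlonglongrightarrow> 0" "\<And>n. 0 < d n" and c: "c \<longlonglongrightarrow> x" and s: "0 \<le> s"
  shows "(\<lambda>n. tan_phase (d n) (c n) (d n * s)) \<longlonglongrightarrow> airy_phase x s"
proof (cases "s = 0")
  case True
  then show ?thesis by (simp add: tan_phase_def airy_phase_def)
next
  case False
  then have s: "s > 0" using s by simp
  have "((\<lambda>h::real. (tan h - h) / h ^ 3) \<longlongrightarrow> 1 / 3) (at_right 0)" by real_asymp
  moreover have "filterlim (\<lambda>n. d n * s) (at_right 0) sequentially"
    unfolding filterlim_at using tendsto_mult_left_zero[OF d(1), of s] d(2) s
    by (auto intro!: always_eventually simp: less_imp_neq[symmetric])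
  ultimately have "(\<lambda>n. (tan (d n * s) - d n * s) / (d n * s) ^ 3) \<longlonglongrightarrow> 1 / 3"
    by (rule filterlim_compose)
  from tendsto_add[OF tendsto_mult_right[OF this, of "s ^ 3"] tendsto_mult_left[OF c, of s]]
  have "(\<lambda>n. (tan (d n * s) - d n * s) / (d n * s) ^ 3 * s ^ 3 + c n * s) \<longlonglongrightarrow> 1 / 3 * s ^ 3 + x * s"
    by (simp add: mult.commute)
  moreover have "(tan (d n * s) - d n * s) / (d n * s) ^ 3 * s ^ 3 + c n * s = tan_phase (d n) (c n) (d n * s)" for n
    using d(2)[of n] s by (simp add: tan_phase_def field_simps power_mult_distrib)
  ultimately show ?thesis by (simp add: airy_phase_def)
qed

context
  fixes d c :: "nat \<Rightarrow> real" and x :: real and p :: nat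
  assumes d: "d \<longlonglongrightarrow> 0" "\<And>n. 0 < d n" and c: "c \<longlonglongrightarrow> x" and p: "p \<ge> 1"
begin

lemma eventually_tan_phase_tail:
  assumes "A \<ge> 1 + 2 * (\<bar>x\<bar> + 1)"
  shows "eventually (\<lambda>n. tan_phase_tail (d n) (c n) (\<bar>x\<bar> + 1) A (A * d n)) sequentially"
proof -
  have "eventually (\<lambda>n. A * d n < pi / 2) sequentially"
    using tendsto_mult_right_zero[OF d(1), of A] pi_half_gt_zero by (rule order_tendstoD)
  moreover have "eventually (\<lambda>n. dist (c n) x < 1) sequentially" using c by (rule tendstoD) auto
  ultimately show ?thesis
    by eventually_elim (use assms d(2) in \<open>unfold_locales, auto simp: dist_real_def\<close>)
qed

lemma eventually_cutoff_small: "eventually (\<lambda>n. A * d n < pi / 2) sequentially"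
  using tendsto_mult_right_zero[OF d(1), of A] pi_half_gt_zero by (rule order_tendstoD)

lemma oscillatory_cos_tendsto:
  "(\<lambda>n. 1 / d n * integral {0..pi / 2} (\<lambda>t. cos t ^ p * cos (tan_phase (d n) (c n) t)))
     \<longlonglongrightarrow> airy_cos_inf x"
proof (rule tendsto_via_truncation[OF _ tendsto_airy_cos])
  let ?f = "\<lambda>n t. cos t ^ p * cos (tan_phase (d n) (c n) t)"
  have cont: "continuous_on {0..pi / 2} (?f n)" for n
    by (rule continuous_on_cos_power_mult[OF p]) (auto intro!: continuous_intros continuous_on_tan_phase)
  show "(\<lambda>n. 1 / d n * integral {0..A * d n} (?f n)) \<longlonglongrightarrow> airy_cos x A" if A: "A > 0" for A
  proof -
    \<comment> \<open>The value 0 replaces the oscillating factor as long as the rescaled range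
      reaches the singularity at \<pi>/2. For fixed A this concerns finitely many n, and it makes
      integrability available for every n.\<close>
    have "(\<lambda>n. integral {0..A} (\<lambda>s. cos (d n * s) ^ p *
        (if A * d n < pi / 2 then cos (tan_phase (d n) (c n) (d n * s)) else 0)))
        \<longlonglongrightarrow> integral {0..A} (\<lambda>s. cos (airy_phase x s))"
    proof (rule dominated_convergence(2)[where h = "\<lambda>_. 1"])
      fix n
      show "(\<lambda>s. cos (d n * s) ^ p *
        (if A * d n < pi / 2 then cos (tan_phase (d n) (c n) (d n * s)) else 0)) integrable_on {0..A}"
      proof (cases "A * d n < pi / 2")
        case True
        have "continuous_on {0..A} (\<lambda>s. ?f n (d n * s))"
        proof (rule continuous_on_compose2[OF cont])
          show "(*) (d n) ` {0..A} \<subseteq> {0..pi / 2}"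
          proof
            fix y assume "y \<in> (*) (d n) ` {0..A}"
            then obtain s where s: "s \<in> {0..A}" "y = d n * s" by auto
            then have "d n * s \<le> d n * A" using d(2)[of n] by (intro mult_left_mono) auto
            moreover have "0 \<le> d n * s" using s d(2)[of n] by simp
            moreover have "d n * A < pi / 2" using True by (simp add: mult.commute)
            ultimately show "y \<in> {0..pi / 2}" using s(2) by auto
          qed
        qed (auto intro!: continuous_intros)
        then show ?thesis using True by (auto intro!: integrable_continuous_interval)
      qed auto
    next
      fix n s
      show "norm (cos (d n * s) ^ p *
        (if A * d n < pi / 2 then cos (tan_phase (d n) (c n) (d n * s)) else 0)) \<le> 1"
        by (auto simp: abs_mult power_abs intro!: mult_le_one power_le_one)
    next
      fix s assume s: "s \<in> {0..A}"
      have "(\<lambda>n. cos (d n * s) ^ p * cos (tan_phase (d n) (c n) (d n * s)))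
         \<longlonglongrightarrow> cos (0 * s) ^ p * cos (airy_phase x s)"
        by (intro tendsto_intros d tan_phase_scaled_tendsto c) (use s d in auto)
      then have "(\<lambda>n. cos (d n * s) ^ p * cos (tan_phase (d n) (c n) (d n * s)))
         \<longlonglongrightarrow> cos (airy_phase x s)" by simp
      then show "(\<lambda>n. cos (d n * s) ^ p *
        (if A * d n < pi / 2 then cos (tan_phase (d n) (c n) (d n * s)) else 0)) \<longlonglongrightarrow> cos (airy_phase x s)"
        by (rule Lim_transform_eventually) (use eventually_cutoff_small[of A] in \<open>eventually_elim, auto\<close>)
    qed (auto simp: integrable_on_const)
    then show ?thesis unfolding airy_cos_def
    proof (rule Lim_transform_eventually)
      show "\<forall>\<^sub>F n in sequentially. integral {0..A} (\<lambda>s. cos (d n * s) ^ p *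
        (if A * d n < pi / 2 then cos (tan_phase (d n) (c n) (d n * s)) else 0)) =
        1 / d n * integral {0..A * d n} (?f n)"
        using eventually_cutoff_small[of A]
      proof eventually_elim
        case (elim n)
        have "continuous_on {0..A * d n} (?f n)"
          by (rule continuous_on_subset[OF cont]) (use elim in auto)
        from integral_stretch_0[OF this d(2)] show ?case using elim d(2)[of n] by simp
      qed
    qed
  qed
  show "\<forall>\<^sub>F n in sequentially. \<bar>1 / d n * integral {0..pi / 2} (?f n) - 1 / d n * integral {0..A * d n} (?f n)\<bar> \<le> 8 / A"
    if "A \<ge> 1 + 2 * (\<bar>x\<bar> + 1)" for A
    using eventually_tan_phase_tail[OF that]
  proof eventually_elim
    case (elim n)
    interpret tan_phase_tail "d n" "c n" "\<bar>x\<bar> + 1" A "A * d n" by (rule elim)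
    have "integral {0..A * d n} (?f n) + integral {A * d n..pi / 2} (?f n) = integral {0..pi / 2} (?f n)"
      by (rule Henstock_Kurzweil_Integration.integral_combine)
        (use a_pos api in \<open>auto intro!: integrable_continuous_interval cont\<close>)
    then have "1 / d n * integral {0..pi / 2} (?f n) - 1 / d n * integral {0..A * d n} (?f n)
      = 1 / d n * integral {A * d n..pi / 2} (?f n)"
      by (simp add: diff_divide_distrib[symmetric])
    also have "\<bar>\<dots>\<bar> \<le> 1 / d n * (8 / A * d n)"
      unfolding abs_mult using cos_tail[OF p] d by (intro mult_mono) auto
    also have "\<dots> = 8 / A" using d by simp
    finally show ?case .
  qed
qed

lemma oscillatory_sin_tendsto:
  "(\<lambda>n. 1 / (d n)\<^sup>2 * integral {0..pi / 2} (\<lambda>t. cos t ^ p * (sin t * sin (tan_phase (d n) (c n) t))))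
     \<longlonglongrightarrow> airy_sin_inf x"
proof (rule tendsto_via_truncation[OF _ tendsto_airy_sin])
  let ?f = "\<lambda>n t. cos t ^ p * (sin t * sin (tan_phase (d n) (c n) t))"
  have cont: "continuous_on {0..pi / 2} (?f n)" for n
    by (rule continuous_on_cos_power_mult[OF p])
      (auto intro!: continuous_intros continuous_on_tan_phase mult_le_one simp: abs_mult)
  show "(\<lambda>n. 1 / (d n)\<^sup>2 * integral {0..A * d n} (?f n)) \<longlonglongrightarrow> airy_sin x A" if A: "A > 0" for A
  proof -
    have "(\<lambda>n. integral {0..A} (\<lambda>s. cos (d n * s) ^ p * (sin (d n * s) / d n *
        (if A * d n < pi / 2 then sin (tan_phase (d n) (c n) (d n * s)) else 0))))
        \<longlonglongrightarrow> integral {0..A} (\<lambda>s. s * sin (airy_phase x s))"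
    \<comment> \<open>On the truncated range ordinary domination works; the majorant is |sin (d s)|
      / d \<le> s.\<close>
    proof (rule dominated_convergence(2)[where h = "\<lambda>s. s"])
      fix n
      show "(\<lambda>s. cos (d n * s) ^ p * (sin (d n * s) / d n *
        (if A * d n < pi / 2 then sin (tan_phase (d n) (c n) (d n * s)) else 0))) integrable_on {0..A}"
      proof (cases "A * d n < pi / 2")
        case True
        have "continuous_on {0..A} (\<lambda>s. ?f n (d n * s))"
        proof (rule continuous_on_compose2[OF cont])
          show "(*) (d n) ` {0..A} \<subseteq> {0..pi / 2}"
          proof
            fix y assume "y \<in> (*) (d n) ` {0..A}"
            then obtain s where s: "s \<in> {0..A}" "y = d n * s" by auto
            then have "d n * s \<le> d n * A" using d(2)[of n] by (intro mult_left_mono) auto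
            moreover have "0 \<le> d n * s" using s d(2)[of n] by simp
            moreover have "d n * A < pi / 2" using True by (simp add: mult.commute)
            ultimately show "y \<in> {0..pi / 2}" using s(2) by auto
          qed
        qed (auto intro!: continuous_intros)
        then have "continuous_on {0..A} (\<lambda>s. ?f n (d n * s) / d n)"
          using d(2)[of n] by (intro continuous_on_divide continuous_on_const) auto
        then show ?thesis using True by (auto intro!: integrable_continuous_interval simp: field_simps)
      qed auto
    next
      fix n s assume s: "s \<in> {0..A}"
      have "norm (cos (d n * s) ^ p * (sin (d n * s) / d n *
        (if A * d n < pi / 2 then sin (tan_phase (d n) (c n) (d n * s)) else 0)))
        \<le> 1 * (s * 1)"
        unfolding real_norm_def abs_mult
      proof (intro mult_mono)
        have "\<bar>sin (d n * s)\<bar> \<le> d n * s" using abs_sin_x_le_abs_x[of "d n * s"] d(2)[of n] s by auto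
        then show "\<bar>sin (d n * s) / d n\<bar> \<le> s" using d(2)[of n] by (simp add: abs_divide field_simps)
      qed (use s in \<open>auto simp: power_abs intro!: power_le_one\<close>)
      then show "norm (cos (d n * s) ^ p * (sin (d n * s) / d n *
        (if A * d n < pi / 2 then sin (tan_phase (d n) (c n) (d n * s)) else 0))) \<le> s" by simp
    next
      fix s assume s: "s \<in> {0..A}"
      have "(\<lambda>n. sin (d n * s) / d n) \<longlonglongrightarrow> s"
      proof (cases "s = 0")
        case False
        have "((\<lambda>h::real. sin h / h) \<longlongrightarrow> 1) (at_right 0)" by real_asymp
        moreover have "filterlim (\<lambda>n. d n * s) (at_right 0) sequentially"
          unfolding filterlim_at using tendsto_mult_left_zero[OF d(1), of s] d(2) s False
          by (auto intro!: always_eventually simp: less_imp_neq[symmetric])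
        ultimately have "(\<lambda>n. sin (d n * s) / (d n * s)) \<longlonglongrightarrow> 1" by (rule filterlim_compose)
        from tendsto_mult_right[OF this, of s] show ?thesis using False by simp
      qed auto
      then have "(\<lambda>n. cos (d n * s) ^ p * (sin (d n * s) / d n * sin (tan_phase (d n) (c n) (d n * s))))
         \<longlonglongrightarrow> cos (0 * s) ^ p * (s * sin (airy_phase x s))"
        by (intro tendsto_intros d tan_phase_scaled_tendsto c) (use s d in auto)
      then have "(\<lambda>n. cos (d n * s) ^ p * (sin (d n * s) / d n * sin (tan_phase (d n) (c n) (d n * s))))
         \<longlonglongrightarrow> s * sin (airy_phase x s)" by simp
      then show "(\<lambda>n. cos (d n * s) ^ p * (sin (d n * s) / d n *
        (if A * d n < pi / 2 then sin (tan_phase (d n) (c n) (d n * s)) else 0))) \<longlonglongrightarrow> s * sin (airy_phase x s)"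
        by (rule Lim_transform_eventually) (use eventually_cutoff_small[of A] in \<open>eventually_elim, auto\<close>)
    qed (auto intro!: integrable_continuous_interval continuous_intros)
    then show ?thesis unfolding airy_sin_def
    proof (rule Lim_transform_eventually)
      show "\<forall>\<^sub>F n in sequentially. integral {0..A} (\<lambda>s. cos (d n * s) ^ p * (sin (d n * s) / d n *
        (if A * d n < pi / 2 then sin (tan_phase (d n) (c n) (d n * s)) else 0))) =
        1 / (d n)\<^sup>2 * integral {0..A * d n} (?f n)"
        using eventually_cutoff_small[of A]
      proof eventually_elim
        case (elim n)
        have "continuous_on {0..A * d n} (?f n)"
          by (rule continuous_on_subset[OF cont]) (use elim in auto)
        from integral_stretch_0[OF this d(2)]
        have "1 / (d n)\<^sup>2 * integral {0..A * d n} (?f n) = 1 / d n * integral {0..A} (\<lambda>s. ?f n (d n * s))"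
          using d(2)[of n] by (simp add: power2_eq_square)
        also have "\<dots> = integral {0..A} (\<lambda>s. 1 / d n * ?f n (d n * s))" by (rule integral_mult_right[symmetric])
        finally show ?case using elim by (simp add: mult_ac)
      qed
    qed
  qed
  show "\<forall>\<^sub>F n in sequentially. \<bar>1 / (d n)\<^sup>2 * integral {0..pi / 2} (?f n) - 1 / (d n)\<^sup>2 * integral {0..A * d n} (?f n)\<bar> \<le> 8 / A"
    if "A \<ge> 1 + 2 * (\<bar>x\<bar> + 1)" for A
    using eventually_tan_phase_tail[OF that]
  proof eventually_elim
    case (elim n)
    interpret tan_phase_tail "d n" "c n" "\<bar>x\<bar> + 1" A "A * d n" by (rule elim)
    have "integral {0..A * d n} (?f n) + integral {A * d n..pi / 2} (?f n) = integral {0..pi / 2} (?f n)"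
      by (rule Henstock_Kurzweil_Integration.integral_combine)
        (use a_pos api in \<open>auto intro!: integrable_continuous_interval cont\<close>)
    then have "1 / (d n)\<^sup>2 * integral {0..pi / 2} (?f n) - 1 / (d n)\<^sup>2 * integral {0..A * d n} (?f n)
      = 1 / (d n)\<^sup>2 * integral {A * d n..pi / 2} (?f n)"
      by (simp add: diff_divide_distrib[symmetric])
    also have "\<bar>\<dots>\<bar> \<le> 1 / (d n)\<^sup>2 * (8 / A * (d n)\<^sup>2)"
      unfolding abs_mult using sin_tail[OF p] d by (intro mult_mono) auto
    also have "\<dots> = 8 / A" using d by simp
    finally show ?case .
  qed
qed

end

section \<open>Laguerre polynomials\<close>

definition lagD :: "'a::idom poly \<Rightarrow> 'a poly" where "lagD p = p - pderiv p"

text \<open>Up to normalisation this is the Laguerre polynomial of degree \<open>k\<close> with parameter \<open>n - k\<close>.\<close>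

definition lag :: "nat \<Rightarrow> nat \<Rightarrow> 'a::idom poly" where
  "lag n k = (lagD ^^ n) (Polynomial.monom 1 k)"

lemma lagD_diff: "lagD (p - q) = lagD p - lagD q"
  by (simp add: lagD_def pderiv_diff)

lemma lagD_smult: "lagD (Polynomial.smult c p) = Polynomial.smult c (lagD p)"
  by (simp add: lagD_def pderiv_smult Polynomial.smult_diff_right)

lemma lagD_pCons: "lagD (pCons 0 p) = pCons 0 (lagD p) - p"
  by (simp add: lagD_def pderiv_pCons)

lemma lag_Suc: "lag (Suc n) k = lagD (lag n k)"
  by (simp add: lag_def)

lemma lag_0: "lag 0 k = Polynomial.monom 1 k"
  by (simp add: lag_def)

lemma lag_0_right: "lag n 0 = 1"
  by (induction n) (simp_all add: lag_0 lag_Suc lagD_def)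

lemma degree_lagD_le: "degree p \<le> K \<Longrightarrow> degree (lagD p :: 'a::{idom,semiring_char_0} poly) \<le> K"
  unfolding lagD_def by (intro degree_diff_le) (auto simp: degree_pderiv)

lemma pderiv_lag_Suc: "pderiv (lag n (Suc k) :: 'a::idom poly) = Polynomial.smult (of_nat (Suc k)) (lag n k)"
proof (induction n)
  case 0
  then show ?case by (simp add: lag_0 pderiv_monom smult_monom)
next
  case (Suc n)
  have "pderiv (lag (Suc n) (Suc k) :: 'a poly) = lagD (pderiv (lag n (Suc k)))"
    by (simp add: lag_Suc lagD_def pderiv_diff)
  also have "\<dots> = Polynomial.smult (of_nat (Suc k)) (lag (Suc n) k)" by (simp only: Suc lagD_smult lag_Suc)
  finally show ?case .
qed

lemma lag_Suc_Suc: "lag (Suc n) (Suc k) = lag n (Suc k) - Polynomial.smult (of_nat (Suc k)) (lag n k)"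
  by (simp only: lag_Suc lagD_def pderiv_lag_Suc)

lemma lag_Suc_right:
  "(lag n (Suc k) :: 'a::idom poly) = pCons 0 (lag n k) - Polynomial.smult (of_nat n) (lag (n - 1) k)"
proof (induction n)
  case 0
  then show ?case by (simp add: lag_0 monom_Suc)
next
  case (Suc n)
  have "(lag (Suc n) (Suc k) :: 'a poly) = pCons 0 (lag (Suc n) k) - lag n k - Polynomial.smult (of_nat n) (lagD (lag (n - 1) k))"
    by (simp only: lag_Suc[of n "Suc k"] Suc lagD_diff lagD_pCons lagD_smult lag_Suc)
  also have "Polynomial.smult (of_nat n) (lagD (lag (n - 1) k)) = (Polynomial.smult (of_nat n) (lag n k) :: 'a poly)"
    by (cases n) (simp_all add: lag_Suc)
  finally show ?case by (simp add: smult_add_left)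
qed

lemma poly_lag_Suc_Suc:
  "poly (lag (Suc n) (Suc k)) x = poly (lag n (Suc k)) x - of_nat (Suc k) * poly (lag n k) x"
  by (simp add: lag_Suc_Suc)

lemma poly_lag_Suc_right:
  "poly (lag n (Suc k)) x = x * poly (lag n k) x - of_nat n * poly (lag (n - 1) k) x"
  by (simp add: lag_Suc_right)

text \<open>Exchanging n and m turns \<open>poly_lag_Suc_Suc\<close> into
  \<open>poly_lag_Suc_right\<close> up to powers of x, so both sides obey the same recurrence. This
  is the classical relation between the Laguerre parameters \<alpha> and -\<alpha>.\<close>

lemma lag_symmetric: "x ^ n * poly (lag n m) x = x ^ m * poly (lag m n) x"
proof (induction "n + m" arbitrary: n m rule: less_induct)
  case less
  show ?case
  proof (cases n)
    case 0
    then show ?thesis by (simp add: lag_0 lag_0_right poly_monom)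
  next
    case n: (Suc n')
    show ?thesis
    proof (cases m)
      case 0
      then show ?thesis by (simp add: lag_0 lag_0_right poly_monom)
    next
      case m: (Suc m')
      have 1: "x ^ n' * poly (lag n' m) x = x ^ m * poly (lag m n') x"
        and 2: "x ^ n' * poly (lag n' m') x = x ^ m' * poly (lag m' n') x"
        by (intro less.hyps; use n m in simp)+
      have "x ^ n * poly (lag n m) x = x * (x ^ n' * poly (lag n' m) x) - of_nat m * x * (x ^ n' * poly (lag n' m') x)"
        unfolding n m poly_lag_Suc_Suc by (simp add: algebra_simps)
      also have "\<dots> = x ^ m * poly (lag m n) x"
        unfolding 1 2 unfolding n m poly_lag_Suc_right by (simp add: algebra_simps)
      finally show ?thesis .
    qed
  qed
qed

lemma coeff_lag_of_real:
  "Polynomial.coeff (lag n k :: 'a::{real_algebra_1,idom} poly) i = of_real (Polynomial.coeff (lag n k) i)"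
proof (induction n arbitrary: i)
  case 0
  then show ?case by (simp add: lag_0)
next
  case (Suc n)
  then show ?case by (simp add: lag_Suc lagD_def coeff_pderiv)
qed

lemma degree_lag: "degree (lag n k :: 'a::{idom,semiring_char_0} poly) \<le> k"
proof (induction n)
  case 0
  show ?case unfolding lag_0 by (rule degree_monom_le)
next
  case (Suc n)
  then show ?case unfolding lag_Suc by (rule degree_lagD_le)
qed

lemma poly_lag_of_real:
  "poly (lag n k :: 'a::{real_algebra_1,idom,semiring_char_0} poly) (of_real x) = of_real (poly (lag n k) x)"
proof -
  have *: "poly p y = (\<Sum>i\<le>k. Polynomial.coeff p i * y ^ i)" if "degree p \<le> k" for p :: "'b::idom poly" and y
    unfolding poly_altdef using that by (intro sum.mono_neutral_left) (auto simp: coeff_eq_0)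
  show ?thesis
    by (simp add: *[OF degree_lag] coeff_lag_of_real[where 'a = 'a])
qed

text \<open>This is (-1)^n times the Laguerre polynomial of degree n with parameter j - n. For j = n
  - \<alpha> the parameter is -\<alpha>, and by \<open>lam_eq_lag\<close> the factor x^\<alpha> is
  built in. Dividing by n! makes differentiation lower n without a constant.\<close>

definition lam :: "nat \<Rightarrow> nat \<Rightarrow> real \<Rightarrow> real" where
  "lam j n x = poly (lag j n) x / fact n"

lemma lam_0_right: "lam j 0 x = 1"
  by (simp add: lam_def lag_0_right)

lemma lam_Suc_Suc: "lam (Suc j) (Suc n) x = lam j (Suc n) x - lam j n x"
  by (simp add: lam_def poly_lag_Suc_Suc diff_divide_distrib del: of_nat_Suc)

lemma lam_Suc_right: "real (Suc n) * lam j (Suc n) x = x * lam j n x - real j * lam (j - 1) n x"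
  by (simp add: lam_def poly_lag_Suc_right diff_divide_distrib right_diff_distrib del: of_nat_Suc)

lemma lam_has_deriv: "(lam j (Suc n) has_real_derivative lam j n x) (at x)"
  unfolding lam_def
  using DERIV_cdivide[OF poly_DERIV[of "lag j (Suc n) :: real poly" x], of "fact (Suc n)"]
  by (simp add: pderiv_lag_Suc del: of_nat_Suc)

text \<open>The gap n - j is one smaller on the left than the smaller gap on the right. This leads
  from \<alpha> + 1 and \<alpha> + 2 down to \<alpha>, hence to the cases \<alpha> < 2.\<close>

lemma lam_raise: "x * lam (Suc j) n x = real (Suc n) * lam j (Suc n) x - (real n - real j) * lam j n x"
  using lam_Suc_right[of n "Suc j" x] lam_Suc_Suc[of j n x] by (simp add: algebra_simps)

lemma lam_eq_lag: "x \<noteq> 0 \<Longrightarrow> lam m (m + a) x = x ^ a * poly (lag (m + a) m) x / fact (m + a)"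
  using lag_symmetric[of x "m + a" m] by (simp add: lam_def power_add)

section \<open>Generating function and Cauchy integral on the unit circle\<close>

lemma lam_diag_recurrence:
  "real (Suc n) * lam (Suc n) (Suc n) x + (2 * real n + 1 - x) * lam n n x + real n * lam (n - 1) (n - 1) x = 0"
proof (cases n)
  case 0
  then show ?thesis using lam_Suc_right[of 0 1 x] by (simp add: lam_0_right)
next
  case k: (Suc k)
  have "real n * lam n n x = x * lam n k x - real n * lam k k x"
    using lam_Suc_right[of k n x] k by simp
  moreover have "real (Suc n) * lam (Suc n) (Suc n) x = x * lam (Suc n) n x - real (Suc n) * lam n n x"
    using lam_Suc_right[of n "Suc n" x] by simp
  moreover have "lam (Suc n) n x = lam n n x - lam n k x" using lam_Suc_Suc[of n k x] k by simp
  then have "x * lam (Suc n) n x = x * lam n n x - x * lam n k x" by (simp add: right_diff_distrib)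
  moreover have "n - 1 = k" using k by simp
  ultimately show ?thesis by (simp add: algebra_simps)
qed

text \<open>The exponential factor of the Laguerre generating function. The other factor 1 / (1 - w)
  is kept apart because further powers of 1 - w shift the parameter.\<close>

definition lag_gen :: "real \<Rightarrow> complex \<Rightarrow> complex" where
  "lag_gen x w = exp (- of_real x * (w / (1 - w)))"

lemma lag_gen_deriv:
  assumes "w \<noteq> 1"
  shows "((\<lambda>w. lag_gen x w / (1 - w)) has_field_derivative (1 - w - of_real x) * (lag_gen x w / (1 - w)) / (1 - w)\<^sup>2) (at w)"
proof -
  have 1: "1 - w \<noteq> 0" using assms by simp
  have "((\<lambda>w. w / (1 - w)) has_field_derivative 1 / (1 - w)\<^sup>2) (at w)"
    using 1 by (auto intro!: derivative_eq_intros simp: field_simps power2_eq_square)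
  from DERIV_cmult[OF this, of "- of_real x"]
  have "(lag_gen x has_field_derivative lag_gen x w * (- of_real x / (1 - w)\<^sup>2)) (at w)"
    unfolding lag_gen_def by (intro DERIV_fun_exp) simp
  then have "((\<lambda>w. lag_gen x w / (1 - w)) has_field_derivative
     (lag_gen x w * (- of_real x / (1 - w)\<^sup>2) * (1 - w) - lag_gen x w * (- 1)) / ((1 - w) * (1 - w))) (at w)"
    using 1 by (auto intro!: derivative_eq_intros)
  moreover have "(E * (- c / u\<^sup>2) * u - E * (- 1)) / (u * u) = (u - c) * (E / u) / u\<^sup>2"
    if "u \<noteq> 0" for E u c :: complex
    using that by (simp add: divide_simps power2_eq_square) (simp add: algebra_simps)
  ultimately show ?thesis using 1 by simp
qed

lemma lag_gen_holomorphic: "1 \<notin> S \<Longrightarrow> lag_gen x holomorphic_on S"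
  unfolding lag_gen_def by (intro holomorphic_intros) auto

text \<open>The generating function solves (1 - w)^2 h' = (1 - w - x) h. Comparing coefficients
  gives the three-term recurrence of \<open>lam_diag_recurrence\<close> with alternating signs, and
  the initial value 1 fixes the solution.\<close>

lemma lag_gen_fps:
  "(\<lambda>w. lag_gen x w / (1 - w)) has_fps_expansion Abs_fps (\<lambda>n. of_real ((-1) ^ n * lam n n x))"
proof -
  let ?h = "\<lambda>w. lag_gen x w / (1 - w)"
  have hol: "?h holomorphic_on ball 0 1"
    by (intro holomorphic_intros lag_gen_holomorphic) auto
  then have "?h analytic_on {0}"
    by (intro analytic_at_ball[THEN iffD2] exI[of _ 1]) auto
  then obtain F where F: "?h has_fps_expansion F"
    using analytic_at_imp_has_fps_expansion_0 by blast
  have 1: "(\<lambda>w. (1 - w)\<^sup>2 * deriv ?h w) has_fps_expansion (1 - fps_X)\<^sup>2 * fps_deriv F"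
    by (intro fps_expansion_intros F)
  have 2: "(\<lambda>w. (1 - w - of_real x) * ?h w) has_fps_expansion (1 - fps_X - fps_const (of_real x)) * F"
    by (intro fps_expansion_intros F)
  have "eventually (\<lambda>w::complex. w \<in> ball 0 1) (nhds 0)"
    by (intro eventually_nhds_in_open) auto
  then have ev: "eventually (\<lambda>w. (1 - w)\<^sup>2 * deriv ?h w = (1 - w - of_real x) * ?h w) (nhds 0)"
  proof eventually_elim
    case (elim w)
    then have "w \<noteq> 1" by auto
    then show ?case using DERIV_imp_deriv[OF lag_gen_deriv[of w x]] by simp
  qed
  have 3: "(\<lambda>w. (1 - w - of_real x) * ?h w) has_fps_expansion (1 - fps_X)\<^sup>2 * fps_deriv F"
    using 1 has_fps_expansion_cong[OF ev refl] by (rule rev_iffD1)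
  have ode: "(1 - fps_X)\<^sup>2 * fps_deriv F = (1 - fps_X - fps_const (of_real x)) * F"
    by (rule fps_expansion_unique_complex[OF 3 2])
  have rec: "of_nat (Suc n) * fps_nth F (Suc n) - (2 * of_nat n + 1 - of_real x) * fps_nth F n
     + of_nat n * fps_nth F (n - 1) = 0" for n
  proof -
    have a: "fps_nth ((1 - fps_X)\<^sup>2 * fps_deriv F) n = fps_nth ((1 - fps_X - fps_const (of_real x)) * F) n"
      by (simp only: ode)
    have b: "(1 - fps_X)\<^sup>2 * fps_deriv F = fps_deriv F - fps_X * fps_deriv F - fps_X * fps_deriv F + fps_X * (fps_X * fps_deriv F)"
      by (simp add: power2_eq_square algebra_simps)
    have c: "(1 - fps_X - fps_const (of_real x)) * F = F - fps_X * F - fps_const (of_real x) * F"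
      by (simp add: algebra_simps)
    show ?thesis
    proof (cases n)
      case 0
      then show ?thesis using a unfolding b c by (simp add: algebra_simps)
    next
      case (Suc k)
      then show ?thesis using a
        unfolding b c fps_sub_nth fps_add_nth fps_X_mult_nth fps_mult_left_const_nth fps_deriv_nth
        by (cases k) (simp_all add: algebra_simps)
    qed
  qed
  have F0: "fps_nth F 0 = 1"
    using has_fps_expansion_imp_0_eq_fps_nth_0[OF F] by (simp add: lag_gen_def)
  \<comment> \<open>The recurrence has order two, so the preceding coefficient is carried along; at
    n = 0 truncated subtraction makes the second conjunct repeat the first.\<close>
  have "fps_nth F n = of_real ((-1) ^ n * lam n n x) \<and> fps_nth F (n - 1) = of_real ((-1) ^ (n - 1) * lam (n - 1) (n - 1) x)" for n
  proof (induction n)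
    case 0
    then show ?case by (simp add: F0 lam_0_right)
  next
    case (Suc n)
    have prev: "of_nat n * fps_nth F (n - 1) = - of_real (real n * ((-1) ^ n * lam (n - 1) (n - 1) x))"
      using Suc by (cases n) simp_all
    have "of_nat (Suc n) * fps_nth F (Suc n) = (2 * of_nat n + 1 - of_real x) * fps_nth F n - of_nat n * fps_nth F (n - 1)"
      using rec[of n] by (simp add: algebra_simps)
    also have "\<dots> = of_real ((-1) ^ n * ((2 * real n + 1 - x) * lam n n x + real n * lam (n - 1) (n - 1) x))"
      unfolding prev using Suc by (simp add: algebra_simps)
    also have "(2 * real n + 1 - x) * lam n n x + real n * lam (n - 1) (n - 1) x = - (real (Suc n) * lam (Suc n) (Suc n) x)"
      using lam_diag_recurrence[of n x] by linarith
    also have "of_real ((-1) ^ n * - (real (Suc n) * lam (Suc n) (Suc n) x)) =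
      of_nat (Suc n) * (of_real ((-1) ^ Suc n * lam (Suc n) (Suc n) x) :: complex)"
      by simp
    finally have "fps_nth F (Suc n) = of_real ((-1) ^ Suc n * lam (Suc n) (Suc n) x)"
      using mult_left_cancel[of "of_nat (Suc n) :: complex"] of_nat_neq_0 by blast
    then show ?case using Suc by simp
  qed
  then have "F = Abs_fps (\<lambda>n. of_real ((-1) ^ n * lam n n x))" by (intro fps_ext) simp
  with F show ?thesis by simp
qed

text \<open>Multiplying by 1 - w subtracts neighbouring coefficients; because of the alternating
  sign this is the sum which \<open>lam_Suc_Suc\<close> identifies as \<open>lam\<close> with its
  first index lowered by one.\<close>

lemma lag_gen_power_coeff:
  "n \<ge> q \<Longrightarrow> fps_nth ((1 - fps_X) ^ q * Abs_fps (\<lambda>n. of_real ((-1) ^ n * lam n n x) :: complex)) n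
     = of_real ((-1) ^ n * lam (n - q) n x)"
proof (induction q arbitrary: n)
  case (Suc q)
  then obtain k where k: "n = Suc k" "q \<le> k" by (cases n) auto
  define G where "G = (1 - fps_X) ^ q * Abs_fps (\<lambda>n. of_real ((-1) ^ n * lam n n x) :: complex)"
  have "(1 - fps_X) ^ Suc q * Abs_fps (\<lambda>n. of_real ((-1) ^ n * lam n n x) :: complex) = G - fps_X * G"
    by (simp add: G_def algebra_simps)
  then have "fps_nth ((1 - fps_X) ^ Suc q * Abs_fps (\<lambda>n. of_real ((-1) ^ n * lam n n x) :: complex)) n = fps_nth G n - fps_nth G k"
    by (simp add: k)
  also have "\<dots> = of_real ((-1) ^ n * (lam (Suc (k - q)) (Suc k) x + lam (k - q) k x))"
    using Suc.IH[of n] Suc.IH[of k] k by (simp add: G_def algebra_simps Suc_diff_le)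
  also have "\<dots> = of_real ((-1) ^ n * lam (n - Suc q) n x)" using k by (simp add: lam_Suc_Suc)
  finally show ?case .
qed simp

text \<open>The map w / (1 - w) sends the unit disc into the half-plane of real part at least -1/2,
  so the essential singularity at w = 1 is not felt from inside.\<close>

lemma norm_lag_gen_le:
  assumes "0 \<le> x" "norm w \<le> 1"
  shows "norm (lag_gen x w) \<le> exp (x / 2)"
\<comment> \<open>At w = 1 division by zero gives \<open>lag_gen x w\<close> the value 1, which also
  obeys the bound.\<close>
proof (cases "w = 1")
  case False
  have "Re (w / (1 - w)) \<ge> - 1 / 2"
  proof -
    have n0: "(norm (1 - w))\<^sup>2 > 0" using False by simp
    have "Re (w / (1 - w)) = Re (w * cnj (1 - w)) / (norm (1 - w))\<^sup>2"
      by (subst complex_div_cnj) (simp add: Re_divide_of_real[of _ "(norm (1 - w))\<^sup>2", simplified])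
    also have "Re (w * cnj (1 - w)) = Re w - (norm w)\<^sup>2"
      by (simp add: cmod_power2) (simp add: power2_eq_square algebra_simps)
    finally have eq: "Re (w / (1 - w)) = (Re w - (norm w)\<^sup>2) / (norm (1 - w))\<^sup>2" .
    have "(norm (1 - w))\<^sup>2 = 1 - 2 * Re w + (norm w)\<^sup>2"
      by (simp add: cmod_power2) (simp add: power2_eq_square algebra_simps)
    moreover have "(norm w)\<^sup>2 \<le> 1" using assms(2) by (simp add: power_le_one)
    ultimately have "- (1 / 2) * (norm (1 - w))\<^sup>2 \<le> Re w - (norm w)\<^sup>2" by linarith
    then show ?thesis unfolding eq using n0 by (simp add: pos_le_divide_eq)
  qed
  then have "x * (- 1 / 2) \<le> x * Re (w / (1 - w))" using assms(1) by (intro mult_left_mono) auto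
  moreover have "Re (- of_real x * z) = - (x * Re z)" for z by simp
  note this[of "w / (1 - w)"]
  ultimately have "Re (- of_real x * (w / (1 - w))) \<le> x / 2" by linarith
  then show ?thesis by (simp only: lag_gen_def norm_exp_eq_Re exp_le_cancel_iff)
qed (use assms in \<open>simp add: lag_gen_def\<close>)

text \<open>A bounded factor times a positive power of 1 - w tends to 0 at w = 1. This continuity is
  what allows the contour to be the unit circle through the singularity.\<close>

lemma lag_gen_continuous:
  assumes "0 \<le> x" "p \<ge> 1"
  shows "continuous_on (cball 0 1) (\<lambda>w. (1 - w) ^ p * lag_gen x w)"
  unfolding continuous_on_eq_continuous_within
proof
  fix w :: complex assume w: "w \<in> cball 0 1"
  show "continuous (at w within cball 0 1) (\<lambda>w. (1 - w) ^ p * lag_gen x w)"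
  proof (cases "w = 1")
    case True
    have "((\<lambda>w. (1 - w) ^ p * lag_gen x w) \<longlongrightarrow> 0) (at w within cball 0 1)"
    proof (rule Lim_null_comparison)
      show "\<forall>\<^sub>F w in at w within cball 0 1. norm ((1 - w) ^ p * lag_gen x w) \<le> norm (1 - w) ^ p * exp (x / 2)"
        unfolding eventually_at_filter using assms norm_lag_gen_le
        by (intro always_eventually) (auto simp: norm_mult norm_power intro!: mult_left_mono)
      have "((\<lambda>w. norm (1 - w) ^ p * exp (x / 2)) \<longlongrightarrow> norm (1 - w) ^ p * exp (x / 2)) (at w within cball 0 1)"
        by (intro tendsto_intros)
      then show "((\<lambda>w. norm (1 - w) ^ p * exp (x / 2)) \<longlongrightarrow> 0) (at w within cball 0 1)"
        using True assms by (simp add: zero_power)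
    qed
    moreover have "(1 - w) ^ p * lag_gen x w = 0" using True assms by (simp add: zero_power)
    ultimately show ?thesis by (simp only: continuous_within)
  next
    case False
    then have "isCont (lag_gen x) w" unfolding lag_gen_def by (intro continuous_intros) auto
    then have "isCont (\<lambda>w. (1 - w) ^ p * lag_gen x w) w" by (intro continuous_intros)
    then show ?thesis by (rule continuous_at_imp_continuous_at_within)
  qed
qed

text \<open>Cauchy's formula for the n-th Taylor coefficient, for a function continuous on the
  closed disc and holomorphic inside. One more power of 1 - w than p is spent on the denominator of
  the generating function, whence \<open>n - p - 1\<close>.\<close>

lemma lam_circle_integral:
  assumes "0 \<le> x" "p \<ge> 1" "n \<ge> p + 1"
  shows "((\<lambda>t. Re ((1 - exp (2 * of_real pi * \<i> * of_real t)) ^ p * lag_gen x (exp (2 * of_real pi * \<i> * of_real t))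
      / exp (2 * of_real pi * \<i> * of_real t) ^ n)) has_integral (-1) ^ n * lam (n - p - 1) n x) {0..1}"
proof -
  define k where "k = (\<lambda>w. (1 - w) ^ p * lag_gen x w)"
  have hol: "k holomorphic_on ball 0 1"
    unfolding k_def by (intro holomorphic_intros lag_gen_holomorphic) auto
  have "(\<lambda>w. (1 - w) ^ Suc p * (lag_gen x w / (1 - w))) has_fps_expansion
     (1 - fps_X) ^ Suc p * Abs_fps (\<lambda>n. of_real ((-1) ^ n * lam n n x))" (is "?f has_fps_expansion ?F")
    by (intro fps_expansion_intros lag_gen_fps)
  moreover have "eventually (\<lambda>w::complex. w \<in> ball 0 1) (nhds 0)"
    by (intro eventually_nhds_in_open) auto
  then have ev: "eventually (\<lambda>w. ?f w = k w) (nhds 0)"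
    by eventually_elim (auto simp: k_def)
  ultimately have "k has_fps_expansion ?F"
    using has_fps_expansion_cong[OF ev refl] by blast
  then have coeff: "(deriv ^^ n) k 0 = fact n * fps_nth ?F n"
    using fps_nth_fps_expansion[of k ?F n] by simp
  have cont: "continuous_on (cball 0 1) k" unfolding k_def by (rule lag_gen_continuous[OF assms(1,2)])
  have "((\<lambda>u. k u / u ^ Suc n) has_contour_integral 2 * of_real pi * \<i> / fact n * (deriv ^^ n) k 0) (circlepath 0 1)"
    using Cauchy_has_contour_integral_higher_derivative_circlepath[OF cont hol, of 0 n] by simp
  moreover have "2 * of_real pi * \<i> / fact n * (deriv ^^ n) k 0 = 2 * of_real pi * \<i> * of_real ((-1) ^ n * lam (n - p - 1) n x)"
  proof -
    have "(deriv ^^ n) k 0 = fact n * of_real ((-1) ^ n * lam (n - p - 1) n x)"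
      using lag_gen_power_coeff[of "Suc p" n x] assms(3) unfolding coeff by simp
    then show ?thesis by (simp only: times_divide_eq_left times_divide_eq_right) simp
  qed
  ultimately have "((\<lambda>u. k u / u ^ Suc n) has_contour_integral 2 * of_real pi * \<i> * of_real ((-1) ^ n * lam (n - p - 1) n x)) (circlepath 0 1)"
    by (simp only:)
  then have "((\<lambda>t. k (circlepath 0 1 t) / circlepath 0 1 t ^ Suc n * vector_derivative (circlepath 0 1) (at t within {0..1}))
     has_integral 2 * of_real pi * \<i> * of_real ((-1) ^ n * lam (n - p - 1) n x)) {0..1}"
    unfolding has_contour_integral_def .
  then have "((\<lambda>t. 2 * of_real pi * \<i> * (k (exp (2 * of_real pi * \<i> * of_real t)) / exp (2 * of_real pi * \<i> * of_real t) ^ n))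
     has_integral 2 * of_real pi * \<i> * of_real ((-1) ^ n * lam (n - p - 1) n x)) {0..1}"
  proof (rule has_integral_eq[rotated])
    fix t :: real assume t: "t \<in> {0..1}"
    define e where "e = exp (2 * of_real pi * \<i> * of_real t)"
    have 1: "circlepath 0 1 t = e" unfolding circlepath e_def by (simp only: mult_1 add_0 of_real_1)
    have 2: "vector_derivative (circlepath 0 1) (at t within {0..1}) = 2 * of_real pi * \<i> * e"
      using t by (simp only: atLeastAtMost_iff vector_derivative_circlepath01 e_def of_real_mult of_real_numeral of_real_1 mult_1_right)
    have 3: "e \<noteq> 0" by (simp only: e_def exp_not_eq_zero not_False_eq_True)
    have "a / e ^ Suc n * (c * e) = c * (a / e ^ n)" for a c using 3 by (simp add: field_simps)
    then show "k (circlepath 0 1 t) / circlepath 0 1 t ^ Suc n * vector_derivative (circlepath 0 1) (at t within {0..1})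
      = 2 * of_real pi * \<i> * (k (exp (2 * of_real pi * \<i> * of_real t)) / exp (2 * of_real pi * \<i> * of_real t) ^ n)"
      unfolding e_def[symmetric] 1 2 by (simp only:)
  qed
  from has_integral_mult_right[OF this, of "1 / (2 * of_real pi * \<i>)"]
  have "((\<lambda>t. k (exp (2 * of_real pi * \<i> * of_real t)) / exp (2 * of_real pi * \<i> * of_real t) ^ n)
     has_integral of_real ((-1) ^ n * lam (n - p - 1) n x)) {0..1}"
    by simp
  from has_integral_Re[OF this] show ?thesis by (simp add: k_def)
qed

text \<open>With w = - cis (2 \<phi>) one has 1 - w = 2 cos \<phi> cis \<phi> and w / (1 - w) = -(1
  + i tan \<phi>) / 2. The minus sign puts w = -1, where the phase degenerates at the edge, at
  \<phi> = 0 and the singularity w = 1 at \<phi> = \<plusminus>\<pi>/2.\<close>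

lemma lag_gen_on_circle:
  assumes "cos \<phi> \<noteq> 0"
  shows "Re ((1 - (- cis (2 * \<phi>))) ^ p * lag_gen x (- cis (2 * \<phi>)) / (- cis (2 * \<phi>)) ^ n)
    = (-1) ^ n * exp (x / 2) * ((2 * cos \<phi>) ^ p * cos (x / 2 * tan \<phi> - (2 * real n - real p) * \<phi>))"
proof -
  have 1: "1 - (- cis (2 * \<phi>)) = of_real (2 * cos \<phi>) * cis \<phi>"
    by (simp add: complex_eq_iff cos_double sin_double power2_eq_square)
       (use sin_cos_squared_add[of \<phi>] in \<open>simp add: power2_eq_square\<close>)
  have 2: "- cis (2 * \<phi>) / (1 - (- cis (2 * \<phi>))) = - Complex (1 / 2) (tan \<phi> / 2)"
  proof -
    have "- cis (2 * \<phi>) / (1 - (- cis (2 * \<phi>))) = - (cis \<phi> / of_real (2 * cos \<phi>))"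
      unfolding 1 using assms by (simp add: field_simps cis_mult)
    also have "\<dots> = - Complex (1 / 2) (tan \<phi> / 2)"
      using assms by (simp add: complex_eq_iff tan_def)
    finally show ?thesis .
  qed
  have 3: "lag_gen x (- cis (2 * \<phi>)) = of_real (exp (x / 2)) * cis (x / 2 * tan \<phi>)"
  proof -
    have "- of_real x * - Complex (1 / 2) (tan \<phi> / 2) = Complex (x / 2) (x / 2 * tan \<phi>)"
      by (simp add: complex_eq_iff)
    then show ?thesis unfolding lag_gen_def 2 by (simp add: exp_eq_polar)
  qed
  have 4: "(- cis (2 * \<phi>)) ^ n = of_real ((-1) ^ n) * cis (2 * real n * \<phi>)"
  proof -
    have "cis (2 * \<phi>) ^ n = cis (2 * real n * \<phi>)"
      unfolding Complex.DeMoivre by (rule arg_cong[of _ _ cis]) simp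
    then show ?thesis by (subst power_minus) simp
  qed
  have "(1 - (- cis (2 * \<phi>))) ^ p * lag_gen x (- cis (2 * \<phi>)) / (- cis (2 * \<phi>)) ^ n =
     of_real ((-1) ^ n * exp (x / 2) * (2 * cos \<phi>) ^ p) * cis (x / 2 * tan \<phi> - (2 * real n - real p) * \<phi>)"
  proof -
    have "(1 - (- cis (2 * \<phi>))) ^ p = of_real ((2 * cos \<phi>) ^ p) * cis (real p * \<phi>)"
      unfolding 1 power_mult_distrib Complex.DeMoivre by simp
    moreover have "1 / (- cis (2 * \<phi>)) ^ n = of_real ((-1) ^ n) * cis (- (2 * real n * \<phi>))"
      unfolding 4 by (simp add: divide_inverse cis_inverse power_inverse[symmetric])
    moreover have "cis (real p * \<phi>) * cis (x / 2 * tan \<phi>) * cis (- (2 * real n * \<phi>)) =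
        cis (x / 2 * tan \<phi> - (2 * real n - real p) * \<phi>)"
      by (simp add: cis_mult algebra_simps)
    ultimately show ?thesis
      unfolding 3 by (simp only: divide_inverse mult_1_left) (simp add: mult_ac)
  qed
  moreover have "Re (of_real r * cis t) = r * cos t" for r t by simp
  ultimately show ?thesis by (simp only: mult.assoc)
qed

section \<open>Asymptotics at the soft edge\<close>

lemma has_integral_symmetric_interval:
  fixes f :: "real \<Rightarrow> real"
  assumes f: "(f has_integral I) {0..a}" and even: "\<And>x. f (- x) = f x" and a: "0 \<le> a"
  shows "(f has_integral 2 * I) {- a..a}"
proof -
  have "((\<lambda>x. f (- x)) has_integral I) {- a..- 0}" using f by (subst has_integral_reflect_real)
  then have "(f has_integral I) {- a..0}" by (simp add: even)
  from has_integral_combine[OF _ _ this f] a show ?thesis by simp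
qed

lemma lam_integral:
  assumes x: "0 \<le> x" and p: "p \<ge> 1" and n: "n \<ge> p + 1"
  shows "lam (n - p - 1) n x = exp (x / 2) * (2 ^ (p + 1) / pi) *
    integral {0..pi / 2} (\<lambda>t. cos t ^ p * cos (x / 2 * tan t - (2 * real n - real p) * t))"
proof -
  define M where "M = 2 * real n - real p"
  define h where "h t = cos t ^ p * cos (x / 2 * tan t - M * t)" for t
  define e where "e t = exp (2 * of_real pi * \<i> * of_real t)" for t :: real
  define R where "R t = Re ((1 - e t) ^ p * lag_gen x (e t) / e t ^ n)" for t
  have "continuous_on {0..pi / 2} h"
    unfolding h_def
  proof (rule continuous_on_cos_power_mult[OF p])
    have "\<forall>t\<in>{0..<pi / 2}. cos t \<noteq> 0" using cos_gt_zero_pi by force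
    then show "continuous_on {0..<pi / 2} (\<lambda>t. cos (x / 2 * tan t - M * t))"
      by (intro continuous_intros)
  qed auto
  then have "(h has_integral integral {0..pi / 2} h) {0..pi / 2}"
    by (intro integrable_integral integrable_continuous_interval)
  moreover have "h (- t) = h t" for t
  proof -
    have "cos (x / 2 * tan (- t) - M * (- t)) = cos (- (x / 2 * tan t - M * t))" by simp
    then show ?thesis by (simp only: h_def cos_minus)
  qed
  ultimately have h: "(h has_integral 2 * integral {0..pi / 2} h) {- (pi / 2)..pi / 2}"
    by (rule has_integral_symmetric_interval) simp
  have "(R has_integral (-1) ^ n * lam (n - p - 1) n x) {0..1}"
    unfolding R_def e_def by (rule lam_circle_integral[OF x p n])
  then have "(R has_integral (-1) ^ n * lam (n - p - 1) n x) (cbox 0 1)" by simp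
  \<comment> \<open>The shift by 1/2 realises the minus sign in w = - cis (2 t), and the scale
    1/\<pi> makes t run from -\<pi>/2 to \<pi>/2.\<close>
  from has_integral_affinity[OF this, of "1 / pi" "1 / 2"]
  have "((\<lambda>t. R (t / pi + 1 / 2)) has_integral pi * ((-1) ^ n * lam (n - p - 1) n x))
      ((\<lambda>y. pi * y - pi / 2) ` {0..1})"
    by simp
  moreover have "(\<lambda>y. pi * y - pi / 2) ` {0..1} = {- (pi / 2)..pi / 2}"
  proof -
    have "y \<in> (\<lambda>y. pi * y - pi / 2) ` {0..1}" if "y \<in> {- (pi / 2)..pi / 2}" for y
      using that by (intro image_eqI[of _ _ "y / pi + 1 / 2"]) (auto simp: field_simps)
    then show ?thesis by auto
  qed
  ultimately have "((\<lambda>t. R (t / pi + 1 / 2)) has_integral pi * ((-1) ^ n * lam (n - p - 1) n x)) {- (pi / 2)..pi / 2}"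
    by simp
  then have "((\<lambda>t. (-1) ^ n * exp (x / 2) * 2 ^ p * h t) has_integral pi * ((-1) ^ n * lam (n - p - 1) n x)) {- (pi / 2)..pi / 2}"
  \<comment> \<open>At the two endpoints w = 1 and the cosine vanishes, so the trigonometric form of
    the integrand is compared only between them.\<close>
  proof (rule has_integral_spike_finite[where S = "{- (pi / 2), pi / 2}", rotated 2])
    fix t assume "t \<in> {- (pi / 2)..pi / 2} - {- (pi / 2), pi / 2}"
    then have "cos t \<noteq> 0" using cos_gt_zero_pi[of t] by force
    have "2 * of_real pi * \<i> * of_real (t / pi + 1 / 2) = \<i> * of_real pi + \<i> * of_real (2 * t)"
      by (simp add: field_simps)
    then have "e (t / pi + 1 / 2) = exp (\<i> * of_real pi) * cis (2 * t)"
      by (simp only: e_def exp_add cis_conv_exp)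
    then have e: "e (t / pi + 1 / 2) = - cis (2 * t)" by (simp add: cis_conv_exp[symmetric])
    show "(-1) ^ n * exp (x / 2) * 2 ^ p * h t = R (t / pi + 1 / 2)"
      unfolding R_def e lag_gen_on_circle[OF \<open>cos t \<noteq> 0\<close>] by (simp add: h_def M_def power_mult_distrib)
  qed simp
  moreover from has_integral_mult_right[OF h, of "(-1) ^ n * exp (x / 2) * 2 ^ p"]
  have "((\<lambda>t. (-1) ^ n * exp (x / 2) * 2 ^ p * h t) has_integral
      (-1) ^ n * exp (x / 2) * 2 ^ p * (2 * integral {0..pi / 2} h)) {- (pi / 2)..pi / 2}" .
  ultimately have "pi * ((-1) ^ n * lam (n - p - 1) n x) = (-1) ^ n * exp (x / 2) * 2 ^ p * (2 * integral {0..pi / 2} h)"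
    by (rule has_integral_unique)
  then have "pi * lam (n - p - 1) n x = exp (x / 2) * 2 ^ p * (2 * integral {0..pi / 2} h)"
    by (simp add: mult_ac)
  then show ?thesis by (simp add: h_def[abs_def] M_def field_simps)
qed

lemma tan_phase_eq:
  assumes "d > 0" "x / 2 = 1 / d ^ 3"
  shows "x / 2 * tan t - K * t = tan_phase d (d * (x / 2 - K)) t"
  unfolding tan_phase_def assms(2) using assms(1) by (simp add: field_simps)

text \<open>Raising n and the first index together keeps p and changes the phase by 2 t. Around the
  middle phase the difference of cosines is 2 sin t times a sine, and this small factor sin t yields
  the derivative of the Airy function.\<close>

lemma lam_diff_integral:
  assumes x: "0 \<le> x" and p: "p \<ge> 1" and n: "n \<ge> p + 1"
    and d: "d > 0" "x / 2 = 1 / d ^ 3"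
  shows "lam (n - p) (Suc n) x - lam (n - p - 1) n x = exp (x / 2) * (2 ^ (p + 2) / pi) *
    integral {0..pi / 2} (\<lambda>t. cos t ^ p * (sin t * sin (tan_phase d (d * (x / 2 - (2 * real n + 1 - real p))) t)))"
proof -
  let ?I = "\<lambda>c t. cos t ^ p * cos (x / 2 * tan t - c * t)"
  have int: "?I c integrable_on {0..pi / 2}" for c
    unfolding tan_phase_eq[OF d]
    by (rule integrable_continuous_interval[OF continuous_on_cos_power_mult[OF p]])
      (auto intro!: continuous_intros continuous_on_tan_phase)
  have "lam (n - p) (Suc n) x - lam (n - p - 1) n x = exp (x / 2) * (2 ^ (p + 1) / pi) *
    (integral {0..pi / 2} (?I (2 * real (Suc n) - real p)) - integral {0..pi / 2} (?I (2 * real n - real p)))"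
    using lam_integral[OF x p n] lam_integral[OF x p, of "Suc n"] n by (simp add: algebra_simps Suc_diff_le)
  also have "integral {0..pi / 2} (?I (2 * real (Suc n) - real p)) - integral {0..pi / 2} (?I (2 * real n - real p))
     = integral {0..pi / 2} (\<lambda>t. ?I (2 * real (Suc n) - real p) t - ?I (2 * real n - real p) t)"
    by (rule Henstock_Kurzweil_Integration.integral_diff[symmetric]) (rule int)+
  also have "(\<lambda>t. ?I (2 * real (Suc n) - real p) t - ?I (2 * real n - real p) t) =
    (\<lambda>t. 2 * (cos t ^ p * (sin t * sin (tan_phase d (d * (x / 2 - (2 * real n + 1 - real p))) t))))"
  proof
    fix t
    define a where "a = tan_phase d (d * (x / 2 - (2 * real n + 1 - real p))) t"
    have a: "a = x / 2 * tan t - (2 * real n + 1 - real p) * t"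
      unfolding a_def by (rule tan_phase_eq[OF d, symmetric])
    have "x / 2 * tan t - (2 * real (Suc n) - real p) * t = a - t"
      "x / 2 * tan t - (2 * real n - real p) * t = a + t"
      unfolding a by (simp_all add: algebra_simps)
    then show "?I (2 * real (Suc n) - real p) t - ?I (2 * real n - real p) t =
      2 * (cos t ^ p * (sin t * sin (tan_phase d (d * (x / 2 - (2 * real n + 1 - real p))) t)))"
      unfolding a_def[symmetric] by (simp only: cos_diff cos_add) (simp add: algebra_simps)
  qed
  also have "integral {0..pi / 2} (\<lambda>t. 2 * (cos t ^ p * (sin t * sin (tan_phase d (d * (x / 2 - (2 * real n + 1 - real p))) t)))) =
    2 * integral {0..pi / 2} (\<lambda>t. cos t ^ p * (sin t * sin (tan_phase d (d * (x / 2 - (2 * real n + 1 - real p))) t)))"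
    by (rule integral_mult_right)
  finally show ?thesis by simp
qed

section \<open>Scaling of the Laguerre polynomials at the edge\<close>

definition edge :: "real \<Rightarrow> nat \<Rightarrow> real" where
  "edge \<mu> N = 4 * real N + 2 powr (4/3) * \<mu> * real N powr (1/3)"

text \<open>The d for which x / 2 = 1 / d^3 at the edge point x. The maximum with 1 keeps it
  positive for every N and is inactive once the edge point is at least 2.\<close>

definition edge_scale :: "real \<Rightarrow> nat \<Rightarrow> real" where
  "edge_scale \<mu> N = max 1 (edge \<mu> N / 2) powr (- 1/3)"

lemma edge_scale_pos: "0 < edge_scale \<mu> N"
  by (simp add: edge_scale_def)

lemma edge_ge_2: "eventually (\<lambda>N. edge \<mu> N \<ge> 2) sequentially"
  unfolding edge_def by real_asymp

lemma edge_scale_eq: "edge \<mu> N \<ge> 2 \<Longrightarrow> edge_scale \<mu> N = (edge \<mu> N / 2) powr (- 1/3)"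
  by (simp add: edge_scale_def max_def)

lemma edge_scale_cube: "edge \<mu> N \<ge> 2 \<Longrightarrow> edge \<mu> N / 2 = 1 / edge_scale \<mu> N ^ 3"
  by (simp add: edge_scale_eq power3_eq_cube powr_add[symmetric] powr_minus_divide)

lemma edge_scale_asymp: "(\<lambda>N. real N powr (1/3) * edge_scale \<mu> N) \<longlonglongrightarrow> 2 powr (- 1/3)"
proof (rule Lim_transform_eventually)
  show "(\<lambda>N. real N powr (1/3) * (edge \<mu> N / 2) powr (- 1/3)) \<longlonglongrightarrow> 2 powr (- 1/3)"
    unfolding edge_def by real_asymp
  show "\<forall>\<^sub>F N in sequentially. real N powr (1/3) * (edge \<mu> N / 2) powr (- 1/3) = real N powr (1/3) * edge_scale \<mu> N"
    using edge_ge_2[of \<mu>] by eventually_elim (simp add: edge_scale_eq)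
qed

lemma edge_scale_tendsto_0: "edge_scale \<mu> \<longlonglongrightarrow> 0"
proof (rule Lim_transform_eventually)
  show "(\<lambda>N. (edge \<mu> N / 2) powr (- 1/3)) \<longlonglongrightarrow> 0"
    unfolding edge_def by real_asymp
  show "\<forall>\<^sub>F N in sequentially. (edge \<mu> N / 2) powr (- 1/3) = edge_scale \<mu> N"
    using edge_ge_2[of \<mu>] by eventually_elim (simp add: edge_scale_eq)
qed

text \<open>Here 2^(4/3) is calibrated: half of 2^(4/3) \<mu> N^(1/3), times a scale asymptotic to
  (2 N)^(-1/3), is \<mu>. A bounded shift K of the index disappears in the limit.\<close>

lemma edge_shift_tendsto: "(\<lambda>N. edge_scale \<mu> N * (edge \<mu> N / 2 - (2 * real N + K))) \<longlonglongrightarrow> \<mu>"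
proof -
  have "(\<lambda>N. (real N powr (1/3) * edge_scale \<mu> N) * (2 powr (1/3) * \<mu> - K * real N powr (- 1/3))) \<longlonglongrightarrow>
      2 powr (- 1/3) * (2 powr (1/3) * \<mu> - K * 0)"
    by (intro tendsto_intros edge_scale_asymp) real_asymp
  moreover have "2 powr (- 1/3) * (2 powr (1/3) * \<mu> - K * 0) = \<mu>"
    by (simp add: powr_add[symmetric] mult.assoc[symmetric])
  ultimately have "(\<lambda>N. (real N powr (1/3) * edge_scale \<mu> N) * (2 powr (1/3) * \<mu> - K * real N powr (- 1/3))) \<longlonglongrightarrow> \<mu>"
    by (simp only:)
  then show ?thesis
  proof (rule Lim_transform_eventually)
    show "\<forall>\<^sub>F N in sequentially. (real N powr (1/3) * edge_scale \<mu> N) * (2 powr (1/3) * \<mu> - K * real N powr (- 1/3))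
       = edge_scale \<mu> N * (edge \<mu> N / 2 - (2 * real N + K))"
      using eventually_gt_at_top[of 0]
    proof eventually_elim
      case (elim N)
      have "2 powr (4/3) = 2 * 2 powr (1/3 :: real)"
        using powr_add[of 2 1 "1/3 :: real"] by simp
      moreover have "real N powr (1/3) * real N powr (- 1/3) = 1"
        using elim by (simp add: powr_add[symmetric])
      ultimately show ?case by (simp add: edge_def algebra_simps)
    qed
  qed
qed

text \<open>For \<open>\<alpha> \<ge> 2\<close> the asymptotics come from the oscillatory integral; for \<open>\<alpha> < 2\<close>, where the cosine
  power in that integral would be too small, they are pulled back with the recurrence raising \<open>\<alpha>\<close>.\<close>

lemma lam_edge_asymp_ge_2:
  assumes "\<alpha> \<ge> 2"
  shows "(\<lambda>N. real N powr (1/3) * (exp (- edge \<mu> N / 2) * lam (N + a - b - \<alpha>) (N + a - b) (edge \<mu> N)))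
     \<longlonglongrightarrow> 2 ^ \<alpha> * 2 powr (- 1/3) * Airy_Ai \<mu>"
proof -
  define p where "p = \<alpha> - 1"
  have p: "p \<ge> 1" "\<alpha> = p + 1" using assms by (auto simp: p_def)
  \<comment> \<open>The index shift a - b only enters this bounded constant. It is kept general
    because the recurrences that lower \<alpha> call on neighbouring indices.\<close>
  define K where "K = 2 * (real a - real b) - real p"
  define d where "d = edge_scale \<mu>"
  define c where "c N = d N * (edge \<mu> N / 2 - (2 * real N + K))" for N
  define J where "J N = integral {0..pi / 2} (\<lambda>t. cos t ^ p * cos (tan_phase (d N) (c N) t))" for N
  have c: "c \<longlonglongrightarrow> \<mu>" unfolding c_def d_def by (rule edge_shift_tendsto)
  have "(\<lambda>N. 1 / d N * J N) \<longlonglongrightarrow> airy_cos_inf \<mu>"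
    unfolding J_def
    by (rule oscillatory_cos_tendsto) (use edge_scale_tendsto_0 edge_scale_pos c p in \<open>auto simp: d_def\<close>)
  then have "(\<lambda>N. 2 ^ \<alpha> / pi * ((real N powr (1/3) * d N) * (1 / d N * J N))) \<longlonglongrightarrow>
      2 ^ \<alpha> / pi * (2 powr (- 1/3) * airy_cos_inf \<mu>)"
    by (intro tendsto_mult_left tendsto_mult edge_scale_asymp[of \<mu>, folded d_def])
  moreover have "2 ^ \<alpha> / pi * (2 powr (- 1/3) * airy_cos_inf \<mu>) = 2 ^ \<alpha> * 2 powr (- 1/3) * Airy_Ai \<mu>"
    by (simp add: Airy_Ai_eq)
  ultimately have "(\<lambda>N. 2 ^ \<alpha> / pi * ((real N powr (1/3) * d N) * (1 / d N * J N))) \<longlonglongrightarrow>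
      2 ^ \<alpha> * 2 powr (- 1/3) * Airy_Ai \<mu>" by simp
  then show ?thesis
  proof (rule Lim_transform_eventually)
    show "\<forall>\<^sub>F N in sequentially. 2 ^ \<alpha> / pi * ((real N powr (1/3) * d N) * (1 / d N * J N)) =
      real N powr (1/3) * (exp (- edge \<mu> N / 2) * lam (N + a - b - \<alpha>) (N + a - b) (edge \<mu> N))"
      using edge_ge_2[of \<mu>] eventually_ge_at_top[of "b + \<alpha>"]
    proof eventually_elim
      case (elim N)
      have d0: "0 < d N" and d3: "edge \<mu> N / 2 = 1 / d N ^ 3"
        using edge_scale_pos edge_scale_cube elim by (auto simp: d_def)
      have n: "real (N + a - b) = real N + real a - real b" using elim by simp
      have "lam (N + a - b - p - 1) (N + a - b) (edge \<mu> N) = exp (edge \<mu> N / 2) * (2 ^ (p + 1) / pi) *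
        integral {0..pi / 2} (\<lambda>t. cos t ^ p * cos (edge \<mu> N / 2 * tan t - (2 * real (N + a - b) - real p) * t))"
        by (rule lam_integral) (use elim p in auto)
      also have "(2 * real (N + a - b) - real p) = 2 * real N + K" unfolding n K_def by simp
      also have "(\<lambda>t. cos t ^ p * cos (edge \<mu> N / 2 * tan t - (2 * real N + K) * t)) =
          (\<lambda>t. cos t ^ p * cos (tan_phase (d N) (c N) t))"
        unfolding tan_phase_eq[OF d0 d3] c_def ..
      finally have "lam (N + a - b - \<alpha>) (N + a - b) (edge \<mu> N) = exp (edge \<mu> N / 2) * (2 ^ \<alpha> / pi) * J N"
        unfolding p(2) J_def by simp
      then show ?case using d0 by (simp add: exp_minus field_simps)
    qed
  qed
qed

text \<open>Differences are smaller than the values by a factor N^(1/3), one power of the scale d.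
  The minus sign is the one in \<open>deriv_Airy_Ai\<close>, and the constant is 2 times the square
  of 2^(-1/3).\<close>

lemma lam_diff_edge_asymp_ge_2:
  assumes "\<alpha> \<ge> 2"
  shows "(\<lambda>N. real N powr (2/3) * (exp (- edge \<mu> N / 2) *
      (lam (Suc (N + a - b) - \<alpha>) (Suc (N + a - b)) (edge \<mu> N) - lam (N + a - b - \<alpha>) (N + a - b) (edge \<mu> N))))
     \<longlonglongrightarrow> - (2 ^ \<alpha> * 2 powr (1/3) * deriv Airy_Ai \<mu>)"
proof -
  define p where "p = \<alpha> - 1"
  have p: "p \<ge> 1" "\<alpha> = p + 1" using assms by (auto simp: p_def)
  define K where "K = 2 * (real a - real b) + 1 - real p"
  define d where "d = edge_scale \<mu>"
  define c where "c N = d N * (edge \<mu> N / 2 - (2 * real N + K))" for N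
  define J where "J N = integral {0..pi / 2} (\<lambda>t. cos t ^ p * (sin t * sin (tan_phase (d N) (c N) t)))" for N
  have c: "c \<longlonglongrightarrow> \<mu>" unfolding c_def d_def by (rule edge_shift_tendsto)
  have "(\<lambda>N. 1 / (d N)\<^sup>2 * J N) \<longlonglongrightarrow> airy_sin_inf \<mu>"
    unfolding J_def
    by (rule oscillatory_sin_tendsto) (use edge_scale_tendsto_0 edge_scale_pos c p in \<open>auto simp: d_def\<close>)
  then have "(\<lambda>N. 2 ^ \<alpha> * 2 / pi * ((real N powr (1/3) * d N)\<^sup>2 * (1 / (d N)\<^sup>2 * J N))) \<longlonglongrightarrow>
      2 ^ \<alpha> * 2 / pi * ((2 powr (- 1/3))\<^sup>2 * airy_sin_inf \<mu>)"
    by (intro tendsto_mult_left tendsto_mult tendsto_power edge_scale_asymp[of \<mu>, folded d_def])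
  moreover have "2 ^ \<alpha> * 2 / pi * ((2 powr (- 1/3))\<^sup>2 * airy_sin_inf \<mu>) = - (2 ^ \<alpha> * 2 powr (1/3) * deriv Airy_Ai \<mu>)"
  proof -
    have "2 * (2 powr (- 1/3))\<^sup>2 = (2 powr (1/3) :: real)"
      using powr_add[of 2 1 "- 2/3 :: real"] by (simp add: power2_eq_square powr_add[symmetric])
    then have "2 ^ \<alpha> * (2 * (2 powr (- 1/3))\<^sup>2) * airy_sin_inf \<mu> / pi = 2 ^ \<alpha> * 2 powr (1/3) * airy_sin_inf \<mu> / pi"
      by simp
    then show ?thesis by (simp add: deriv_Airy_Ai mult_ac)
  qed
  ultimately have "(\<lambda>N. 2 ^ \<alpha> * 2 / pi * ((real N powr (1/3) * d N)\<^sup>2 * (1 / (d N)\<^sup>2 * J N))) \<longlonglongrightarrow>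
      - (2 ^ \<alpha> * 2 powr (1/3) * deriv Airy_Ai \<mu>)" by simp
  then show ?thesis
  proof (rule Lim_transform_eventually)
    show "\<forall>\<^sub>F N in sequentially. 2 ^ \<alpha> * 2 / pi * ((real N powr (1/3) * d N)\<^sup>2 * (1 / (d N)\<^sup>2 * J N)) =
      real N powr (2/3) * (exp (- edge \<mu> N / 2) *
      (lam (Suc (N + a - b) - \<alpha>) (Suc (N + a - b)) (edge \<mu> N) - lam (N + a - b - \<alpha>) (N + a - b) (edge \<mu> N)))"
      using edge_ge_2[of \<mu>] eventually_ge_at_top[of "b + \<alpha>"]
    proof eventually_elim
      case (elim N)
      have d0: "0 < d N" and d3: "edge \<mu> N / 2 = 1 / d N ^ 3"
        using edge_scale_pos edge_scale_cube elim by (auto simp: d_def)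
      have n: "real (N + a - b) = real N + real a - real b" using elim by simp
      have "lam (N + a - b - p) (Suc (N + a - b)) (edge \<mu> N) - lam (N + a - b - p - 1) (N + a - b) (edge \<mu> N)
        = exp (edge \<mu> N / 2) * (2 ^ (p + 2) / pi) * integral {0..pi / 2} (\<lambda>t. cos t ^ p * (sin t *
           sin (tan_phase (d N) (d N * (edge \<mu> N / 2 - (2 * real (N + a - b) + 1 - real p))) t)))"
        by (rule lam_diff_integral[OF _ _ _ d0 d3]) (use elim p in auto)
      also have "(2 * real (N + a - b) + 1 - real p) = 2 * real N + K" unfolding n K_def by simp
      finally have key: "lam (Suc (N + a - b) - \<alpha>) (Suc (N + a - b)) (edge \<mu> N) - lam (N + a - b - \<alpha>) (N + a - b) (edge \<mu> N)
         = exp (edge \<mu> N / 2) * (2 ^ \<alpha> * 2 / pi) * J N"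
        unfolding p(2) J_def c_def by (simp add: mult.commute)
      have "(real N powr (1/3))\<^sup>2 = real N powr (2/3)"
        by (simp add: power2_eq_square powr_add[symmetric])
      then show ?case unfolding key using d0 by (simp add: exp_minus field_simps)
    qed
  qed
qed

lemma ratio_edge: "(\<lambda>N. real (Suc (N + a - b)) / edge \<mu> N) \<longlonglongrightarrow> 1 / 4"
proof (rule Lim_transform_eventually)
  show "(\<lambda>N. (real N + (real a - real b + 1)) / edge \<mu> N) \<longlonglongrightarrow> 1 / 4"
    unfolding edge_def by real_asymp
  show "\<forall>\<^sub>F N in sequentially. (real N + (real a - real b + 1)) / edge \<mu> N = real (Suc (N + a - b)) / edge \<mu> N"
    using eventually_ge_at_top[of b] by eventually_elim simp
qed

lemma inverse_edge: "(\<lambda>N. 1 / edge \<mu> N) \<longlonglongrightarrow> 0" "(\<lambda>N. real N powr (1/3) / edge \<mu> N) \<longlonglongrightarrow> 0"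
  unfolding edge_def by real_asymp+

lemma lam_raise_diff:
  "\<alpha> + 1 \<le> n \<Longrightarrow> x * lam (n - \<alpha>) n x = real (Suc n) * lam (Suc n - (\<alpha> + 2)) (Suc n) x - (real \<alpha> + 1) * lam (n - (\<alpha> + 1)) n x"
  using lam_raise[of x "n - \<alpha> - 1" n] by (simp add: Suc_diff_Suc algebra_simps)

text \<open>In the recurrence of \<open>lam_raise_diff\<close>, divided by x, the leading
  coefficient tends to 1/4 and turns 2^(\<alpha>+2) into 2^\<alpha>; the other term carries a factor
  1/x and drops out.\<close>

lemma lam_edge_asymp_step:
  assumes 1: "\<And>a b. (\<lambda>N. real N powr (1/3) * (exp (- edge \<mu> N / 2) * lam (N + a - b - (\<alpha> + 1)) (N + a - b) (edge \<mu> N)))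
       \<longlonglongrightarrow> 2 ^ (\<alpha> + 1) * 2 powr (- 1/3) * Airy_Ai \<mu>"
    and 2: "\<And>a b. (\<lambda>N. real N powr (1/3) * (exp (- edge \<mu> N / 2) * lam (N + a - b - (\<alpha> + 2)) (N + a - b) (edge \<mu> N)))
       \<longlonglongrightarrow> 2 ^ (\<alpha> + 2) * 2 powr (- 1/3) * Airy_Ai \<mu>"
  shows "(\<lambda>N. real N powr (1/3) * (exp (- edge \<mu> N / 2) * lam (N + a - b - \<alpha>) (N + a - b) (edge \<mu> N)))
       \<longlonglongrightarrow> 2 ^ \<alpha> * 2 powr (- 1/3) * Airy_Ai \<mu>"
proof -
  let ?T = "\<lambda>\<alpha> a b N. real N powr (1/3) * (exp (- edge \<mu> N / 2) * lam (N + a - b - \<alpha>) (N + a - b) (edge \<mu> N))"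
  let ?L = "\<lambda>N. real (Suc (N + a - b)) / edge \<mu> N * ?T (\<alpha> + 2) (Suc a) b N
      - (real \<alpha> + 1) * (1 / edge \<mu> N * ?T (\<alpha> + 1) a b N)"
  have "?L \<longlonglongrightarrow>
     1 / 4 * (2 ^ (\<alpha> + 2) * 2 powr (- 1/3) * Airy_Ai \<mu>) - (real \<alpha> + 1) * (0 * (2 ^ (\<alpha> + 1) * 2 powr (- 1/3) * Airy_Ai \<mu>))"
    by (intro tendsto_diff tendsto_mult tendsto_const ratio_edge inverse_edge 1 2)
  moreover have "1 / 4 * (2 ^ (\<alpha> + 2) * 2 powr (- 1/3) * Airy_Ai \<mu>) - (real \<alpha> + 1) * (0 * (2 ^ (\<alpha> + 1) * 2 powr (- 1/3) * Airy_Ai \<mu>))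
     = 2 ^ \<alpha> * 2 powr (- 1/3) * Airy_Ai \<mu>"
    by (simp add: power_add)
  ultimately have "?L \<longlonglongrightarrow> 2 ^ \<alpha> * 2 powr (- 1/3) * Airy_Ai \<mu>" by (simp only:)
  then show ?thesis
  proof (rule Lim_transform_eventually)
    show "\<forall>\<^sub>F N in sequentially. real (Suc (N + a - b)) / edge \<mu> N * ?T (\<alpha> + 2) (Suc a) b N
      - (real \<alpha> + 1) * (1 / edge \<mu> N * ?T (\<alpha> + 1) a b N) = ?T \<alpha> a b N"
      using edge_ge_2[of \<mu>] eventually_ge_at_top[of "b + \<alpha> + 1"]
    proof eventually_elim
      case (elim N)
      define n where "n = N + a - b"
      have n: "N + Suc a - b = Suc n" "\<alpha> + 1 \<le> n" using elim by (auto simp: n_def)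
      define x where "x = edge \<mu> N"
      have x: "x \<noteq> 0" using elim by (simp add: x_def)
      have "lam (n - \<alpha>) n x = (x * lam (n - \<alpha>) n x) / x" using x by simp
      also have "\<dots> = (real (Suc n) * lam (Suc n - (\<alpha> + 2)) (Suc n) x - (real \<alpha> + 1) * lam (n - (\<alpha> + 1)) n x) / x"
        by (simp only: lam_raise_diff[OF n(2)])
      finally have "lam (n - \<alpha>) n x = real (Suc n) / x * lam (Suc n - (\<alpha> + 2)) (Suc n) x - (real \<alpha> + 1) * (1 / x * lam (n - (\<alpha> + 1)) n x)"
        by (simp add: diff_divide_distrib)
      then show ?case unfolding n(1) n_def[symmetric] x_def[symmetric]
        by (simp only: right_diff_distrib mult_ac)
    qed
  qed
qed

lemma lam_edge_asymp:
  "(\<lambda>N. real N powr (1/3) * (exp (- edge \<mu> N / 2) * lam (N + a - b - \<alpha>) (N + a - b) (edge \<mu> N)))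
       \<longlonglongrightarrow> 2 ^ \<alpha> * 2 powr (- 1/3) * Airy_Ai \<mu>"
proof -
  have 1: "(\<lambda>N. real N powr (1/3) * (exp (- edge \<mu> N / 2) * lam (N + a - b - 1) (N + a - b) (edge \<mu> N)))
       \<longlonglongrightarrow> 2 ^ 1 * 2 powr (- 1/3) * Airy_Ai \<mu>" for a b
    by (rule lam_edge_asymp_step; rule lam_edge_asymp_ge_2) simp_all
  have 0: "(\<lambda>N. real N powr (1/3) * (exp (- edge \<mu> N / 2) * lam (N + a - b - 0) (N + a - b) (edge \<mu> N)))
       \<longlonglongrightarrow> 2 ^ 0 * 2 powr (- 1/3) * Airy_Ai \<mu>"
    by (rule lam_edge_asymp_step) (use 1 lam_edge_asymp_ge_2[of 2] in \<open>simp_all add: numeral_2_eq_2\<close>)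
  consider "\<alpha> = 0" | "\<alpha> = 1" | "\<alpha> \<ge> 2" by linarith
  then show ?thesis by cases (use 0 1[of a b] lam_edge_asymp_ge_2 in auto)
qed

text \<open>Subtracting the recurrences at n and n + 1 leaves one undifferenced term, as their
  leading coefficients differ by 1. Under the weight N^(2/3) it is a bounded quantity times N^(1/3)
  / x, hence negligible.\<close>

lemma lam_diff_edge_asymp_step:
  assumes 1: "\<And>a b. (\<lambda>N. real N powr (2/3) * (exp (- edge \<mu> N / 2) *
      (lam (Suc (N + a - b) - (\<alpha> + 1)) (Suc (N + a - b)) (edge \<mu> N) - lam (N + a - b - (\<alpha> + 1)) (N + a - b) (edge \<mu> N))))
     \<longlonglongrightarrow> - (2 ^ (\<alpha> + 1) * 2 powr (1/3) * deriv Airy_Ai \<mu>)"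
    and 2: "\<And>a b. (\<lambda>N. real N powr (2/3) * (exp (- edge \<mu> N / 2) *
      (lam (Suc (N + a - b) - (\<alpha> + 2)) (Suc (N + a - b)) (edge \<mu> N) - lam (N + a - b - (\<alpha> + 2)) (N + a - b) (edge \<mu> N))))
     \<longlonglongrightarrow> - (2 ^ (\<alpha> + 2) * 2 powr (1/3) * deriv Airy_Ai \<mu>)"
  shows "(\<lambda>N. real N powr (2/3) * (exp (- edge \<mu> N / 2) *
      (lam (Suc (N + a - b) - \<alpha>) (Suc (N + a - b)) (edge \<mu> N) - lam (N + a - b - \<alpha>) (N + a - b) (edge \<mu> N))))
     \<longlonglongrightarrow> - (2 ^ \<alpha> * 2 powr (1/3) * deriv Airy_Ai \<mu>)"
proof -
  let ?U = "\<lambda>\<alpha> a b N. real N powr (2/3) * (exp (- edge \<mu> N / 2) *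
      (lam (Suc (N + a - b) - \<alpha>) (Suc (N + a - b)) (edge \<mu> N) - lam (N + a - b - \<alpha>) (N + a - b) (edge \<mu> N)))"
  let ?T = "\<lambda>\<alpha> a b N. real N powr (1/3) * (exp (- edge \<mu> N / 2) * lam (N + a - b - \<alpha>) (N + a - b) (edge \<mu> N))"
  let ?L = "\<lambda>N. real (Suc (N + a - b)) / edge \<mu> N * ?U (\<alpha> + 2) (Suc a) b N
      + real N powr (1/3) / edge \<mu> N * ?T (\<alpha> + 2) (Suc (Suc a)) b N
      - (real \<alpha> + 1) * (1 / edge \<mu> N * ?U (\<alpha> + 1) a b N)"
  have "?L \<longlonglongrightarrow>
     1 / 4 * (- (2 ^ (\<alpha> + 2) * 2 powr (1/3) * deriv Airy_Ai \<mu>)) + 0 * (2 ^ (\<alpha> + 2) * 2 powr (- 1/3) * Airy_Ai \<mu>)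
      - (real \<alpha> + 1) * (0 * (- (2 ^ (\<alpha> + 1) * 2 powr (1/3) * deriv Airy_Ai \<mu>)))"
    by (intro tendsto_diff tendsto_add tendsto_mult tendsto_const ratio_edge inverse_edge 1 2 lam_edge_asymp)
  moreover have "1 / 4 * (- (2 ^ (\<alpha> + 2) * 2 powr (1/3) * deriv Airy_Ai \<mu>)) + 0 * (2 ^ (\<alpha> + 2) * 2 powr (- 1/3) * Airy_Ai \<mu>)
      - (real \<alpha> + 1) * (0 * (- (2 ^ (\<alpha> + 1) * 2 powr (1/3) * deriv Airy_Ai \<mu>)))
     = - (2 ^ \<alpha> * 2 powr (1/3) * deriv Airy_Ai \<mu>)"
    by (simp add: power_add)
  ultimately have "?L \<longlonglongrightarrow> - (2 ^ \<alpha> * 2 powr (1/3) * deriv Airy_Ai \<mu>)" by (simp only:)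
  then show ?thesis
  proof (rule Lim_transform_eventually)
    show "\<forall>\<^sub>F N in sequentially. ?L N = ?U \<alpha> a b N"
      using edge_ge_2[of \<mu>] eventually_ge_at_top[of "b + \<alpha> + 1"]
    proof eventually_elim
      case (elim N)
      define n where "n = N + a - b"
      have n: "N + Suc a - b = Suc n" "N + Suc (Suc a) - b = Suc (Suc n)" "\<alpha> + 1 \<le> n" "\<alpha> + 1 \<le> Suc n"
        using elim by (auto simp: n_def)
      define x where "x = edge \<mu> N"
      have x: "x \<noteq> 0" using elim by (simp add: x_def)
      define A where "A = lam (Suc (Suc n) - (\<alpha> + 2)) (Suc (Suc n)) x"
      define B where "B = lam (Suc n - (\<alpha> + 2)) (Suc n) x"
      define C where "C = lam (Suc n - (\<alpha> + 1)) (Suc n) x"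
      define D where "D = lam (n - (\<alpha> + 1)) n x"
      have "x * lam (Suc n - \<alpha>) (Suc n) x = (real n + 2) * A - (real \<alpha> + 1) * C"
        using lam_raise_diff[OF n(4), of x] by (simp add: A_def C_def)
      moreover have "x * lam (n - \<alpha>) n x = (real n + 1) * B - (real \<alpha> + 1) * D"
        using lam_raise_diff[OF n(3), of x] by (simp add: B_def D_def)
      ultimately have "x * (lam (Suc n - \<alpha>) (Suc n) x - lam (n - \<alpha>) n x) =
         (real n + 1) * (A - B) + A - (real \<alpha> + 1) * (C - D)"
        by (simp add: algebra_simps)
      then have key: "lam (Suc n - \<alpha>) (Suc n) x - lam (n - \<alpha>) n x =
         ((real n + 1) * (A - B) + A - (real \<alpha> + 1) * (C - D)) / x"
        using x by (simp add: eq_divide_eq mult.commute)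
      have pw: "real N powr (2/3) = real N powr (1/3) * real N powr (1/3)"
        by (simp add: powr_add[symmetric])
      show ?case unfolding n(1,2) n_def[symmetric] x_def[symmetric] key pw
          A_def[symmetric] B_def[symmetric] C_def[symmetric] D_def[symmetric] of_nat_Suc
        by (simp add: add_divide_distrib diff_divide_distrib algebra_simps)
    qed
  qed
qed

lemma lam_diff_edge_asymp:
  "(\<lambda>N. real N powr (2/3) * (exp (- edge \<mu> N / 2) *
      (lam (Suc (N + a - b) - \<alpha>) (Suc (N + a - b)) (edge \<mu> N) - lam (N + a - b - \<alpha>) (N + a - b) (edge \<mu> N))))
     \<longlonglongrightarrow> - (2 ^ \<alpha> * 2 powr (1/3) * deriv Airy_Ai \<mu>)"
proof -
  have 1: "(\<lambda>N. real N powr (2/3) * (exp (- edge \<mu> N / 2) *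
      (lam (Suc (N + a - b) - 1) (Suc (N + a - b)) (edge \<mu> N) - lam (N + a - b - 1) (N + a - b) (edge \<mu> N))))
     \<longlonglongrightarrow> - (2 ^ 1 * 2 powr (1/3) * deriv Airy_Ai \<mu>)" for a b
    by (rule lam_diff_edge_asymp_step; rule lam_diff_edge_asymp_ge_2) simp_all
  have 0: "(\<lambda>N. real N powr (2/3) * (exp (- edge \<mu> N / 2) *
      (lam (Suc (N + a - b) - 0) (Suc (N + a - b)) (edge \<mu> N) - lam (N + a - b - 0) (N + a - b) (edge \<mu> N))))
     \<longlonglongrightarrow> - (2 ^ 0 * 2 powr (1/3) * deriv Airy_Ai \<mu>)"
    by (rule lam_diff_edge_asymp_step) (use 1 lam_diff_edge_asymp_ge_2[of 2] in \<open>simp_all add: numeral_2_eq_2\<close>)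
  consider "\<alpha> = 0" | "\<alpha> = 1" | "\<alpha> \<ge> 2" by linarith
  then show ?thesis by cases (use 0 1[of a b] lam_diff_edge_asymp_ge_2 in auto)
qed

section \<open>Laguerre kernels\<close>

text \<open>The Christoffel-Darboux kernel of the weight x^\<alpha> exp (-x):
  \<open>lag (k + \<alpha>) k\<close> is (-1)^k k! times the Laguerre polynomial, whose squared norm
  is (k + \<alpha>)! / k!.\<close>

definition lag_kernel :: "nat \<Rightarrow> nat \<Rightarrow> 'a::field_char_0 \<Rightarrow> 'a \<Rightarrow> 'a" where
  "lag_kernel \<alpha> m x y =
     (\<Sum>k\<le>m. poly (lag (k + \<alpha>) k) x * poly (lag (k + \<alpha>) k) y / (fact (k + \<alpha>) * fact k))"

text \<open>The two polynomials share n, so their parameters differ by one. Replacing the first by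
  \<open>lag (Suc n) (Suc m)\<close> changes it by a multiple of the second, which the determinant
  ignores; so this is the usual Christoffel-Darboux numerator. In this form \<open>lagD\<close> in
  both variables simply raises n.\<close>

definition lag_wronskian :: "nat \<Rightarrow> nat \<Rightarrow> 'a::field_char_0 \<Rightarrow> 'a \<Rightarrow> 'a" where
  "lag_wronskian n m x y =
     poly (lag n (Suc m)) x * poly (lag n m) y - poly (lag n m) x * poly (lag n (Suc m)) y"

lemma lag_wronskian_0: "lag_wronskian n 0 x y = x - y"
proof -
  have "poly (lag n (Suc 0)) z = z - of_nat n" for z :: 'a
    by (simp add: poly_lag_Suc_right lag_0_right)
  then show ?thesis by (simp add: lag_wronskian_def lag_0_right)
qed

text \<open>Both indices are raised so that n - m stays fixed; each step then contributes one
  summand of the kernel with that parameter.\<close>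

lemma lag_wronskian_Suc:
  "lag_wronskian (Suc n) (Suc m) x y = (x - y) * poly (lag (Suc n) (Suc m)) x * poly (lag (Suc n) (Suc m)) y
     + of_nat (Suc n) * of_nat (Suc m) * lag_wronskian n m x y"
proof -
  define a where "a z = poly (lag n (Suc m)) z" for z :: 'a
  define b where "b z = poly (lag n m) z" for z :: 'a
  define M N :: 'a where "M = of_nat (Suc m)" and "N = of_nat (Suc n)"
  have 1: "poly (lag (Suc n) (Suc m)) z = a z - M * b z" for z
    by (simp only: poly_lag_Suc_Suc a_def b_def M_def)
  have 2: "poly (lag (Suc n) (Suc (Suc m))) z = z * (a z - M * b z) - N * a z" for z
    by (simp only: poly_lag_Suc_right[of "Suc n" "Suc m"] 1 N_def a_def diff_Suc_1)
  show ?thesis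
    unfolding lag_wronskian_def 1 2 unfolding a_def[symmetric] b_def[symmetric] M_def[symmetric] N_def[symmetric]
    by (simp add: algebra_simps)
qed

lemma lag_kernel_christoffel_darboux:
  "(x - y) * lag_kernel \<alpha> m x y * (fact (m + \<alpha>) * fact m) = lag_wronskian (m + \<alpha>) m x y"
proof (induction m)
  case 0
  then show ?case by (simp add: lag_kernel_def lag_wronskian_0 lag_0_right)
next
  case (Suc m)
  have "lag_kernel \<alpha> (Suc m) x y * (fact (Suc m + \<alpha>) * fact (Suc m)) =
      lag_kernel \<alpha> m x y * (fact (m + \<alpha>) * fact m) * (of_nat (Suc (m + \<alpha>)) * of_nat (Suc m))
      + poly (lag (Suc m + \<alpha>) (Suc m)) x * poly (lag (Suc m + \<alpha>) (Suc m)) y"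
    by (simp add: lag_kernel_def distrib_right del: of_nat_Suc)
  then have "(x - y) * lag_kernel \<alpha> (Suc m) x y * (fact (Suc m + \<alpha>) * fact (Suc m)) =
      (x - y) * lag_kernel \<alpha> m x y * (fact (m + \<alpha>) * fact m) * (of_nat (Suc (m + \<alpha>)) * of_nat (Suc m))
      + (x - y) * (poly (lag (Suc m + \<alpha>) (Suc m)) x * poly (lag (Suc m + \<alpha>) (Suc m)) y)"
    by (simp only: mult.assoc distrib_left)
  also have "\<dots> = lag_wronskian (Suc m + \<alpha>) (Suc m) x y"
    unfolding Suc.IH by (simp add: lag_wronskian_Suc mult_ac del: of_nat_Suc)
  finally show ?case .
qed

lemma lag_kernel_of_real: "lag_kernel \<alpha> m (complex_of_real x) (complex_of_real y) = of_real (lag_kernel \<alpha> m x y)"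
  by (simp add: lag_kernel_def poly_lag_of_real)

text \<open>At the edge both polynomials of the Wronskian are to leading order multiples of the same
  function, so their asymptotics alone would cancel. Written with \<open>A\<close> and the
  difference \<open>B\<close>, this part cancels algebraically, and only products of
  \<open>A\<close> with \<open>B\<close> remain.\<close>

lemma lag_kernel_lam:
  fixes x y :: real and m \<alpha> :: nat
  assumes "x \<noteq> 0" "y \<noteq> 0"
  defines "n \<equiv> m + \<alpha>"
  defines "A \<equiv> lam m n" and "B \<equiv> \<lambda>x. lam (Suc m) (Suc n) x - lam m n x"
  shows "(x - y) * ((x * y) ^ \<alpha> * lag_kernel \<alpha> m x y) = fact (Suc n) / fact m * (B x * A y - A x * B y)"
proof -
  have A: "z ^ \<alpha> * poly (lag n m) z = fact n * A z" if "z \<noteq> 0" for z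
    using lam_eq_lag[OF that, of m \<alpha>] by (simp add: A_def n_def)
  have B: "z ^ \<alpha> * poly (lag n (Suc m)) z = fact (Suc n) * (A z + B z) + real (Suc m) * (fact n * A z)" if "z \<noteq> 0" for z
  proof -
    have "z ^ \<alpha> * poly (lag (Suc n) (Suc m)) z = fact (Suc n) * (A z + B z)"
      using lam_eq_lag[OF that, of "Suc m" \<alpha>] by (simp add: A_def B_def n_def)
    then show ?thesis unfolding poly_lag_Suc_Suc A[OF that, symmetric] by (simp add: algebra_simps)
  qed
  have "(x * y) ^ \<alpha> * lag_wronskian n m x y =
     (x ^ \<alpha> * poly (lag n (Suc m)) x) * (y ^ \<alpha> * poly (lag n m) y) - (x ^ \<alpha> * poly (lag n m) x) * (y ^ \<alpha> * poly (lag n (Suc m)) y)"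
    by (simp add: lag_wronskian_def power_mult_distrib algebra_simps)
  also have "\<dots> = fact (Suc n) * fact n * (B x * A y - A x * B y)"
    unfolding A[OF assms(1)] A[OF assms(2)] B[OF assms(1)] B[OF assms(2)] by (simp add: algebra_simps)
  finally have "(x - y) * ((x * y) ^ \<alpha> * lag_kernel \<alpha> m x y) * (fact n * fact m) = fact (Suc n) * fact n * (B x * A y - A x * B y)"
    unfolding lag_kernel_christoffel_darboux[of x y \<alpha> m, symmetric, folded n_def] by (simp add: mult_ac)
  then have "((x - y) * ((x * y) ^ \<alpha> * lag_kernel \<alpha> m x y) * fact m) * fact n = (fact (Suc n) * (B x * A y - A x * B y)) * fact n"
    by (simp add: mult_ac)
  then have "(x - y) * ((x * y) ^ \<alpha> * lag_kernel \<alpha> m x y) * fact m = fact (Suc n) * (B x * A y - A x * B y)"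
    by (simp only: mult_right_cancel[OF fact_nonzero])
  then show ?thesis by (simp add: eq_divide_eq)
qed

text \<open>The off-diagonal identity is differentiated at the diagonal. The derivative brings in
  \<open>lam m k\<close>, which the recurrences eliminate after multiplication by x, leaving a
  quadratic form in the two quantities with known asymptotics.\<close>

lemma lag_kernel_lam_diagonal:
  fixes x :: real and m \<alpha> k :: nat
  assumes x: "x > 0" and n: "m + \<alpha> = Suc k"
  defines "n \<equiv> m + \<alpha>"
  defines "A \<equiv> lam m n x" and "B \<equiv> lam (Suc m) (Suc n) x - lam m n x"
  shows "x * ((x * x) ^ \<alpha> * lag_kernel \<alpha> m x x) = fact (Suc n) / fact m *
    ((2 * real n + 2 * real m + 4 - x) * A\<^sup>2 + (3 * real n + real m + 4 - x) * A * B + (real n + 1) * B\<^sup>2)"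
proof -
  define C where "C = fact (Suc n) / (fact m :: real)"
  define A' where "A' = lam m k x"
  have n': "n = Suc k" by (simp add: n_def n)
  define g where "g t = (t * x) ^ \<alpha> * lag_kernel \<alpha> m t x" for t
  have dA: "(lam m n has_real_derivative A') (at x)"
    unfolding A'_def n' by (rule lam_has_deriv)
  have dAB: "(lam (Suc m) (Suc n) has_real_derivative A - A') (at x)"
    using lam_has_deriv[of "Suc m" n x] lam_Suc_Suc[of m k x] by (simp add: A'_def A_def n')
  have "((\<lambda>t. C * ((lam (Suc m) (Suc n) t - lam m n t) * A - lam m n t * B)) has_real_derivative C * ((A - A' - A') * A - A' * B)) (at x)"
    by (auto intro!: derivative_eq_intros dA dAB)
  then have 1: "((\<lambda>t. (t - x) * g t) has_real_derivative C * ((A - A' - A') * A - A' * B)) (at x)"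
  proof (rule has_field_derivative_transform_within_open[where S = "{0<..}"])
    fix t assume "t \<in> {0::real<..}"
    then show "C * ((lam (Suc m) (Suc n) t - lam m n t) * A - lam m n t * B) = (t - x) * g t"
      using lag_kernel_lam[of t x \<alpha> m] x by (simp add: g_def C_def A_def B_def n_def)
  qed (use x in auto)
  have "\<exists>g'. (g has_real_derivative g') (at x)"
  proof -
    have "(\<lambda>t. (t * x) ^ \<alpha> * lag_kernel \<alpha> m t x) field_differentiable at x"
      unfolding lag_kernel_def
      by (intro derivative_intros field_differentiable_sum)
        (auto simp: field_differentiable_def intro!: exI derivative_eq_intros)
    then show ?thesis by (simp add: g_def[abs_def] field_differentiable_def)
  qed
  then obtain g' where g': "(g has_real_derivative g') (at x)" by blast
  \<comment> \<open>At the zero of t - x the product rule leaves the value of \<open>g\<close>,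
    independently of its derivative.\<close>
  have "((\<lambda>t. (t - x) * g t) has_real_derivative g x) (at x)"
    by (auto intro!: derivative_eq_intros g')
  from DERIV_unique[OF this 1] have "g x = C * ((A - A' - A') * A - A' * B)" .
  moreover have "x * A' = (x - real n - real m - 2) * A - (real n + 1) * B"
  proof -
    have "real (Suc n) * (A + B) = x * lam (Suc m) n x - real (Suc m) * A"
      using lam_Suc_right[of n "Suc m" x] by (simp add: A_def B_def)
    moreover have "lam (Suc m) n x = A - A'"
      using lam_Suc_Suc[of m k x] by (simp add: A_def A'_def n')
    ultimately show ?thesis by (simp add: algebra_simps)
  qed
  then have "x * ((A - A' - A') * A - A' * B) = x * A\<^sup>2 - ((x - real n - real m - 2) * A - (real n + 1) * B) * (2 * A + B)"
    by (simp only: \<open>x * A' = _\<close>[symmetric]) (simp add: algebra_simps power2_eq_square)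
  then have "x * ((A - A' - A') * A - A' * B) =
    (2 * real n + 2 * real m + 4 - x) * A\<^sup>2 + (3 * real n + real m + 4 - x) * A * B + (real n + 1) * B\<^sup>2"
    by (simp add: algebra_simps power2_eq_square)
  ultimately have "x * g x = C * ((2 * real n + 2 * real m + 4 - x) * A\<^sup>2 + (3 * real n + real m + 4 - x) * A * B + (real n + 1) * B\<^sup>2)"
    by (simp add: mult.left_commute)
  then show ?thesis by (simp add: g_def C_def)
qed

section \<open>Edge limits of the Laguerre kernels\<close>

lemma fact_ratio_asymp:
  "(\<lambda>N. fact (Suc (N - j)) / (fact (N - j - \<alpha>) * real N ^ Suc \<alpha>)) \<longlonglongrightarrow> 1"
proof (induction \<alpha>)
  case 0
  have "(\<lambda>N. (real N - real j + 1) / real N) \<longlonglongrightarrow> 1" by real_asymp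
  then show ?case
  proof (rule Lim_transform_eventually)
    show "\<forall>\<^sub>F N in sequentially. (real N - real j + 1) / real N = fact (Suc (N - j)) / (fact (N - j - 0) * real N ^ Suc 0)"
      using eventually_ge_at_top[of j] by eventually_elim (simp add: add.commute)
  qed
next
  case (Suc \<alpha>)
  have "(\<lambda>N. (real N - real j - real \<alpha>) / real N) \<longlonglongrightarrow> 1" by real_asymp
  from tendsto_mult[OF Suc this] have "(\<lambda>N. fact (Suc (N - j)) / (fact (N - j - \<alpha>) * real N ^ Suc \<alpha>) * ((real N - real j - real \<alpha>) / real N)) \<longlonglongrightarrow> 1"
    by simp
  then show ?case
  proof (rule Lim_transform_eventually)
    show "\<forall>\<^sub>F N in sequentially. fact (Suc (N - j)) / (fact (N - j - \<alpha>) * real N ^ Suc \<alpha>) * ((real N - real j - real \<alpha>) / real N)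
       = fact (Suc (N - j)) / (fact (N - j - Suc \<alpha>) * real N ^ Suc (Suc \<alpha>))"
      using eventually_ge_at_top[of "Suc (j + \<alpha>)"]
    proof eventually_elim
      case (elim N)
      then obtain r where r: "N - j - \<alpha> = Suc r" by (cases "N - j - \<alpha>") auto
      then have "real N - real j - real \<alpha> = real (Suc r)" "N - j - Suc \<alpha> = r" using elim by linarith+
      moreover have "F / (real (Suc r) * f * P) * (real (Suc r) / n) = F / (f * (n * P))" for F f P n :: real
        by (simp del: of_nat_Suc)
      ultimately show ?case unfolding r fact_Suc[of r] by (simp only: power_Suc[of _ "Suc \<alpha>"])
    qed
  qed
qed

lemma edge_ratio: "(\<lambda>N. edge \<mu> N / real N) \<longlonglongrightarrow> 4" "(\<lambda>N. real N / edge \<mu> N) \<longlonglongrightarrow> 1 / 4"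
  unfolding edge_def by real_asymp+

text \<open>At the edge points this is the prefactor of the theorem, by
  \<open>Z_factor_edge\<close>. It factorises in x and y for positive arguments, which the majorant
  for the kernels exploits.\<close>

definition edge_weight :: "nat \<Rightarrow> nat \<Rightarrow> real \<Rightarrow> real \<Rightarrow> real" where
  "edge_weight \<alpha> N x y = 2 powr (4/3) * real N powr (1/3) * ((x * y) powr (real \<alpha> / 2) * exp (- (x + y) / 2))"

lemma edge_power_asymp:
  "(\<lambda>N. (edge \<mu> N * edge \<nu> N) powr (- real \<alpha> / 2) * real N ^ \<alpha>) \<longlonglongrightarrow> 1 / 4 ^ \<alpha>"
proof -
  have "(\<lambda>N. (edge \<mu> N / real N * (edge \<nu> N / real N)) powr (- real \<alpha> / 2)) \<longlonglongrightarrow> (4 * 4) powr (- real \<alpha> / 2)"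
    by (intro tendsto_powr tendsto_mult edge_ratio tendsto_const) auto
  moreover have "(4 * 4) powr (- real \<alpha> / 2) = 1 / (4::real) ^ \<alpha>"
  proof -
    have "(4 * 4) powr (- real \<alpha> / 2) = (4 powr 2) powr (- real \<alpha> / 2)" by simp
    also have "\<dots> = 4 powr (- real \<alpha>)" unfolding powr_powr by simp
    finally show ?thesis by (simp add: powr_minus_divide powr_realpow)
  qed
  ultimately have "(\<lambda>N. (edge \<mu> N / real N * (edge \<nu> N / real N)) powr (- real \<alpha> / 2)) \<longlonglongrightarrow> 1 / 4 ^ \<alpha>"
    by (simp only:)
  then show ?thesis
  proof (rule Lim_transform_eventually)
    show "\<forall>\<^sub>F N in sequentially. (edge \<mu> N / real N * (edge \<nu> N / real N)) powr (- real \<alpha> / 2) =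
      (edge \<mu> N * edge \<nu> N) powr (- real \<alpha> / 2) * real N ^ \<alpha>"
      using edge_ge_2[of \<mu>] edge_ge_2[of \<nu>] eventually_gt_at_top[of 0]
    proof eventually_elim
      case (elim N)
      have "(edge \<mu> N / real N * (edge \<nu> N / real N)) powr (- real \<alpha> / 2)
        = (edge \<mu> N * edge \<nu> N) powr (- real \<alpha> / 2) / (real N * real N) powr (- real \<alpha> / 2)"
        using elim by (simp add: powr_divide)
      also have "(real N * real N) powr (- real \<alpha> / 2) = real N powr (- real \<alpha>)"
        using elim powr_powr[of "real N" 2 "- real \<alpha> / 2"] by (simp add: power2_eq_square)
      also have "(edge \<mu> N * edge \<nu> N) powr (- real \<alpha> / 2) / real N powr (- real \<alpha>) = (edge \<mu> N * edge \<nu> N) powr (- real \<alpha> / 2) * real N ^ \<alpha>"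
        using elim by (simp add: powr_minus_divide powr_realpow)
      finally show ?case .
    qed
  qed
qed

text \<open>The kernel identities supply the integer power of x y, so the weight is split into it
  and the decaying power, whose limit is \<open>edge_power_asymp\<close>.\<close>

lemma powr_half_eq: "z > 0 \<Longrightarrow> z powr (real \<alpha> / 2) = z powr (- real \<alpha> / 2) * z ^ \<alpha>"
  by (simp add: powr_realpow[symmetric] powr_add[symmetric])

lemma exp_half_sum: "exp (- (x + y) / 2) = exp (- x / 2) * exp (- y / 2 :: real)"
  by (simp add: exp_add[symmetric] add_divide_distrib)

text \<open>The prefactor 2^(4/3) N^(1/3) cancels against x - y. The factorials give N^(\<alpha>+1):
  \<alpha> powers balance the weight, and the last N is split as N^(1/3) N^(2/3) between
  \<open>A\<close> and \<open>B\<close>. The constants cancel as 2^\<alpha> 2^\<alpha> / 4^\<alpha>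
  and 2^(1/3) 2^(-1/3).\<close>

lemma lag_kernel_edge_asymp_offdiagonal:
  assumes "\<mu> \<noteq> \<nu>"
  shows "(\<lambda>N. edge_weight \<alpha> N (edge \<mu> N) (edge \<nu> N) * lag_kernel \<alpha> (N - j - \<alpha>) (edge \<mu> N) (edge \<nu> N))
     \<longlonglongrightarrow> Airy_quotient \<mu> \<nu>"
proof -
  define A where "A \<mu> N = exp (- edge \<mu> N / 2) * lam (N - j - \<alpha>) (N - j) (edge \<mu> N)" for \<mu> N
  define B where "B \<mu> N = exp (- edge \<mu> N / 2) * (lam (Suc (N - j) - \<alpha>) (Suc (N - j)) (edge \<mu> N) - lam (N - j - \<alpha>) (N - j) (edge \<mu> N))" for \<mu> N
  have A: "(\<lambda>N. real N powr (1/3) * A \<mu> N) \<longlonglongrightarrow> 2 ^ \<alpha> * 2 powr (- 1/3) * Airy_Ai \<mu>" for \<mu>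
    unfolding A_def using lam_edge_asymp[of \<mu> 0 j \<alpha>] by simp
  have B: "(\<lambda>N. real N powr (2/3) * B \<mu> N) \<longlonglongrightarrow> - (2 ^ \<alpha> * 2 powr (1/3) * deriv Airy_Ai \<mu>)" for \<mu>
    unfolding B_def using lam_diff_edge_asymp[of \<mu> 0 j \<alpha>] by simp
  let ?P = "\<lambda>N. (edge \<mu> N * edge \<nu> N) powr (- real \<alpha> / 2) * real N ^ \<alpha>"
  let ?F = "\<lambda>N. fact (Suc (N - j)) / (fact (N - j - \<alpha>) * real N ^ Suc \<alpha>)"
  let ?W = "\<lambda>N. (real N powr (2/3) * B \<mu> N) * (real N powr (1/3) * A \<nu> N) - (real N powr (1/3) * A \<mu> N) * (real N powr (2/3) * B \<nu> N)"
  let ?l = "1 / 4 ^ \<alpha> * 1 * ((- (2 ^ \<alpha> * 2 powr (1/3) * deriv Airy_Ai \<mu>)) * (2 ^ \<alpha> * 2 powr (- 1/3) * Airy_Ai \<nu>)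
      - (2 ^ \<alpha> * 2 powr (- 1/3) * Airy_Ai \<mu>) * (- (2 ^ \<alpha> * 2 powr (1/3) * deriv Airy_Ai \<nu>))) / (\<mu> - \<nu>)"
  have "(\<lambda>N. ?P N * ?F N * ?W N / (\<mu> - \<nu>)) \<longlonglongrightarrow> ?l"
    by (intro tendsto_divide tendsto_mult tendsto_diff edge_power_asymp fact_ratio_asymp A B tendsto_const) (use assms in auto)
  moreover have "?l = Airy_quotient \<mu> \<nu>"
  proof -
    have c: "(2::real) ^ \<alpha> * 2 ^ \<alpha> = 4 ^ \<alpha>" by (simp add: power_mult_distrib[symmetric])
    have qr: "(2::real) powr (1/3) * 2 powr (- 1/3) = 1" by (simp add: powr_add[symmetric])
    have "q * r = 1 \<Longrightarrow> (- (t * q * a')) * (t * r * b) - (t * r * a) * (- (t * q * b')) = (t * t) * (a * b' - a' * b)"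
      for q r t a a' b b' :: real
    proof -
      assume qr: "q * r = 1"
      have "(- (t * q * a')) * (t * r * b) - (t * r * a) * (- (t * q * b')) = (q * r) * ((t * t) * (a * b' - a' * b))"
        by (simp add: algebra_simps)
      then show ?thesis by (simp only: qr mult_1)
    qed
    from this[OF qr] have "(- (2 ^ \<alpha> * 2 powr (1/3) * deriv Airy_Ai \<mu>)) * (2 ^ \<alpha> * 2 powr (- 1/3) * Airy_Ai \<nu>)
      - (2 ^ \<alpha> * 2 powr (- 1/3) * Airy_Ai \<mu>) * (- (2 ^ \<alpha> * 2 powr (1/3) * deriv Airy_Ai \<nu>))
      = (2 ^ \<alpha> * 2 ^ \<alpha>) * (Airy_Ai \<mu> * deriv Airy_Ai \<nu> - deriv Airy_Ai \<mu> * Airy_Ai \<nu>)" .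
    then show ?thesis unfolding c by (simp add: Airy_quotient_def)
  qed
  ultimately have "(\<lambda>N. ?P N * ?F N * ?W N / (\<mu> - \<nu>)) \<longlonglongrightarrow> Airy_quotient \<mu> \<nu>" by (simp only:)
  then show ?thesis
  proof (rule Lim_transform_eventually)
    show "\<forall>\<^sub>F N in sequentially. ?P N * ?F N * ?W N / (\<mu> - \<nu>) =
      edge_weight \<alpha> N (edge \<mu> N) (edge \<nu> N) * lag_kernel \<alpha> (N - j - \<alpha>) (edge \<mu> N) (edge \<nu> N)"
      using edge_ge_2[of \<mu>] edge_ge_2[of \<nu>] eventually_ge_at_top[of "j + \<alpha> + 1"]
    proof eventually_elim
      case (elim N)
      define m where "m = N - j - \<alpha>"
      have n: "N - j = m + \<alpha>" using elim by (simp add: m_def)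
      define x y where "x = edge \<mu> N" and "y = edge \<nu> N"
      have xy: "x > 0" "y > 0" using elim by (auto simp: x_def y_def)
      define a b where "a z = lam m (m + \<alpha>) z" and "b z = lam (Suc m) (Suc (m + \<alpha>)) z - lam m (m + \<alpha>) z" for z
      have N0: "real N > 0" using elim by simp
      have d: "x - y = 2 powr (4/3) * real N powr (1/3) * (\<mu> - \<nu>)"
        by (simp add: x_def y_def edge_def algebra_simps)
      have A: "A \<mu> N = exp (- x / 2) * a x" "A \<nu> N = exp (- y / 2) * a y"
        by (simp_all add: A_def x_def y_def a_def n)
      have B: "B \<mu> N = exp (- x / 2) * b x" "B \<nu> N = exp (- y / 2) * b y"
        by (simp_all add: B_def x_def y_def b_def n Suc_diff_le)
      have pw: "real N powr (2/3) * real N powr (1/3) = real N"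
        using N0 by (simp add: powr_add[symmetric])
      have "edge_weight \<alpha> N x y * lag_kernel \<alpha> m x y =
        (x * y) powr (- real \<alpha> / 2) * exp (- (x + y) / 2) * (((x - y) * ((x * y) ^ \<alpha> * lag_kernel \<alpha> m x y)) / (\<mu> - \<nu>))"
        unfolding edge_weight_def d using xy assms by (simp add: powr_half_eq)
      also have "(x - y) * ((x * y) ^ \<alpha> * lag_kernel \<alpha> m x y) = fact (Suc (m + \<alpha>)) / fact m * (b x * a y - a x * b y)"
        unfolding a_def b_def using lag_kernel_lam[of x y \<alpha> m] xy by simp
      finally have "edge_weight \<alpha> N x y * lag_kernel \<alpha> m x y = (x * y) powr (- real \<alpha> / 2) * (fact (Suc (m + \<alpha>)) / fact m) *
         (B \<mu> N * A \<nu> N - A \<mu> N * B \<nu> N) / (\<mu> - \<nu>)"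
        unfolding A B exp_half_sum by (simp add: algebra_simps)
      also have "fact (Suc (m + \<alpha>)) / fact m = real N ^ \<alpha> * ?F N * real N"
        unfolding n using N0 by simp
      also have "(x * y) powr (- real \<alpha> / 2) * (real N ^ \<alpha> * ?F N * real N) * (B \<mu> N * A \<nu> N - A \<mu> N * B \<nu> N) / (\<mu> - \<nu>)
         = ?P N * ?F N * (real N powr (2/3) * real N powr (1/3) * (B \<mu> N * A \<nu> N - A \<mu> N * B \<nu> N)) / (\<mu> - \<nu>)"
        unfolding pw x_def y_def by (simp only: mult_ac)
      also have "real N powr (2/3) * real N powr (1/3) * (B \<mu> N * A \<nu> N - A \<mu> N * B \<nu> N) = ?W N"
        by (simp only: right_diff_distrib mult_ac)
      finally show ?case unfolding x_def y_def m_def by (rule sym)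
    qed
  qed
qed

text \<open>With A of order N^(-1/3) and B of order N^(-2/3), the coefficients of A^2 and A B are
  only of order N^(1/3), since 4 N cancels against x; that of B^2 has order N. The A^2 and B^2 terms
  balance, giving -\<mu> Ai^2 and Ai'^2, while the mixed term is smaller.\<close>

lemma lag_kernel_edge_asymp_diagonal:
  "(\<lambda>N. edge_weight \<alpha> N (edge \<mu> N) (edge \<mu> N) * lag_kernel \<alpha> (N - j - \<alpha>) (edge \<mu> N) (edge \<mu> N))
     \<longlonglongrightarrow> Airy_kernel \<mu> \<mu>"
proof -
  define A where "A N = exp (- edge \<mu> N / 2) * lam (N - j - \<alpha>) (N - j) (edge \<mu> N)" for N
  define B where "B N = exp (- edge \<mu> N / 2) * (lam (Suc (N - j) - \<alpha>) (Suc (N - j)) (edge \<mu> N) - lam (N - j - \<alpha>) (N - j) (edge \<mu> N))" for N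
  have A: "(\<lambda>N. real N powr (1/3) * A N) \<longlonglongrightarrow> 2 ^ \<alpha> * 2 powr (- 1/3) * Airy_Ai \<mu>"
    unfolding A_def using lam_edge_asymp[of \<mu> 0 j \<alpha>] by simp
  have B: "(\<lambda>N. real N powr (2/3) * B N) \<longlonglongrightarrow> - (2 ^ \<alpha> * 2 powr (1/3) * deriv Airy_Ai \<mu>)"
    unfolding B_def using lam_diff_edge_asymp[of \<mu> 0 j \<alpha>] by simp
  let ?P = "\<lambda>N. (edge \<mu> N * edge \<mu> N) powr (- real \<alpha> / 2) * real N ^ \<alpha>"
  let ?F = "\<lambda>N. fact (Suc (N - j)) / (fact (N - j - \<alpha>) * real N ^ Suc \<alpha>)"
  let ?u = "\<lambda>N. (4 * real N - 4 * real j - 2 * real \<alpha> + 4 - edge \<mu> N) / real N powr (1/3)"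
  let ?v = "\<lambda>N. (4 * real N - 4 * real j - real \<alpha> + 4 - edge \<mu> N) / real N powr (2/3)"
  let ?w = "\<lambda>N. (real N - real j + 1) / real N"
  have u: "?u \<longlonglongrightarrow> - (2 powr (4/3) * \<mu>)" and v: "?v \<longlonglongrightarrow> 0" and w: "?w \<longlonglongrightarrow> 1"
    unfolding edge_def by real_asymp+
  let ?W = "\<lambda>N. ?u N * (real N powr (1/3) * A N)\<^sup>2 + ?v N * (real N powr (1/3) * A N) * (real N powr (2/3) * B N) + ?w N * (real N powr (2/3) * B N)\<^sup>2"
  let ?l = "2 powr (4/3) * (1 / 4 ^ \<alpha>) * 1 * (1 / 4) * (- (2 powr (4/3) * \<mu>) * (2 ^ \<alpha> * 2 powr (- 1/3) * Airy_Ai \<mu>)\<^sup>2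
     + 0 * (2 ^ \<alpha> * 2 powr (- 1/3) * Airy_Ai \<mu>) * (- (2 ^ \<alpha> * 2 powr (1/3) * deriv Airy_Ai \<mu>))
     + 1 * (- (2 ^ \<alpha> * 2 powr (1/3) * deriv Airy_Ai \<mu>))\<^sup>2)"
  have "(\<lambda>N. 2 powr (4/3) * ?P N * ?F N * (real N / edge \<mu> N) * ?W N) \<longlonglongrightarrow> ?l"
    by (intro tendsto_mult tendsto_add tendsto_power edge_power_asymp fact_ratio_asymp edge_ratio u v w A B tendsto_const)
  moreover have "?l = Airy_kernel \<mu> \<mu>"
  proof -
    define q where "q = (2::real) powr (1/3)"
    have q3: "q ^ 3 = 2" by (simp add: q_def power3_eq_cube powr_add[symmetric])
    have q4: "2 powr (4/3) = 2 * q" using powr_add[of 2 1 "1/3 :: real"] by (simp add: q_def)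
    have q0: "q > 0" by (simp add: q_def)
    have qm: "2 powr (- 1/3) = 1 / q" by (simp add: q_def powr_minus_divide)
    have c: "((2::real) ^ \<alpha>)\<^sup>2 = 4 ^ \<alpha>" by (simp add: power2_eq_square power_mult_distrib[symmetric])
    have "?l = 2 * q * (1 / 4 ^ \<alpha>) * (1 / 4) * (- (2 * q * \<mu>) * ((2 ^ \<alpha>)\<^sup>2 * (1 / q)\<^sup>2 * (Airy_Ai \<mu>)\<^sup>2) + (2 ^ \<alpha>)\<^sup>2 * q\<^sup>2 * (deriv Airy_Ai \<mu>)\<^sup>2)"
      unfolding q4 qm q_def[symmetric] by (simp add: power_mult_distrib power_divide)
    also have "\<dots> = q * q\<^sup>2 / 2 * (deriv Airy_Ai \<mu>)\<^sup>2 - \<mu> * (Airy_Ai \<mu>)\<^sup>2"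
      unfolding c using q0 by (simp add: field_simps power2_eq_square)
    also have "q * q\<^sup>2 = 2" using q3 by (simp add: power2_eq_square power3_eq_cube)
    finally show ?thesis by (simp add: Airy_kernel_diagonal)
  qed
  ultimately have "(\<lambda>N. 2 powr (4/3) * ?P N * ?F N * (real N / edge \<mu> N) * ?W N) \<longlonglongrightarrow> Airy_kernel \<mu> \<mu>" by (simp only:)
  then show ?thesis
  proof (rule Lim_transform_eventually)
    show "\<forall>\<^sub>F N in sequentially. 2 powr (4/3) * ?P N * ?F N * (real N / edge \<mu> N) * ?W N =
      edge_weight \<alpha> N (edge \<mu> N) (edge \<mu> N) * lag_kernel \<alpha> (N - j - \<alpha>) (edge \<mu> N) (edge \<mu> N)"
      using edge_ge_2[of \<mu>] eventually_ge_at_top[of "j + \<alpha> + 1"]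
    proof eventually_elim
      case (elim N)
      define m where "m = N - j - \<alpha>"
      have n: "N - j = m + \<alpha>" using elim by (simp add: m_def)
      then obtain k where k: "m + \<alpha> = Suc k" using elim by (cases "m + \<alpha>") auto
      define x where "x = edge \<mu> N"
      have x: "x > 0" using elim by (auto simp: x_def)
      define a b where "a = lam m (m + \<alpha>) x" and "b = lam (Suc m) (Suc (m + \<alpha>)) x - lam m (m + \<alpha>) x"
      have N0: "real N > 0" using elim by simp
      have A: "A N = exp (- x / 2) * a"
        by (simp add: A_def x_def a_def n)
      have B: "B N = exp (- x / 2) * b"
        by (simp add: B_def x_def b_def n Suc_diff_le)
      have rm: "real m = real N - real j - real \<alpha>" using elim by (simp add: m_def)
      define c1 c2 c3 where "c1 = 4 * real N - 4 * real j - 2 * real \<alpha> + 4 - x" and "c2 = 4 * real N - 4 * real j - real \<alpha> + 4 - x"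
        and "c3 = real N - real j + 1"
      have "edge_weight \<alpha> N x x * lag_kernel \<alpha> m x x =
        2 powr (4/3) * real N powr (1/3) * ((x * x) powr (- real \<alpha> / 2) * (exp (- x / 2))\<^sup>2) * ((x * ((x * x) ^ \<alpha> * lag_kernel \<alpha> m x x)) / x)"
        unfolding edge_weight_def exp_half_sum using x by (simp add: powr_half_eq power2_eq_square)
      also have "x * ((x * x) ^ \<alpha> * lag_kernel \<alpha> m x x) = fact (Suc (m + \<alpha>)) / fact m * (c1 * a\<^sup>2 + c2 * a * b + c3 * b\<^sup>2)"
      proof -
        have "2 * real (m + \<alpha>) + 2 * real m + 4 - x = c1" "3 * real (m + \<alpha>) + real m + 4 - x = c2"
          "real (m + \<alpha>) + 1 = c3" by (simp_all add: c1_def c2_def c3_def rm)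
        with lag_kernel_lam_diagonal[OF x k] show ?thesis unfolding a_def b_def by (simp only:)
      qed
      also have "2 powr (4/3) * real N powr (1/3) * ((x * x) powr (- real \<alpha> / 2) * (exp (- x / 2))\<^sup>2) * ((fact (Suc (m + \<alpha>)) / fact m * (c1 * a\<^sup>2 + c2 * a * b + c3 * b\<^sup>2)) / x)
         = 2 powr (4/3) * real N powr (1/3) * (x * x) powr (- real \<alpha> / 2) * (fact (Suc (m + \<alpha>)) / fact m) * (c1 * (A N)\<^sup>2 + c2 * A N * B N + c3 * (B N)\<^sup>2) / x"
      proof -
        have "c1 * (A N)\<^sup>2 + c2 * A N * B N + c3 * (B N)\<^sup>2 = (exp (- x / 2))\<^sup>2 * (c1 * a\<^sup>2 + c2 * a * b + c3 * b\<^sup>2)"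
          unfolding A B by (simp only: power_mult_distrib power2_eq_square distrib_left mult_ac)
        then show ?thesis by (simp only: times_divide_eq_left times_divide_eq_right mult_ac)
      qed
      also have "fact (Suc (m + \<alpha>)) / fact m = real N ^ \<alpha> * ?F N * real N"
        unfolding n using N0 by simp
      finally have eq: "edge_weight \<alpha> N x x * lag_kernel \<alpha> m x x = 2 powr (4/3) * ((x * x) powr (- real \<alpha> / 2) * real N ^ \<alpha>) * ?F N * (real N / x)
         * (real N powr (1/3) * (c1 * (A N)\<^sup>2 + c2 * A N * B N + c3 * (B N)\<^sup>2))"
        by (simp add: mult_ac)
      define s where "s = real N powr (1/3)"
      have s0: "s > 0" using N0 by (simp add: s_def)
      have s2: "real N powr (2/3) = s * s" and s3: "real N = s * s * s"
        using N0 by (simp_all add: s_def powr_add[symmetric])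
      have alg: "s * (c1 * a\<^sup>2 + c2 * a * b + c3 * b\<^sup>2) =
          c1 / s * (s * a)\<^sup>2 + c2 / (s * s) * (s * a) * (s * s * b) + c3 / (s * s * s) * (s * s * b)\<^sup>2" for a b
        using s0 by (simp add: field_simps power2_eq_square)
      have "real N powr (1/3) * (c1 * (A N)\<^sup>2 + c2 * A N * B N + c3 * (B N)\<^sup>2) = ?W N"
        unfolding x_def[symmetric] c1_def[symmetric] c2_def[symmetric] c3_def[symmetric]
        unfolding s_def[symmetric] s2 unfolding s3 by (rule alg)
      with eq show ?case unfolding x_def m_def by simp
    qed
  qed
qed

lemma lag_kernel_edge_asymp:
  "(\<lambda>N. edge_weight \<alpha> N (edge \<mu> N) (edge \<nu> N) * lag_kernel \<alpha> (N - j - \<alpha>) (edge \<mu> N) (edge \<nu> N))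
     \<longlonglongrightarrow> Airy_kernel \<mu> \<nu>"
  using lag_kernel_edge_asymp_diagonal[of \<alpha> \<nu> j] lag_kernel_edge_asymp_offdiagonal[of \<mu> \<nu> \<alpha> j]
  by (cases "\<mu> = \<nu>") (simp_all add: Airy_kernel_def)

text \<open>Termwise AM-GM against the two diagonal kernels; the weight splits as a product \<open>z x * z y\<close>.\<close>

lemma lag_kernel_weighted_bound:
  fixes x y :: real
  assumes "x > 0" "y > 0" "m' \<le> m"
  shows "\<bar>edge_weight \<alpha> N x y * lag_kernel \<alpha> m' x y\<bar> \<le>
     (edge_weight \<alpha> N x x * lag_kernel \<alpha> m x x + edge_weight \<alpha> N y y * lag_kernel \<alpha> m y y) / 2"
proof -
  define c where "c = 2 powr (4/3) * real N powr (1/3)"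
  have c: "c \<ge> 0" by (simp add: c_def)
  define z where "z t = t powr (real \<alpha> / 2) * exp (- t / 2)" for t :: real
  have w: "edge_weight \<alpha> N s t = c * (z s * z t)" if "s > 0" "t > 0" for s t
    using that unfolding edge_weight_def c_def z_def exp_half_sum by (simp add: powr_mult)
  define u where "u k t = z t * poly (lag (k + \<alpha>) k) t" for k t
  define g where "g k = 1 / (fact (k + \<alpha>) * fact k :: real)" for k
  have g: "g k \<ge> 0" for k by (simp add: g_def)
  have ker: "edge_weight \<alpha> N s t * lag_kernel \<alpha> M s t = (\<Sum>k\<le>M. c * (g k * (u k s * u k t)))" if "s > 0" "t > 0" for s t M
    unfolding w[OF that] lag_kernel_def sum_distrib_left by (rule sum.cong) (simp_all add: u_def g_def)
  have "\<bar>edge_weight \<alpha> N x y * lag_kernel \<alpha> m' x y\<bar> \<le> (\<Sum>k\<le>m'. \<bar>c * (g k * (u k x * u k y))\<bar>)"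
    unfolding ker[OF assms(1,2)] by (rule sum_abs)
  also have "\<dots> \<le> (\<Sum>k\<le>m'. c * (g k * (u k x * u k x + u k y * u k y)) / 2)"
  proof (rule sum_mono)
    fix k
    have "0 \<le> (\<bar>u k x\<bar> - \<bar>u k y\<bar>)\<^sup>2" by simp
    then have "2 * (\<bar>u k x\<bar> * \<bar>u k y\<bar>) \<le> u k x * u k x + u k y * u k y"
      by (simp add: power2_eq_square algebra_simps)
    then have "c * (g k * (\<bar>u k x\<bar> * \<bar>u k y\<bar>)) \<le> c * (g k * ((u k x * u k x + u k y * u k y) / 2))"
      using c g by (intro mult_left_mono) auto
    then show "\<bar>c * (g k * (u k x * u k y))\<bar> \<le> c * (g k * (u k x * u k x + u k y * u k y)) / 2"
      using c g by (simp add: abs_mult)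
  qed
  also have "\<dots> \<le> (\<Sum>k\<le>m. c * (g k * (u k x * u k x + u k y * u k y)) / 2)"
    using assms(3) c g by (intro sum_mono2) (auto intro!: mult_nonneg_nonneg add_nonneg_nonneg divide_nonneg_nonneg)
  also have "\<dots> = (edge_weight \<alpha> N x x * lag_kernel \<alpha> m x x + edge_weight \<alpha> N y y * lag_kernel \<alpha> m y y) / 2"
    unfolding ker[OF assms(1,1)] ker[OF assms(2,2)] unfolding sum.distrib[symmetric] sum_divide_distrib by (simp add: distrib_left)
  finally show ?thesis .
qed

lemma lag_kernel_edge_series_asymp:
  "(\<lambda>N. edge_weight \<alpha> N (edge \<mu> N) (edge \<nu> N) *
      (\<Sum>j\<le>N - \<alpha>. \<kappa> ^ j / fact j * lag_kernel \<alpha> (N - \<alpha> - j) (edge \<mu> N) (edge \<nu> N)))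
     \<longlonglongrightarrow> exp \<kappa> * Airy_kernel \<mu> \<nu>"
proof -
  define T where "T j N = edge_weight \<alpha> N (edge \<mu> N) (edge \<nu> N) * lag_kernel \<alpha> (N - j - \<alpha>) (edge \<mu> N) (edge \<nu> N)" for j N
  define D where "D \<mu> N = edge_weight \<alpha> N (edge \<mu> N) (edge \<mu> N) * lag_kernel \<alpha> (N - \<alpha>) (edge \<mu> N) (edge \<mu> N)" for \<mu> N
  \<comment> \<open>The full diagonal kernels converge, hence are bounded in N. This bounds all
    shorter kernels at once, including those with j comparable to N.\<close>
  have "Bseq (\<lambda>N. (D \<mu> N + D \<nu> N) / 2)"
    using lag_kernel_edge_asymp[of \<alpha> _ _ 0]
    by (intro convergent_imp_Bseq convergentI[of _ "(Airy_kernel \<mu> \<mu> + Airy_kernel \<nu> \<nu>) / 2"])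
      (auto simp: D_def intro!: tendsto_intros)
  then obtain C where C: "\<And>N. \<bar>(D \<mu> N + D \<nu> N) / 2\<bar> \<le> C" by (auto simp: Bseq_def)
  \<comment> \<open>Extension by zero beyond N - \<alpha> turns the finite sums into series over a
    fixed index set, as Tannery's theorem requires.\<close>
  define G where "G j N = (if j \<le> N - \<alpha> then \<kappa> ^ j / fact j * T j N else 0)" for j N
  have bound: "norm (G j N) \<le> \<bar>\<kappa>\<bar> ^ j / fact j * C" if "edge \<mu> N \<ge> 2" "edge \<nu> N \<ge> 2" for j N
  proof -
    have "\<bar>T j N\<bar> \<le> (D \<mu> N + D \<nu> N) / 2"
      unfolding T_def D_def by (rule lag_kernel_weighted_bound) (use that in auto)
    then have "\<bar>T j N\<bar> \<le> C" using C[of N] by linarith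
    moreover have "0 \<le> C" using C[of 0] by linarith
    ultimately show ?thesis by (auto simp: G_def abs_mult power_abs intro!: divide_right_mono mult_left_mono)
  qed
  have lim: "(\<lambda>N. G j N) \<longlonglongrightarrow> \<kappa> ^ j / fact j * Airy_kernel \<mu> \<nu>" for j
  proof (rule Lim_transform_eventually)
    show "(\<lambda>N. \<kappa> ^ j / fact j * T j N) \<longlonglongrightarrow> \<kappa> ^ j / fact j * Airy_kernel \<mu> \<nu>"
      unfolding T_def by (intro tendsto_mult_left lag_kernel_edge_asymp)
    show "\<forall>\<^sub>F N in sequentially. \<kappa> ^ j / fact j * T j N = G j N"
      using eventually_ge_at_top[of "j + \<alpha>"] by eventually_elim (simp add: G_def)
  qed
  have sums: "(\<lambda>j. \<kappa> ^ j / fact j * Airy_kernel \<mu> \<nu>) sums (exp \<kappa> * Airy_kernel \<mu> \<nu>)"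
    using exp_converges[of \<kappa>] by (intro sums_mult2) (simp add: divide_inverse mult.commute)
  have "(\<lambda>N. \<Sum>j. G j N) \<longlonglongrightarrow> (\<Sum>j. \<kappa> ^ j / fact j * Airy_kernel \<mu> \<nu>)"
  proof -
    have "eventually (\<lambda>N. edge \<mu> N \<ge> 2 \<and> edge \<nu> N \<ge> 2) sequentially"
      by (intro eventually_conj edge_ge_2)
    then obtain N0 where N0: "\<And>N. N \<ge> N0 \<Longrightarrow> edge \<mu> N \<ge> 2 \<and> edge \<nu> N \<ge> 2"
      by (auto simp: eventually_sequentially)
    have ev: "\<forall>\<^sub>F (j, N) in sequentially \<times>\<^sub>F sequentially. norm (G j N) \<le> \<bar>\<kappa>\<bar> ^ j / fact j * C"
      unfolding eventually_prod_sequentially using bound N0 by (intro exI[of _ N0]) auto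
    have "summable (\<lambda>j. \<bar>\<kappa>\<bar> ^ j / fact j * C)"
      using summable_exp[of "\<bar>\<kappa>\<bar>"] by (intro summable_mult2) (simp add: divide_inverse mult.commute)
    from tannerys_theorem[OF lim ev this] show ?thesis by simp
  qed
  then have "(\<lambda>N. \<Sum>j. G j N) \<longlonglongrightarrow> exp \<kappa> * Airy_kernel \<mu> \<nu>"
    using sums by (simp add: sums_iff)
  moreover have "(\<Sum>j. G j N) = edge_weight \<alpha> N (edge \<mu> N) (edge \<nu> N) *
      (\<Sum>j\<le>N - \<alpha>. \<kappa> ^ j / fact j * lag_kernel \<alpha> (N - \<alpha> - j) (edge \<mu> N) (edge \<nu> N))" for N
  proof -
    have "(\<Sum>j. G j N) = (\<Sum>j\<le>N - \<alpha>. G j N)"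
      by (rule suminf_finite) (auto simp: G_def)
    also have "\<dots> = edge_weight \<alpha> N (edge \<mu> N) (edge \<nu> N) *
      (\<Sum>j\<le>N - \<alpha>. \<kappa> ^ j / fact j * lag_kernel \<alpha> (N - \<alpha> - j) (edge \<mu> N) (edge \<nu> N))"
      unfolding sum_distrib_left by (rule sum.cong) (simp_all only: G_def T_def diff_commute[of N _ \<alpha>] atMost_iff if_True mult_ac)
    finally show ?thesis .
  qed
  ultimately show ?thesis by simp
qed

section \<open>Gram matrices\<close>

lemma cofactor_cong_row:
  assumes A: "A \<in> carrier_mat k k" and B: "B \<in> carrier_mat k k"
    and eq: "\<And>i j. i < k \<Longrightarrow> j < k \<Longrightarrow> i \<noteq> t \<Longrightarrow> A $$ (i, j) = B $$ (i, j)" and t: "t < k"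
  shows "cofactor A t b = cofactor B t b"
proof -
  have "mat_delete A t b = mat_delete B t b"
  proof (rule eq_matI)
    fix i j assume "i < dim_row (mat_delete B t b)" "j < dim_col (mat_delete B t b)"
    then have ij: "i < k - 1" "j < k - 1" using B by auto
    have "A $$ (if i < t then i else Suc i, if j < b then j else Suc j) =
       B $$ (if i < t then i else Suc i, if j < b then j else Suc j)"
      by (rule eq) (use ij in auto)
    then show "mat_delete A t b $$ (i, j) = mat_delete B t b $$ (i, j)"
      using ij A B unfolding mat_delete_def by auto
  qed (use A B in auto)
  then show ?thesis by (simp add: cofactor_def)
qed

text \<open>Turning the rows of \<open>A\<close> one after the other into rows of \<open>A + p q\<^sup>T\<close>; at every step row operations
  with the row \<open>q\<close> undo the changes made before.\<close>

lemma det_rank_one_update: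
  fixes A :: "'a::comm_ring_1 mat"
  assumes A: "A \<in> carrier_mat k k"
  shows "Determinant.det (A + Matrix.mat k k (\<lambda>(i, j). p i * q j)) =
    Determinant.det A + (\<Sum>a<k. \<Sum>b<k. p a * q b * cofactor A a b)"
proof -
  define M where "M s = Matrix.mat k k (\<lambda>(i, j). if i < s then A $$ (i, j) + p i * q j else A $$ (i, j))" for s
  define R where "R t s = Matrix.mat k k (\<lambda>(i, j). if i = t then q j else if i < s then A $$ (i, j) + p i * q j else A $$ (i, j))" for t s
  have M: "M s \<in> carrier_mat k k" for s by (simp add: M_def)
  have R: "R t s \<in> carrier_mat k k" for t s by (simp add: R_def)
  have R_eq: "Determinant.det (R t s) = Determinant.det (R t 0)" if "t < k" "s \<le> t" for t s
    using that(2)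
  proof (induction s)
    case (Suc s)
    have "R t (Suc s) = addrow (p s) s t (R t s)"
      by (rule eq_matI) (use Suc.prems that(1) in \<open>auto simp: R_def less_Suc_eq\<close>)
    then have "Determinant.det (R t (Suc s)) = Determinant.det (R t s)"
      using det_addrow[OF that(1) _ R[of t s], of s "p s"] Suc.prems by simp
    then show ?case using Suc by simp
  qed simp
  have R_expand: "Determinant.det (R t s) = (\<Sum>b<k. q b * cofactor (M s) t b)" if "t < k" for t s
  proof -
    have "Determinant.det (R t s) = (\<Sum>b<k. R t s $$ (t, b) * cofactor (R t s) t b)"
      by (rule laplace_expansion_row[OF R that])
    also have "\<dots> = (\<Sum>b<k. q b * cofactor (M s) t b)"
    proof (rule sum.cong)
      fix b assume "b \<in> {..<k}"
      moreover have "cofactor (R t s) t b = cofactor (M s) t b"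
        by (rule cofactor_cong_row[OF R M _ that]) (auto simp: R_def M_def)
      ultimately show "R t s $$ (t, b) * cofactor (R t s) t b = q b * cofactor (M s) t b"
        using that by (simp add: R_def)
    qed simp
    finally show ?thesis .
  qed
  have M0: "M 0 = A" by (rule eq_matI) (use A in \<open>auto simp: M_def\<close>)
  have Mk: "M k = A + Matrix.mat k k (\<lambda>(i, j). p i * q j)" by (rule eq_matI) (use A in \<open>auto simp: M_def\<close>)
  have "Determinant.det (M s) = Determinant.det A + (\<Sum>a<s. p a * (\<Sum>b<k. q b * cofactor A a b))" if "s \<le> k" for s
    using that
  proof (induction s)
    case (Suc s)
    then have s: "s < k" by simp
    have cof: "cofactor (M (Suc s)) s b = cofactor (M s) s b" for b
      by (rule cofactor_cong_row[OF M M _ s]) (auto simp: M_def less_Suc_eq)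
    have "Determinant.det (M (Suc s)) = (\<Sum>b<k. M (Suc s) $$ (s, b) * cofactor (M (Suc s)) s b)"
      by (rule laplace_expansion_row[OF M s])
    also have "\<dots> = (\<Sum>b<k. M s $$ (s, b) * cofactor (M s) s b + p s * (q b * cofactor (M s) s b))"
    proof (rule sum.cong)
      fix b assume "b \<in> {..<k}"
      then have "M (Suc s) $$ (s, b) = M s $$ (s, b) + p s * q b" using s by (simp add: M_def)
      then show "M (Suc s) $$ (s, b) * cofactor (M (Suc s)) s b =
          M s $$ (s, b) * cofactor (M s) s b + p s * (q b * cofactor (M s) s b)"
        by (simp only: cof) (simp add: algebra_simps)
    qed simp
    also have "\<dots> = Determinant.det (M s) + p s * Determinant.det (R s s)"
      unfolding laplace_expansion_row[OF M[of s] s] R_expand[OF s] by (simp add: sum.distrib sum_distrib_left)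
    also have "Determinant.det (R s s) = (\<Sum>b<k. q b * cofactor A s b)"
      using R_eq[OF s order_refl] R_expand[OF s, of 0] by (simp add: M0)
    finally show ?case using Suc by simp
  qed (simp add: M0)
  from this[of k] show ?thesis unfolding Mk by (simp add: sum_distrib_left mult.assoc)
qed

text \<open>Every Leibniz term uses each row factor and each column factor exactly once, so the
  product bound is the same for all permutations. No factor is squared, which keeps the growth in
  each entry low.\<close>

lemma norm_det_le:
  fixes A :: "complex mat"
  assumes A: "A \<in> carrier_mat k k" and C: "C \<ge> 0" and f: "\<And>a. 0 \<le> f a" and g: "\<And>a. 0 \<le> g a"
    and le: "\<And>a b. a < k \<Longrightarrow> b < k \<Longrightarrow> norm (A $$ (a, b)) \<le> C * (f a * g b)"
  shows "norm (Determinant.det A) \<le> fact k * C ^ k * ((\<Prod>a<k. f a) * (\<Prod>a<k. g a))"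
proof -
  have "norm (Determinant.det A) \<le> (\<Sum>\<sigma> | \<sigma> permutes {0..<k}. norm (signof \<sigma> * (\<Prod>i = 0..<k. A $$ (i, \<sigma> i))))"
    unfolding det_def'[OF A] by (rule norm_sum)
  also have "\<dots> \<le> (\<Sum>\<sigma> | \<sigma> permutes {0..<k}. C ^ k * ((\<Prod>a<k. f a) * (\<Prod>a<k. g a)))"
  proof (rule sum_mono)
    fix \<sigma> assume "\<sigma> \<in> {\<sigma>. \<sigma> permutes {0..<k}}"
    then have \<sigma>: "\<sigma> permutes {0..<k}" by simp
    have "norm (signof \<sigma> * (\<Prod>i = 0..<k. A $$ (i, \<sigma> i))) = (\<Prod>i = 0..<k. norm (A $$ (i, \<sigma> i)))"
      by (simp add: norm_mult prod_norm sign_def)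
    also have "\<dots> \<le> (\<Prod>i = 0..<k. C * (f i * g (\<sigma> i)))"
    proof (rule prod_mono)
      fix i assume "i \<in> {0..<k}"
      moreover from this have "\<sigma> i \<in> {0..<k}" using permutes_in_image[OF \<sigma>] by simp
      ultimately show "0 \<le> norm (A $$ (i, \<sigma> i)) \<and> norm (A $$ (i, \<sigma> i)) \<le> C * (f i * g (\<sigma> i))"
        using le by simp
    qed
    also have "\<dots> = C ^ k * ((\<Prod>i = 0..<k. f i) * (\<Prod>i = 0..<k. g (\<sigma> i)))"
      by (simp add: prod.distrib)
    also have "(\<Prod>i = 0..<k. g (\<sigma> i)) = (\<Prod>i = 0..<k. g i)"
      using prod.permute[OF \<sigma>, of g] by (simp add: o_def)
    finally show "norm (signof \<sigma> * (\<Prod>i = 0..<k. A $$ (i, \<sigma> i))) \<le> C ^ k * ((\<Prod>a<k. f a) * (\<Prod>a<k. g a))"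
      by (simp add: atLeast0LessThan)
  qed
  also have "\<dots> = fact k * C ^ k * ((\<Prod>a<k. f a) * (\<Prod>a<k. g a))"
    by (simp add: card_permutations)
  finally show ?thesis .
qed

section \<open>Gram pencils: cofactors, derivatives and the effect of a new row\<close>

definition gram :: "(nat \<times> nat \<Rightarrow> complex) \<Rightarrow> nat \<Rightarrow> (nat \<Rightarrow> nat) \<Rightarrow> nat \<Rightarrow> complex mat" where
  "gram u r c k = Matrix.mat k k (\<lambda>(a, b). \<Sum>i<r. cnj (u (i, c a)) * u (i, c b))"

definition gram_pencil :: "(nat \<times> nat \<Rightarrow> complex) \<Rightarrow> nat \<Rightarrow> (nat \<Rightarrow> nat) \<Rightarrow> nat \<Rightarrow> complex \<Rightarrow> complex mat" where
  "gram_pencil u r c k \<mu> = gram u r c k - \<mu> \<cdot>\<^sub>m 1\<^sub>m k"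

definition gram_poly :: "(nat \<times> nat \<Rightarrow> complex) \<Rightarrow> nat \<Rightarrow> (nat \<Rightarrow> nat) \<Rightarrow> nat \<Rightarrow> complex poly" where
  "gram_poly u r c k = Polynomial.smult ((-1) ^ k) (char_poly (gram u r c k))"

lemma gram_carrier: "gram u r c k \<in> carrier_mat k k"
  by (simp add: gram_def)

lemma gram_pencil_carrier: "gram_pencil u r c k \<mu> \<in> carrier_mat k k"
  by (simp add: gram_pencil_def minus_carrier_mat)

lemma poly_char_poly_eq_det:
  assumes A: "(A :: complex mat) \<in> carrier_mat k k"
  shows "poly (char_poly A) \<mu> = (-1) ^ k * Determinant.det (A - \<mu> \<cdot>\<^sub>m 1\<^sub>m k)"
proof -
  have "- (char_matrix A \<mu>) = (-1) \<cdot>\<^sub>m (A - \<mu> \<cdot>\<^sub>m 1\<^sub>m k)"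
    by (rule eq_matI) (use A in \<open>auto simp: char_matrix_def\<close>)
  then show ?thesis
    unfolding char_poly_matrix[OF A] using A by (simp only: det_smult) auto
qed

lemma poly_gram_poly: "poly (gram_poly u r c k) \<mu> = Determinant.det (gram_pencil u r c k \<mu>)"
  by (simp add: gram_poly_def poly_char_poly_eq_det[OF gram_carrier] gram_pencil_def power_mult_distrib[symmetric] mult.assoc[symmetric])

lemma degree_gram_poly: "degree (gram_poly u r c k) \<le> k"
  using degree_monic_char_poly[OF gram_carrier[of u r c k]] by (simp add: gram_poly_def)

text \<open>The reason why Gram matrices carry a column selection \<open>c\<close>: deleting a
  diagonal position composes it with \<open>insert_index a\<close>, so principal minors stay in the
  same family.\<close>

lemma mat_delete_gram:
  assumes "a < k"
  shows "mat_delete (gram u r c k) a a = gram u r (c \<circ> insert_index a) (k - 1)"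
  by (rule eq_matI) (use assms in \<open>auto simp: gram_def mat_delete_def insert_index_def\<close>)

lemma mat_delete_gram_pencil:
  assumes "a < k"
  shows "mat_delete (gram_pencil u r c k \<mu>) a a = gram_pencil u r (c \<circ> insert_index a) (k - 1) \<mu>"
  by (rule eq_matI) (use assms in \<open>auto simp: gram_pencil_def gram_def mat_delete_def insert_index_def\<close>)

lemma cofactor_gram_pencil_diagonal:
  assumes "a < k"
  shows "cofactor (gram_pencil u r c k \<mu>) a a = poly (gram_poly u r (c \<circ> insert_index a) (k - 1)) \<mu>"
proof -
  have "(-1 :: complex) ^ (a + a) = 1" by simp
  then show ?thesis by (simp only: cofactor_def mat_delete_gram_pencil[OF assms] poly_gram_poly mult_1)
qed

text \<open>Jacobi's formula, with a minus sign because \<mu> is subtracted on the diagonal. Through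
  it second moments of the new row become derivatives.\<close>

lemma sum_cofactor_gram_pencil:
  "(\<Sum>a<k. cofactor (gram_pencil u r c k \<mu>) a a) = - poly (pderiv (gram_poly u r c k)) \<mu>"
proof (cases k)
  case 0
  then show ?thesis by (simp add: gram_poly_def pderiv_smult pderiv_char_poly[OF gram_carrier])
next
  case (Suc l)
  have "pderiv (gram_poly u r c k) = Polynomial.smult ((-1) ^ k) (\<Sum>a<k. char_poly (gram u r (c \<circ> insert_index a) l))"
    unfolding gram_poly_def pderiv_smult pderiv_char_poly[OF gram_carrier]
    using mat_delete_gram[of _ k u r c] Suc by (intro arg_cong[where f = "Polynomial.smult _"] sum.cong) auto
  then have "- poly (pderiv (gram_poly u r c k)) \<mu> = (\<Sum>a<k. (-1) ^ l * poly (char_poly (gram u r (c \<circ> insert_index a) l)) \<mu>)"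
    by (simp add: Suc poly_sum sum_distrib_left sum_negf[symmetric] del: sum.lessThan_Suc)
  also have "\<dots> = (\<Sum>a<k. cofactor (gram_pencil u r c k \<mu>) a a)"
    using Suc by (intro sum.cong) (auto simp: cofactor_gram_pencil_diagonal gram_poly_def)
  finally show ?thesis by simp
qed

lemma gram_pencil_Suc:
  "gram_pencil u (Suc r) c k \<mu> = gram_pencil u r c k \<mu> + Matrix.mat k k (\<lambda>(a, b). cnj (u (r, c a)) * u (r, c b))"
  by (rule eq_matI) (auto simp: gram_pencil_def gram_def)

lemma gram_poly_Suc:
  "poly (gram_poly u (Suc r) c k) \<mu> = poly (gram_poly u r c k) \<mu> +
    (\<Sum>a<k. \<Sum>b<k. cnj (u (r, c a)) * u (r, c b) * cofactor (gram_pencil u r c k \<mu>) a b)"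
  unfolding poly_gram_poly gram_pencil_Suc by (rule det_rank_one_update[OF gram_pencil_carrier])

lemma poly_gram_poly_0: "poly (gram_poly u 0 c k) \<mu> = (- \<mu>) ^ k"
proof -
  have "gram_pencil u 0 c k \<mu> = (- \<mu>) \<cdot>\<^sub>m 1\<^sub>m k"
    by (rule eq_matI) (auto simp: gram_pencil_def gram_def)
  then show ?thesis by (simp add: poly_gram_poly)
qed

text \<open>Multiply \<open>A\<^sub>\<nu> - A\<^sub>\<mu> = (\<mu> - \<nu>) 1\<close> by the two adjugates from both sides and take traces.\<close>

lemma sum_cofactor_product:
  "(\<mu> - \<nu>) * (\<Sum>a<k. \<Sum>b<k. cofactor (gram_pencil u r c k \<mu>) a b * cofactor (gram_pencil u r c k \<nu>) b a)
   = (\<Sum>a<k. cofactor (gram_pencil u r c k \<mu>) a a) * poly (gram_poly u r c k) \<nu>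
   - poly (gram_poly u r c k) \<mu> * (\<Sum>a<k. cofactor (gram_pencil u r c k \<nu>) a a)"
proof -
  define A where "A = gram_pencil u r c k \<mu>"
  define B where "B = gram_pencil u r c k \<nu>"
  have A: "A \<in> carrier_mat k k" and B: "B \<in> carrier_mat k k" by (simp_all add: A_def B_def gram_pencil_carrier)
  note adjA = adj_mat[OF A] and adjB = adj_mat[OF B]
  have BA: "B = A + (\<mu> - \<nu>) \<cdot>\<^sub>m 1\<^sub>m k"
    by (rule eq_matI) (auto simp: A_def B_def gram_pencil_def gram_def algebra_simps)
  have "adj_mat A * (B * adj_mat B) = adj_mat A * ((A + (\<mu> - \<nu>) \<cdot>\<^sub>m 1\<^sub>m k) * adj_mat B)"
    by (simp only: BA[symmetric])
  also have "(A + (\<mu> - \<nu>) \<cdot>\<^sub>m 1\<^sub>m k) * adj_mat B = A * adj_mat B + (\<mu> - \<nu>) \<cdot>\<^sub>m adj_mat B"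
    using A adjB(1) by (subst add_mult_distrib_mat[of _ k k]) auto
  also have "adj_mat A * (A * adj_mat B + (\<mu> - \<nu>) \<cdot>\<^sub>m adj_mat B) = adj_mat A * (A * adj_mat B) + adj_mat A * ((\<mu> - \<nu>) \<cdot>\<^sub>m adj_mat B)"
    using A adjA(1) adjB(1) by (intro mult_add_distrib_mat[of _ k k]) auto
  also have "adj_mat A * (A * adj_mat B) = Determinant.det A \<cdot>\<^sub>m adj_mat B"
    using A adjA adjB(1) by (subst assoc_mult_mat[symmetric, of _ k k _ k _ k]) auto
  also have "adj_mat A * ((\<mu> - \<nu>) \<cdot>\<^sub>m adj_mat B) = (\<mu> - \<nu>) \<cdot>\<^sub>m (adj_mat A * adj_mat B)"
    using adjA(1) adjB(1) by (intro mult_smult_distrib[of _ k k]) auto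
  also have "adj_mat A * (B * adj_mat B) = Determinant.det B \<cdot>\<^sub>m adj_mat A"
    unfolding adjB(2) using adjA(1) by (subst mult_smult_distrib[of _ k k]) auto
  finally have eq: "Determinant.det B \<cdot>\<^sub>m adj_mat A = Determinant.det A \<cdot>\<^sub>m adj_mat B + (\<mu> - \<nu>) \<cdot>\<^sub>m (adj_mat A * adj_mat B)" .
  have entry: "Determinant.det B * cofactor A a a = Determinant.det A * cofactor B a a + (\<mu> - \<nu>) * (\<Sum>b<k. cofactor A b a * cofactor B a b)"
    if "a < k" for a
  proof -
    have "(Determinant.det B \<cdot>\<^sub>m adj_mat A) $$ (a, a) = (Determinant.det A \<cdot>\<^sub>m adj_mat B + (\<mu> - \<nu>) \<cdot>\<^sub>m (adj_mat A * adj_mat B)) $$ (a, a)"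
      by (simp only: eq)
    moreover have "(adj_mat A * adj_mat B) $$ (a, a) = (\<Sum>b<k. cofactor A b a * cofactor B a b)"
      using that A B adjA(1) adjB(1)
      by (auto simp: times_mat_def scalar_prod_def adj_mat_def atLeast0LessThan intro!: sum.cong)
    ultimately show ?thesis using that A B adjA(1) adjB(1) by (simp add: adj_mat_def)
  qed
  have "(\<Sum>a<k. Determinant.det B * cofactor A a a) = (\<Sum>a<k. Determinant.det A * cofactor B a a + (\<mu> - \<nu>) * (\<Sum>b<k. cofactor A b a * cofactor B a b))"
    by (rule sum.cong) (use entry in auto)
  then have "Determinant.det B * (\<Sum>a<k. cofactor A a a) = Determinant.det A * (\<Sum>a<k. cofactor B a a) + (\<mu> - \<nu>) * (\<Sum>a<k. \<Sum>b<k. cofactor A b a * cofactor B a b)"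
    by (simp add: sum.distrib sum_distrib_left)
  moreover have "(\<Sum>a<k. \<Sum>b<k. cofactor A b a * cofactor B a b) = (\<Sum>a<k. \<Sum>b<k. cofactor A a b * cofactor B b a)"
    by (rule sum.swap)
  ultimately show ?thesis unfolding poly_gram_poly A_def[symmetric] B_def[symmetric] by (simp add: algebra_simps)
qed

text \<open>From 1 + sum s t \<le> prod (1 + s) prod (1 + t). The bound splits into one factor for
  each of the two columns, the shape that \<open>norm_det_le\<close> takes as input.\<close>

lemma norm_gram_pencil_le:
  assumes "a < k" "b < k"
  shows "norm (gram_pencil u r c k \<mu> $$ (a, b)) \<le> (1 + norm \<mu>) *
     ((\<Prod>i<r. 1 + norm (u (i, c a))) * (\<Prod>i<r. 1 + norm (u (i, c b))))"
proof -
  define s where "s i = norm (u (i, c a))" for i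
  define t where "t i = norm (u (i, c b))" for i
  have nn: "0 \<le> s i" "0 \<le> t i" for i by (simp_all add: s_def t_def)
  have P: "1 + (\<Sum>i<q. s i * t i) \<le> (\<Prod>i<q. 1 + s i) * (\<Prod>i<q. 1 + t i)" for q
  proof (induction q)
    case (Suc q)
    define S where "S = (\<Sum>i<q. s i * t i)"
    define Pq where "Pq = (\<Prod>i<q. 1 + s i) * (\<Prod>i<q. 1 + t i)"
    have "0 \<le> S" using nn by (simp add: S_def sum_nonneg)
    then have 1: "1 \<le> Pq" using Suc by (simp add: S_def Pq_def)
    have "1 + (S + s q * t q) \<le> Pq + 1 * (s q * t q)" using Suc by (simp add: S_def Pq_def)
    also have "\<dots> \<le> Pq + Pq * (s q * t q)"
      using 1 nn by (intro add_left_mono mult_right_mono) auto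
    also have "\<dots> \<le> Pq * ((1 + s q) * (1 + t q))"
      using 1 nn[of q] by (simp add: algebra_simps)
    finally show ?case by (simp add: S_def Pq_def mult_ac)
  qed simp
  have "gram_pencil u r c k \<mu> $$ (a, b) = (\<Sum>i<r. cnj (u (i, c a)) * u (i, c b)) - (if a = b then \<mu> else 0)"
    using assms by (simp add: gram_pencil_def gram_def)
  also have "norm \<dots> \<le> (\<Sum>i<r. s i * t i) + norm \<mu>"
    by (rule order_trans[OF norm_triangle_ineq4], rule add_mono)
      (auto simp: s_def t_def norm_mult intro!: order_trans[OF norm_sum])
  also have "\<dots> \<le> (1 + norm \<mu>) * (1 + (\<Sum>i<r. s i * t i))"
    using sum_nonneg[of "{..<r}" "\<lambda>i. s i * t i"] nn by (simp add: algebra_simps)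
  also have "\<dots> \<le> (1 + norm \<mu>) * ((\<Prod>i<r. 1 + s i) * (\<Prod>i<r. 1 + t i))"
    by (intro mult_left_mono P) auto
  finally show ?thesis by (simp add: s_def t_def)
qed

section \<open>Interpolation, and the solution of the recursion\<close>

lemma ex_interpolation_basis:
  "\<exists>b :: nat \<Rightarrow> 'a::field_char_0 poly. \<forall>p. degree p \<le> K \<longrightarrow> p = (\<Sum>j\<le>K. Polynomial.smult (poly p (of_nat j)) (b j))"
proof -
  define e where "e j = (\<Prod>i\<in>{..K} - {j}. [:- of_nat i, 1:] :: 'a poly)" for j
  define b where "b j = Polynomial.smult (1 / poly (e j) (of_nat j)) (e j)" for j
  have e: "poly (e j) (of_nat l) = 0 \<longleftrightarrow> l \<noteq> j" if "l \<le> K" for j l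
    using that by (auto simp: e_def poly_prod)
  have deg_e: "degree (e j) \<le> K" if "j \<le> K" for j
  proof -
    have "degree (e j) \<le> (\<Sum>i\<in>{..K} - {j}. degree ([:- of_nat i, 1:] :: 'a poly))"
      unfolding e_def using degree_prod_sum_le[of "{..K} - {j}" "\<lambda>i. [:- of_nat i, 1:] :: 'a poly"] by (simp add: o_def)
    also have "\<dots> = K" using that by simp
    finally show ?thesis .
  qed
  have "p = (\<Sum>j\<le>K. Polynomial.smult (poly p (of_nat j)) (b j))" (is "p = ?q") if "degree p \<le> K" for p
  proof (rule poly_eqI_degree[where A = "of_nat ` {..K}"])
    fix z :: 'a assume "z \<in> of_nat ` {..K}"
    then obtain l where l: "l \<le> K" "z = of_nat l" by auto
    have "poly ?q z = (\<Sum>j\<le>K. if j = l then poly p z else 0)"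
      unfolding poly_sum by (rule sum.cong) (use l e in \<open>auto simp: b_def\<close>)
    then show "poly p z = poly ?q z" using l by simp
  next
    have card: "card (of_nat ` {..K} :: 'a set) = Suc K"
      by (subst card_image) (auto intro: inj_onI)
    then show "degree p < card (of_nat ` {..K} :: 'a set)" using that by simp
    have "degree ?q \<le> K"
      by (rule degree_sum_le) (auto simp: b_def intro!: order_trans[OF degree_smult_le] deg_e)
    then show "degree ?q < card (of_nat ` {..K} :: 'a set)" using card by simp
  qed
  then show ?thesis by blast
qed

lemma lagD_sum: "lagD (\<Sum>j\<in>A. f j) = (\<Sum>j\<in>A. lagD (f j))"
  by (induction A rule: infinite_finite_induct) (auto simp: lagD_def pderiv_add algebra_simps)

lemma ex_interpolation_lagD:
  "\<exists>w :: 'a::field_char_0 \<Rightarrow> nat \<Rightarrow> 'a. \<forall>p \<mu>. degree p \<le> K \<longrightarrow> poly (lagD p) \<mu> = (\<Sum>j\<le>K. w \<mu> j * poly p (of_nat j))"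
proof -
  from ex_interpolation_basis[of K] obtain b :: "nat \<Rightarrow> 'a poly"
    where b: "\<And>p. degree p \<le> K \<Longrightarrow> p = (\<Sum>j\<le>K. Polynomial.smult (poly p (of_nat j)) (b j))" by blast
  have "poly (lagD p) \<mu> = (\<Sum>j\<le>K. poly (lagD (b j)) \<mu> * poly p (of_nat j))" if "degree p \<le> K" for p \<mu>
  proof -
    have "lagD p = (\<Sum>j\<le>K. Polynomial.smult (poly p (of_nat j)) (lagD (b j)))"
      by (subst b[OF that]) (simp add: lagD_sum lagD_smult)
    then show ?thesis by (simp add: poly_sum mult.commute)
  qed
  then show ?thesis by (intro exI[of _ "\<lambda>\<mu> j. poly (lagD (b j)) \<mu>"]) blast
qed

text \<open>The integer coefficient counts placements of t non-attacking rooks on an r by k board: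
  each factor \<kappa> uses up one entry and removes its row and its column.\<close>

definition cov_wronskian :: "complex \<Rightarrow> nat \<Rightarrow> nat \<Rightarrow> complex \<Rightarrow> complex \<Rightarrow> complex" where
  "cov_wronskian \<kappa> r k \<mu> \<nu> = (\<Sum>t\<le>k. \<kappa> ^ t * of_nat (fact t * (r choose t) * (k choose t)) * lag_wronskian (r - t) (k - t) \<mu> \<nu>)"

lemma cov_wronskian_0: "cov_wronskian \<kappa> 0 k \<mu> \<nu> = (\<mu> - \<nu>) * (\<mu> * \<nu>) ^ k"
proof -
  have "cov_wronskian \<kappa> 0 k \<mu> \<nu> = (\<Sum>t\<in>{0}. \<kappa> ^ t * of_nat (fact t * (0 choose t) * (k choose t)) * lag_wronskian (0 - t) (k - t) \<mu> \<nu>)"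
    unfolding cov_wronskian_def by (rule sum.mono_neutral_right) auto
  then show ?thesis by (simp add: lag_wronskian_def lag_0 poly_monom algebra_simps)
qed

text \<open>Pascal's rule for r + 1 rows: either the new row carries no excess entry and only raises
  the first Laguerre index, or it carries one, in any of the k columns, and k - 1 columns
  remain.\<close>

lemma cov_wronskian_Suc:
  "cov_wronskian \<kappa> (Suc r) k \<mu> \<nu> =
     (\<Sum>t\<le>k. \<kappa> ^ t * of_nat (fact t * (r choose t) * (k choose t)) * lag_wronskian (Suc (r - t)) (k - t) \<mu> \<nu>)
     + \<kappa> * of_nat k * cov_wronskian \<kappa> r (k - 1) \<mu> \<nu>"
proof (cases k)
  case 0
  then show ?thesis by (simp add: cov_wronskian_def)
next
  case (Suc l)
  let ?f = "\<lambda>t. \<kappa> ^ t * of_nat (fact t * (r choose t) * (k choose t)) * lag_wronskian (Suc (r - t)) (k - t) \<mu> \<nu>"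
  let ?g = "\<lambda>t. \<kappa> ^ Suc t * of_nat (fact (Suc t) * (r choose t) * (k choose Suc t)) * lag_wronskian (r - t) (l - t) \<mu> \<nu>"
  \<comment> \<open>For t > r the truncated subtractions disagree, but there the binomial
    coefficient vanishes.\<close>
  have f: "?f t = \<kappa> ^ t * of_nat (fact t * (r choose t) * (k choose t)) * lag_wronskian (Suc r - t) (k - t) \<mu> \<nu>" for t
    by (cases "t \<le> r") (simp_all add: Suc_diff_le)
  have "cov_wronskian \<kappa> (Suc r) k \<mu> \<nu> = lag_wronskian (Suc r) k \<mu> \<nu>
    + (\<Sum>t\<le>l. \<kappa> ^ Suc t * of_nat (fact (Suc t) * (Suc r choose Suc t) * (k choose Suc t)) * lag_wronskian (Suc r - Suc t) (k - Suc t) \<mu> \<nu>)"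
    unfolding cov_wronskian_def Suc by (subst sum.atMost_Suc_shift) simp
  also have "(\<Sum>t\<le>l. \<kappa> ^ Suc t * of_nat (fact (Suc t) * (Suc r choose Suc t) * (k choose Suc t)) * lag_wronskian (Suc r - Suc t) (k - Suc t) \<mu> \<nu>)
     = (\<Sum>t\<le>l. ?f (Suc t) + ?g t)"
  proof (rule sum.cong)
    fix t
    show "\<kappa> ^ Suc t * of_nat (fact (Suc t) * (Suc r choose Suc t) * (k choose Suc t)) * lag_wronskian (Suc r - Suc t) (k - Suc t) \<mu> \<nu>
       = ?f (Suc t) + ?g t"
      unfolding f[of "Suc t"] by (simp add: Suc algebra_simps del: fact_Suc)
  qed simp
  also have "lag_wronskian (Suc r) k \<mu> \<nu> + (\<Sum>t\<le>l. ?f (Suc t) + ?g t) = (\<Sum>t\<le>k. ?f t) + (\<Sum>t\<le>l. ?g t)"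
    unfolding Suc by (subst sum.atMost_Suc_shift) (simp add: sum.distrib)
  also have "(\<Sum>t\<le>l. ?g t) = \<kappa> * of_nat k * cov_wronskian \<kappa> r (k - 1) \<mu> \<nu>"
  proof -
    have "?g t = \<kappa> * of_nat k * (\<kappa> ^ t * of_nat (fact t * (r choose t) * (l choose t)) * lag_wronskian (r - t) (l - t) \<mu> \<nu>)" for t
    proof -
      have "Suc t * (k choose Suc t) = k * (l choose t)" using Suc_times_binomial_eq[of l t] by (simp add: Suc)
      moreover have "fact (Suc t) * (r choose t) * (k choose Suc t) = (Suc t * (k choose Suc t)) * (fact t * (r choose t))"
        by (simp only: fact_Suc of_nat_id mult_ac)
      ultimately have "fact (Suc t) * (r choose t) * (k choose Suc t) = k * (fact t * (r choose t) * (l choose t))"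
        by (simp only: mult_ac)
      then show ?thesis by (simp only: of_nat_mult power_Suc mult_ac)
    qed
    then show ?thesis by (simp only: cov_wronskian_def Suc diff_Suc_1 sum_distrib_left)
  qed
  finally show ?thesis .
qed

section \<open>Moments of arrays of independent entries\<close>

lemma cnj_measurable [measurable]: "cnj \<in> borel_measurable borel"
  by (intro borel_measurable_continuous_onI continuous_intros)

lemma prod_power_of_bool:
  fixes f :: "'b \<Rightarrow> 'c::comm_monoid_mult"
  assumes "finite R" "q \<in> R"
  shows "(\<Prod>i\<in>R. f i ^ of_bool (i = q)) = f q"
proof -
  have "(\<Prod>i\<in>R. f i ^ of_bool (i = q)) = (\<Prod>i\<in>R. if i = q then f i else 1)"
    by (rule prod.cong) auto
  then show ?thesis using assms by simp
qed

text \<open>Here \<kappa> is the excess of E |x|^4 over the value 2 of a standard complex Gaussian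
  variable.\<close>

locale iid_entries = prob_space M for M :: "'a measure" +
  fixes x :: "nat \<times> nat \<Rightarrow> 'a \<Rightarrow> complex" and n m :: nat and \<kappa> :: real
  assumes indep: "indep_vars (\<lambda>_. borel) x ({..<n} \<times> {..<m})"
    and int4: "ij \<in> {..<n} \<times> {..<m} \<Longrightarrow> integrable M (\<lambda>\<omega>. norm (x ij \<omega>) ^ 4)"
    and mom1: "ij \<in> {..<n} \<times> {..<m} \<Longrightarrow> expectation (x ij) = 0"
    and mom2: "ij \<in> {..<n} \<times> {..<m} \<Longrightarrow> expectation (\<lambda>\<omega>. x ij \<omega> ^ 2) = 0"
    and mom11: "ij \<in> {..<n} \<times> {..<m} \<Longrightarrow> expectation (\<lambda>\<omega>. x ij \<omega> * cnj (x ij \<omega>)) = 1"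
    and mom22: "ij \<in> {..<n} \<times> {..<m} \<Longrightarrow> expectation (\<lambda>\<omega>. x ij \<omega> ^ 2 * cnj (x ij \<omega>) ^ 2) = of_real (2 + \<kappa>)"
begin

definition Ix :: "(nat \<times> nat) set" where "Ix = {..<n} \<times> {..<m}"

definition mom :: "nat \<Rightarrow> nat \<Rightarrow> nat \<times> nat \<Rightarrow> complex" where
  "mom p q ij = expectation (\<lambda>\<omega>. x ij \<omega> ^ p * cnj (x ij \<omega>) ^ q)"

lemma x_measurable: "ij \<in> Ix \<Longrightarrow> random_variable borel (x ij)"
  using indep by (auto simp: indep_vars_def Ix_def)

lemma int_mom:
  assumes ij: "ij \<in> Ix" and pq: "p + q \<le> 4"
  shows "integrable M (\<lambda>\<omega>. x ij \<omega> ^ p * cnj (x ij \<omega>) ^ q)"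
proof (rule Bochner_Integration.integrable_bound)
  show "integrable M (\<lambda>\<omega>. 1 + norm (x ij \<omega>) ^ 4)"
    using int4[of ij] ij by (simp add: Ix_def)
  show "(\<lambda>\<omega>. x ij \<omega> ^ p * cnj (x ij \<omega>) ^ q) \<in> borel_measurable M"
    using x_measurable[OF ij] by measurable
  have "t ^ (p + q) \<le> 1 + t ^ 4" if "0 \<le> t" for t :: real
  proof (cases "t \<le> 1")
    case True
    then have "t ^ (p + q) \<le> 1" using that by (intro power_le_one) auto
    then show ?thesis using that by (simp add: add_increasing2)
  next
    case False
    then have "t ^ (p + q) \<le> t ^ 4" using pq by (intro power_increasing) auto
    then show ?thesis by simp
  qed
  then show "AE \<omega> in M. norm (x ij \<omega> ^ p * cnj (x ij \<omega>) ^ q) \<le> norm (1 + norm (x ij \<omega>) ^ 4)"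
    by (intro AE_I2) (simp add: norm_mult norm_power power_add[symmetric])
qed

lemma mom_simps:
  assumes ij: "ij \<in> Ix"
  shows "mom 0 0 ij = 1" "mom 1 0 ij = 0" "mom 0 1 ij = 0" "mom 2 0 ij = 0" "mom 0 2 ij = 0"
    "mom 1 1 ij = 1" "mom 2 2 ij = of_real (2 + \<kappa>)"
proof -
  have ij': "ij \<in> {..<n} \<times> {..<m}" using ij by (simp add: Ix_def)
  show "mom 0 0 ij = 1" by (simp add: mom_def prob_space)
  show 1: "mom 1 0 ij = 0" using mom1[OF ij'] by (simp add: mom_def)
  show 2: "mom 2 0 ij = 0" using mom2[OF ij'] by (simp add: mom_def)
  have "mom 0 p ij = cnj (mom p 0 ij)" for p
    by (simp add: mom_def complex_cnj_power[symmetric] del: complex_cnj_power)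
  then show "mom 0 1 ij = 0" "mom 0 2 ij = 0" using 1 2 by simp_all
  show "mom 1 1 ij = 1" using mom11[OF ij'] by (simp add: mom_def)
  show "mom 2 2 ij = of_real (2 + \<kappa>)" using mom22[OF ij'] by (simp add: mom_def)
qed

lemma monomial_expectation:
  assumes R: "finite R" "R \<subseteq> Ix" and ab: "\<And>ij. a ij + b ij \<le> 4"
  shows "integrable M (\<lambda>\<omega>. \<Prod>ij\<in>R. x ij \<omega> ^ a ij * cnj (x ij \<omega>) ^ b ij)"
    and "expectation (\<lambda>\<omega>. \<Prod>ij\<in>R. x ij \<omega> ^ a ij * cnj (x ij \<omega>) ^ b ij) = (\<Prod>ij\<in>R. mom (a ij) (b ij) ij)"
proof -
  have "indep_vars (\<lambda>_. borel) x R"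
    using indep R by (auto simp: Ix_def intro: indep_vars_subset)
  then have ind: "indep_vars (\<lambda>_. borel) (\<lambda>ij \<omega>. x ij \<omega> ^ a ij * cnj (x ij \<omega>) ^ b ij) R"
    by (rule indep_vars_compose2) measurable
  have int: "integrable M (\<lambda>\<omega>. x ij \<omega> ^ a ij * cnj (x ij \<omega>) ^ b ij)" if "ij \<in> R" for ij
    by (rule int_mom[OF _ ab]) (use that R in auto)
  show "integrable M (\<lambda>\<omega>. \<Prod>ij\<in>R. x ij \<omega> ^ a ij * cnj (x ij \<omega>) ^ b ij)"
    by (rule indep_vars_integrable[OF R(1) ind int])
  show "expectation (\<lambda>\<omega>. \<Prod>ij\<in>R. x ij \<omega> ^ a ij * cnj (x ij \<omega>) ^ b ij) = (\<Prod>ij\<in>R. mom (a ij) (b ij) ij)"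
    unfolding mom_def by (rule indep_vars_lebesgue_integral[OF R(1) ind int])
qed

text \<open>Wick's rule with one correction: two pairings of conjugated with unconjugated entries,
  and \<kappa> when all four coincide, where both pairings already account for 2.\<close>

lemma fourth_moment:
  assumes "P \<in> Ix" "Q \<in> Ix" "S \<in> Ix" "T \<in> Ix"
  shows "integrable M (\<lambda>\<omega>. cnj (x P \<omega>) * x Q \<omega> * (cnj (x S \<omega>) * x T \<omega>))"
    and "expectation (\<lambda>\<omega>. cnj (x P \<omega>) * x Q \<omega> * (cnj (x S \<omega>) * x T \<omega>)) =
      of_bool (P = Q \<and> S = T) + of_bool (P = T \<and> Q = S) + of_real \<kappa> * of_bool (P = Q \<and> Q = S \<and> S = T)"
proof -
  define R where "R = {P, Q, S, T}"
  define a where "a ij = (of_bool (ij = Q) + of_bool (ij = T) :: nat)" for ij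
  define b where "b ij = (of_bool (ij = P) + of_bool (ij = S) :: nat)" for ij
  have R: "finite R" "R \<subseteq> Ix" and mem: "P \<in> R" "Q \<in> R" "S \<in> R" "T \<in> R" using assms by (auto simp: R_def)
  have ab: "a ij + b ij \<le> 4" for ij by (auto simp: a_def b_def)
  have eq: "(\<Prod>ij\<in>R. x ij \<omega> ^ a ij * cnj (x ij \<omega>) ^ b ij) = cnj (x P \<omega>) * x Q \<omega> * (cnj (x S \<omega>) * x T \<omega>)" for \<omega>
    unfolding a_def b_def power_add prod.distrib
    using prod_power_of_bool[OF R(1), of _ "\<lambda>ij. x ij \<omega>"] prod_power_of_bool[OF R(1), of _ "\<lambda>ij. cnj (x ij \<omega>)"] mem
    by (simp add: mult_ac)
  note E = monomial_expectation[of R a b, OF R ab, unfolded eq]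
  show "integrable M (\<lambda>\<omega>. cnj (x P \<omega>) * x Q \<omega> * (cnj (x S \<omega>) * x T \<omega>))" by (rule E(1))
  have zero: "(\<Prod>ij\<in>R. mom (a ij) (b ij) ij) = 0" if "ij \<in> R" "mom (a ij) (b ij) ij = 0" for ij
    using that R(1) by (intro prod_zero) auto
  have m: "mom 0 0 ij = 1" "mom (Suc 0) 0 ij = 0" "mom 0 (Suc 0) ij = 0" "mom (Suc (Suc 0)) 0 ij = 0" "mom 0 (Suc (Suc 0)) ij = 0"
    "mom (Suc 0) (Suc 0) ij = 1" "mom (Suc (Suc 0)) (Suc (Suc 0)) ij = of_real (2 + \<kappa>)" if "ij \<in> R" for ij
    using mom_simps[of ij] R(2) that by (auto simp: numeral_2_eq_2)
  \<comment> \<open>Outside the listed patterns some entry occurs once, or only unconjugated, or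
    only conjugated, and its moment annihilates the product.\<close>
  have "(\<Prod>ij\<in>R. mom (a ij) (b ij) ij) =
      of_bool (P = Q \<and> S = T) + of_bool (P = T \<and> Q = S) + of_real \<kappa> * of_bool (P = Q \<and> Q = S \<and> S = T)"
  proof (cases "Q = T")
    case QT: True
    show ?thesis
    proof (cases "P = S")
      case PS: True
      show ?thesis
      proof (cases "P = Q")
        case True
        then have "R = {P}" using QT PS by (auto simp: R_def)
        then show ?thesis using QT PS True m[of P] mem by (simp add: a_def b_def)
      next
        case False
        then show ?thesis using QT PS zero[of Q] m[of Q] mem by (simp add: a_def b_def)
      qed
    next
      case PS: False
      show ?thesis
      proof (cases "P = Q")
        case True
        then show ?thesis using QT PS zero[of S] m[of S] mem by (simp add: a_def b_def)
      next
        case False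
        then show ?thesis using QT PS zero[of P] m[of P] mem by (simp add: a_def b_def)
      qed
    qed
  next
    case QT: False
    show ?thesis
    proof (cases "P = S")
      case PS: True
      show ?thesis
      proof (cases "P = Q")
        case True
        then show ?thesis using QT PS zero[of T] m[of T] mem by (simp add: a_def b_def)
      next
        case False
        then show ?thesis using QT PS zero[of Q] m[of Q] mem by (auto simp: a_def b_def)
      qed
    next
      case PS: False
      consider "P = Q" "S = T" | "P = T" "S = Q" | "Q \<noteq> P" "Q \<noteq> S" | "T \<noteq> P" "T \<noteq> S" | "P = Q" "T = P" | "S = Q" "T = S"
        by blast
      then show ?thesis
      proof cases
        case 1
        then have "R = {P, S}" by (auto simp: R_def)
        then show ?thesis using 1 QT PS m[of P] m[of S] mem by (simp add: a_def b_def)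
      next
        case 2
        then have "R = {P, S}" by (auto simp: R_def)
        then show ?thesis using 2 QT PS m[of P] m[of S] mem by (simp add: a_def b_def)
      next
        case 3
        then show ?thesis using QT PS zero[of Q] m[of Q] mem by (auto simp: a_def b_def)
      next
        case 4
        then show ?thesis using QT PS zero[of T] m[of T] mem by (auto simp: a_def b_def)
      qed (use QT in auto)
    qed
  qed
  with E(2) show "expectation (\<lambda>\<omega>. cnj (x P \<omega>) * x Q \<omega> * (cnj (x S \<omega>) * x T \<omega>)) =
      of_bool (P = Q \<and> S = T) + of_bool (P = T \<and> Q = S) + of_real \<kappa> * of_bool (P = Q \<and> Q = S \<and> S = T)" by simp
qed

lemma second_moment:
  assumes "P \<in> Ix" "Q \<in> Ix"
  shows "integrable M (\<lambda>\<omega>. cnj (x P \<omega>) * x Q \<omega>)"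
    and "expectation (\<lambda>\<omega>. cnj (x P \<omega>) * x Q \<omega>) = of_bool (P = Q)"
proof -
  define R where "R = {P, Q}"
  define a where "a ij = (of_bool (ij = Q) :: nat)" for ij
  define b where "b ij = (of_bool (ij = P) :: nat)" for ij
  have R: "finite R" "R \<subseteq> Ix" and mem: "P \<in> R" "Q \<in> R" using assms by (auto simp: R_def)
  have ab: "a ij + b ij \<le> 4" for ij by (auto simp: a_def b_def)
  have eq: "(\<Prod>ij\<in>R. x ij \<omega> ^ a ij * cnj (x ij \<omega>) ^ b ij) = cnj (x P \<omega>) * x Q \<omega>" for \<omega>
    unfolding a_def b_def prod.distrib
    using prod_power_of_bool[OF R(1), of _ "\<lambda>ij. x ij \<omega>"] prod_power_of_bool[OF R(1), of _ "\<lambda>ij. cnj (x ij \<omega>)"] mem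
    by (simp add: mult_ac)
  note E = monomial_expectation[of R a b, OF R ab, unfolded eq]
  show "integrable M (\<lambda>\<omega>. cnj (x P \<omega>) * x Q \<omega>)" by (rule E(1))
  have "(\<Prod>ij\<in>R. mom (a ij) (b ij) ij) = of_bool (P = Q)"
  proof (cases "P = Q")
    case True
    then have "R = {P}" by (auto simp: R_def)
    then show ?thesis using True mom_simps[of P] assms by (simp add: a_def b_def)
  next
    case False
    then have "mom (a Q) (b Q) Q = 0" using mom_simps[of Q] assms by (simp add: a_def b_def)
    then have "(\<Prod>ij\<in>R. mom (a ij) (b ij) ij) = 0" using mem R(1) by (intro prod_zero) auto
    then show ?thesis using False by simp
  qed
  with E(2) show "expectation (\<lambda>\<omega>. cnj (x P \<omega>) * x Q \<omega>) = of_bool (P = Q)" by simp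
qed

section \<open>Integrable functions of the earlier rows and independence of the next row\<close>

definition rows :: "nat \<Rightarrow> (nat \<times> nat) set" where "rows r = {..<r} \<times> {..<m}"

definition row_weight :: "nat \<Rightarrow> (nat \<times> nat \<Rightarrow> complex) \<Rightarrow> real" where
  "row_weight r u = (\<Prod>ij\<in>rows r. 1 + norm (u ij))"

text \<open>Growth of degree \<open>e = 4\<close> in each entry is the most that finite fourth moments integrate.\<close>

definition row_fun :: "nat \<Rightarrow> nat \<Rightarrow> ((nat \<times> nat \<Rightarrow> complex) \<Rightarrow> complex) \<Rightarrow> bool" where
  "row_fun e r U \<longleftrightarrow> U \<in> borel_measurable (PiM (rows r) (\<lambda>_. borel)) \<and>
     (\<forall>u. U (restrict u (rows r)) = U u) \<and> (\<exists>C\<ge>0. \<forall>u. norm (U u) \<le> C * row_weight r u ^ e)"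

definition array :: "'a \<Rightarrow> nat \<times> nat \<Rightarrow> complex" where "array \<omega> ij = x ij \<omega>"

lemma finite_rows: "finite (rows r)"
  by (simp add: rows_def)

lemma rows_subset: "r \<le> n \<Longrightarrow> rows r \<subseteq> Ix"
  by (auto simp: rows_def Ix_def)

lemma row_weight_nonneg: "0 \<le> row_weight r u"
  unfolding row_weight_def by (intro prod_nonneg) auto

lemma row_fun_mult: "row_fun 2 r U \<Longrightarrow> row_fun 2 r V \<Longrightarrow> row_fun 4 r (\<lambda>u. U u * V u)"
  unfolding row_fun_def
proof (elim conjE exE, intro conjI)
  fix C D assume C: "0 \<le> C" "\<forall>u. norm (U u) \<le> C * row_weight r u ^ 2" and D: "0 \<le> D" "\<forall>u. norm (V u) \<le> D * row_weight r u ^ 2"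
  show "\<exists>C\<ge>0. \<forall>u. norm (U u * V u) \<le> C * row_weight r u ^ 4"
  proof (intro exI[of _ "C * D"] conjI allI)
    fix u
    have "norm (U u * V u) \<le> (C * row_weight r u ^ 2) * (D * row_weight r u ^ 2)"
      unfolding norm_mult using C D row_weight_nonneg by (intro mult_mono) auto
    also have "\<dots> = C * D * row_weight r u ^ 4" by (simp add: power2_eq_square power4_eq_xxxx mult_ac)
    finally show "norm (U u * V u) \<le> C * D * row_weight r u ^ 4" .
  qed (use C D in auto)
qed auto

lemma array_restrict_measurable:
  assumes "R \<subseteq> Ix"
  shows "(\<lambda>\<omega>. restrict (array \<omega>) R) \<in> measurable M (PiM R (\<lambda>_. borel))"
  unfolding array_def[abs_def] using x_measurable assms by (intro measurable_restrict) auto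

lemma row_fun_measurable:
  assumes U: "row_fun e r U" and r: "r \<le> n"
  shows "(\<lambda>\<omega>. U (array \<omega>)) \<in> borel_measurable M"
proof -
  have "(\<lambda>\<omega>. U (restrict (array \<omega>) (rows r))) \<in> borel_measurable M"
    using U by (intro measurable_compose[OF array_restrict_measurable[OF rows_subset[OF r]]]) (simp add: row_fun_def)
  then show ?thesis using U by (simp add: row_fun_def)
qed

lemma row_fun_integrable:
  assumes U: "row_fun 4 r U" and r: "r \<le> n"
  shows "integrable M (\<lambda>\<omega>. U (array \<omega>))"
proof -
  obtain C where C: "C \<ge> 0" "\<And>u. norm (U u) \<le> C * row_weight r u ^ 4" using U by (auto simp: row_fun_def)
  have "indep_vars (\<lambda>_. borel) x (rows r)"
    using indep rows_subset[OF r] by (auto simp: Ix_def intro: indep_vars_subset)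
  then have ind: "indep_vars (\<lambda>_. borel) (\<lambda>ij \<omega>. (1 + norm (x ij \<omega>)) ^ 4) (rows r)"
    by (rule indep_vars_compose2) measurable
  have int: "integrable M (\<lambda>\<omega>. (1 + norm (x ij \<omega>)) ^ 4)" if "ij \<in> rows r" for ij
  proof (rule Bochner_Integration.integrable_bound)
    have ij: "ij \<in> Ix" using that rows_subset[OF r] by auto
    show "integrable M (\<lambda>\<omega>. 16 * (1 + norm (x ij \<omega>) ^ 4))"
      using int4[of ij] ij by (simp add: Ix_def)
    show "(\<lambda>\<omega>. (1 + norm (x ij \<omega>)) ^ 4) \<in> borel_measurable M"
      using x_measurable[OF ij] by measurable
    have "(1 + t) ^ 4 \<le> 16 * (1 + t ^ 4)" if "0 \<le> t" for t :: real
    proof (cases "t \<le> 1")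
      case True
      then have "(1 + t) ^ 4 \<le> 2 ^ 4" using that by (intro power_mono) auto
      also have "\<dots> \<le> 16 * (1 + t ^ 4)" using that by simp
      finally show ?thesis .
    next
      case False
      then have "(1 + t) ^ 4 \<le> (2 * t) ^ 4" using that by (intro power_mono) auto
      also have "\<dots> \<le> 16 * (1 + t ^ 4)" by (simp add: power_mult_distrib)
      finally show ?thesis .
    qed
    then show "AE \<omega> in M. norm ((1 + norm (x ij \<omega>)) ^ 4) \<le> norm (16 * (1 + norm (x ij \<omega>) ^ 4))"
      by (intro AE_I2) simp
  qed
  have "integrable M (\<lambda>\<omega>. \<Prod>ij\<in>rows r. (1 + norm (x ij \<omega>)) ^ 4)"
    by (rule indep_vars_integrable[OF finite_rows ind int])
  then have "integrable M (\<lambda>\<omega>. C * row_weight r (array \<omega>) ^ 4)"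
    by (simp add: row_weight_def array_def prod_power_distrib)
  then show ?thesis
    by (rule Bochner_Integration.integrable_bound)
      (use C row_fun_measurable[OF U r] row_weight_nonneg in auto)
qed

lemma row_fun_mult_row:
  assumes U: "row_fun 4 r U" and r: "r < n"
    and V: "V \<in> borel_measurable (PiM ({r} \<times> {..<m}) (\<lambda>_. borel))" "\<And>u. V (restrict u ({r} \<times> {..<m})) = V u"
    and int: "integrable M (\<lambda>\<omega>. V (array \<omega>))"
  shows "integrable M (\<lambda>\<omega>. U (array \<omega>) * V (array \<omega>))"
    and "expectation (\<lambda>\<omega>. U (array \<omega>) * V (array \<omega>)) = expectation (\<lambda>\<omega>. U (array \<omega>)) * expectation (\<lambda>\<omega>. V (array \<omega>))"
proof -
  have U': "U \<in> borel_measurable (PiM (rows r) (\<lambda>_. borel))" "\<And>u. U (restrict u (rows r)) = U u"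
    using U by (auto simp: row_fun_def)
  have "indep_var (PiM (rows r) (\<lambda>_. borel)) (\<lambda>\<omega>. restrict (\<lambda>ij. x ij \<omega>) (rows r))
      (PiM ({r} \<times> {..<m}) (\<lambda>_. borel)) (\<lambda>\<omega>. restrict (\<lambda>ij. x ij \<omega>) ({r} \<times> {..<m}))"
    by (rule indep_var_restrict[OF indep]) (use r in \<open>auto simp: rows_def\<close>)
  from indep_var_compose[OF this U'(1) V(1)]
  have ind: "indep_var borel (\<lambda>\<omega>. U (array \<omega>)) borel (\<lambda>\<omega>. V (array \<omega>))"
    by (simp add: o_def U'(2) V(2) array_def[abs_def])
  note int' = row_fun_integrable[OF U less_imp_le[OF r]] int
  show "integrable M (\<lambda>\<omega>. U (array \<omega>) * V (array \<omega>))" by (rule indep_var_integrable[OF ind int'])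
  show "expectation (\<lambda>\<omega>. U (array \<omega>) * V (array \<omega>)) = expectation (\<lambda>\<omega>. U (array \<omega>)) * expectation (\<lambda>\<omega>. V (array \<omega>))"
    by (rule indep_var_lebesgue_integral[OF ind int'])
qed

lemma row_fun_mult_second:
  assumes U: "row_fun 4 r U" and r: "r < n" and pq: "p < m" "q < m"
  shows "integrable M (\<lambda>\<omega>. U (array \<omega>) * (cnj (array \<omega> (r, p)) * array \<omega> (r, q)))"
    and "expectation (\<lambda>\<omega>. U (array \<omega>) * (cnj (array \<omega> (r, p)) * array \<omega> (r, q))) = expectation (\<lambda>\<omega>. U (array \<omega>)) * of_bool (p = q)"
proof -
  have Ix: "(r, p) \<in> Ix" "(r, q) \<in> Ix" using r pq by (auto simp: Ix_def)
  note mom = second_moment[OF Ix]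
  have V: "(\<lambda>u. cnj (u (r, p)) * u (r, q)) \<in> borel_measurable (PiM ({r} \<times> {..<m}) (\<lambda>_. borel :: complex measure))"
    using pq by (auto intro!: borel_measurable_times measurable_compose[OF _ cnj_measurable] measurable_component_singleton)
  note * = row_fun_mult_row[OF U r V]
  show "integrable M (\<lambda>\<omega>. U (array \<omega>) * (cnj (array \<omega> (r, p)) * array \<omega> (r, q)))"
    by (rule *) (use pq mom in \<open>auto simp: array_def\<close>)
  have "expectation (\<lambda>\<omega>. U (array \<omega>) * (cnj (array \<omega> (r, p)) * array \<omega> (r, q))) = expectation (\<lambda>\<omega>. U (array \<omega>)) * expectation (\<lambda>\<omega>. cnj (array \<omega> (r, p)) * array \<omega> (r, q))"
    by (rule *) (use pq mom in \<open>auto simp: array_def\<close>)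
  then show "expectation (\<lambda>\<omega>. U (array \<omega>) * (cnj (array \<omega> (r, p)) * array \<omega> (r, q))) = expectation (\<lambda>\<omega>. U (array \<omega>)) * of_bool (p = q)"
    using mom(2) by (simp add: array_def)
qed

lemma row_fun_mult_fourth:
  assumes U: "row_fun 4 r U" and r: "r < n" and pq: "p < m" "q < m" "s < m" "t < m"
  shows "integrable M (\<lambda>\<omega>. U (array \<omega>) * (cnj (array \<omega> (r, p)) * array \<omega> (r, q) * (cnj (array \<omega> (r, s)) * array \<omega> (r, t))))"
    and "expectation (\<lambda>\<omega>. U (array \<omega>) * (cnj (array \<omega> (r, p)) * array \<omega> (r, q) * (cnj (array \<omega> (r, s)) * array \<omega> (r, t)))) =
      expectation (\<lambda>\<omega>. U (array \<omega>)) * (of_bool (p = q \<and> s = t) + of_bool (p = t \<and> q = s) + of_real \<kappa> * of_bool (p = q \<and> q = s \<and> s = t))"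
proof -
  have Ix: "(r, p) \<in> Ix" "(r, q) \<in> Ix" "(r, s) \<in> Ix" "(r, t) \<in> Ix" using r pq by (auto simp: Ix_def)
  note mom = fourth_moment[OF Ix]
  have V: "(\<lambda>u. cnj (u (r, p)) * u (r, q) * (cnj (u (r, s)) * u (r, t))) \<in> borel_measurable (PiM ({r} \<times> {..<m}) (\<lambda>_. borel :: complex measure))"
    using pq by (auto intro!: borel_measurable_times measurable_compose[OF _ cnj_measurable] measurable_component_singleton)
  note * = row_fun_mult_row[OF U r V]
  show "integrable M (\<lambda>\<omega>. U (array \<omega>) * (cnj (array \<omega> (r, p)) * array \<omega> (r, q) * (cnj (array \<omega> (r, s)) * array \<omega> (r, t))))"
    by (rule *) (use pq mom in \<open>auto simp: array_def\<close>)
  have "expectation (\<lambda>\<omega>. U (array \<omega>) * (cnj (array \<omega> (r, p)) * array \<omega> (r, q) * (cnj (array \<omega> (r, s)) * array \<omega> (r, t)))) =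
     expectation (\<lambda>\<omega>. U (array \<omega>)) * expectation (\<lambda>\<omega>. cnj (array \<omega> (r, p)) * array \<omega> (r, q) * (cnj (array \<omega> (r, s)) * array \<omega> (r, t)))"
    by (rule *) (use pq mom in \<open>auto simp: array_def\<close>)
  then show "expectation (\<lambda>\<omega>. U (array \<omega>) * (cnj (array \<omega> (r, p)) * array \<omega> (r, q) * (cnj (array \<omega> (r, s)) * array \<omega> (r, t)))) =
      expectation (\<lambda>\<omega>. U (array \<omega>)) * (of_bool (p = q \<and> s = t) + of_bool (p = t \<and> q = s) + of_real \<kappa> * of_bool (p = q \<and> q = s \<and> s = t))"
    using mom(2) by (simp add: array_def)
qed

end

lemma prod_ge_1_mono2:
  fixes h :: "'b \<Rightarrow> real"
  assumes "finite B" "A \<subseteq> B" "\<And>x. 1 \<le> h x"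
  shows "prod h A \<le> prod h B"
proof (rule prod_mono2[OF assms(1,2)])
  show "1 \<le> h x" for x by (rule assms)
  show "0 \<le> h x" for x using assms(3)[of x] by linarith
qed

lemma sum_of_bool_eq:
  fixes f :: "nat \<Rightarrow> 'b::semiring_1"
  assumes "s < k"
  shows "(\<Sum>t<k. f t * of_bool (s = t)) = f s" "(\<Sum>t<k. f t * of_bool (t = s)) = f s"
proof -
  have "(\<Sum>t<k. f t * of_bool (s = t)) = (\<Sum>t<k. if s = t then f t else 0)"
    by (rule sum.cong) auto
  then show 1: "(\<Sum>t<k. f t * of_bool (s = t)) = f s" using assms by simp
  then show "(\<Sum>t<k. f t * of_bool (t = s)) = f s" by (simp only: eq_commute[of s])
qed

text \<open>For products of cofactors the three patterns become the product of the traces of the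
  adjugates, the trace of their product, and the sum over diagonal cofactors.\<close>

lemma sum_fourth_moment:
  fixes G :: "nat \<Rightarrow> nat \<Rightarrow> nat \<Rightarrow> nat \<Rightarrow> 'b::comm_semiring_1"
  shows "(\<Sum>p<k. \<Sum>q<k. \<Sum>s<k. \<Sum>t<k. G p q s t *
      (of_bool (p = q \<and> s = t) + of_bool (p = t \<and> q = s) + z * of_bool (p = q \<and> q = s \<and> s = t)))
    = (\<Sum>p<k. \<Sum>s<k. G p p s s) + (\<Sum>p<k. \<Sum>q<k. G p q q p) + z * (\<Sum>p<k. G p p p p)"
proof -
  have inner: "(\<Sum>q<k. \<Sum>s<k. \<Sum>t<k. G p q s t *
      (of_bool (p = q \<and> s = t) + of_bool (p = t \<and> q = s) + z * of_bool (p = q \<and> q = s \<and> s = t)))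
    = (\<Sum>s<k. G p p s s) + (\<Sum>q<k. G p q q p) + z * G p p p p" if p: "p < k" for p
  proof -
    have t: "(\<Sum>t<k. G p q s t *
      (of_bool (p = q \<and> s = t) + of_bool (p = t \<and> q = s) + z * of_bool (p = q \<and> q = s \<and> s = t)))
      = G p q s s * of_bool (p = q) + G p q s p * of_bool (q = s) + z * (G p q s s * of_bool (p = q)) * of_bool (q = s)"
      if s: "s < k" for q s
    proof -
      have "(\<Sum>t<k. G p q s t *
         (of_bool (p = q \<and> s = t) + of_bool (p = t \<and> q = s) + z * of_bool (p = q \<and> q = s \<and> s = t)))
        = (\<Sum>t<k. (G p q s t * of_bool (p = q)) * of_bool (s = t)) + (\<Sum>t<k. (G p q s t * of_bool (q = s)) * of_bool (p = t))
          + (\<Sum>t<k. (z * (G p q s t * of_bool (p = q)) * of_bool (q = s)) * of_bool (s = t))"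
        unfolding sum.distrib[symmetric] by (rule sum.cong) (auto simp: of_bool_conj algebra_simps)
      then show ?thesis by (simp only: sum_of_bool_eq[OF s] sum_of_bool_eq[OF p])
    qed
    have s: "(\<Sum>s<k. \<Sum>t<k. G p q s t *
      (of_bool (p = q \<and> s = t) + of_bool (p = t \<and> q = s) + z * of_bool (p = q \<and> q = s \<and> s = t)))
      = (\<Sum>s<k. G p q s s) * of_bool (p = q) + G p q q p + (z * G p q q q) * of_bool (p = q)" if q: "q < k" for q
    proof -
      have "(\<Sum>s<k. \<Sum>t<k. G p q s t *
        (of_bool (p = q \<and> s = t) + of_bool (p = t \<and> q = s) + z * of_bool (p = q \<and> q = s \<and> s = t)))
        = (\<Sum>s<k. G p q s s * of_bool (p = q) + G p q s p * of_bool (q = s) + z * (G p q s s * of_bool (p = q)) * of_bool (q = s))"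
        by (rule sum.cong) (simp_all only: t lessThan_iff)
      also have "\<dots> = (\<Sum>s<k. G p q s s) * of_bool (p = q) + G p q q p + z * (G p q q q * of_bool (p = q))"
        by (simp only: sum.distrib sum_of_bool_eq[OF q] sum_distrib_right)
      finally show ?thesis by (simp only: mult.assoc)
    qed
    have "(\<Sum>q<k. \<Sum>s<k. \<Sum>t<k. G p q s t *
      (of_bool (p = q \<and> s = t) + of_bool (p = t \<and> q = s) + z * of_bool (p = q \<and> q = s \<and> s = t)))
      = (\<Sum>q<k. (\<Sum>s<k. G p q s s) * of_bool (p = q) + G p q q p + (z * G p q q q) * of_bool (p = q))"
      by (rule sum.cong) (simp_all only: s lessThan_iff)
    also have "\<dots> = (\<Sum>s<k. G p p s s) + (\<Sum>q<k. G p q q p) + z * G p p p p"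
      by (simp only: sum.distrib sum_of_bool_eq[OF p])
    finally show ?thesis .
  qed
  have "(\<Sum>p<k. \<Sum>q<k. \<Sum>s<k. \<Sum>t<k. G p q s t *
      (of_bool (p = q \<and> s = t) + of_bool (p = t \<and> q = s) + z * of_bool (p = q \<and> q = s \<and> s = t)))
    = (\<Sum>p<k. (\<Sum>s<k. G p p s s) + (\<Sum>q<k. G p q q p) + z * G p p p p)"
    by (rule sum.cong) (simp_all only: inner lessThan_iff)
  then show ?thesis by (simp only: sum.distrib sum_distrib_left)
qed

section \<open>Recursion of the two-point function in the number of rows\<close>

context iid_entries
begin

lemma row_fun_cmult: "row_fun e r U \<Longrightarrow> row_fun e r (\<lambda>u. c * U u)"
  unfolding row_fun_def
proof (elim conjE exE, intro conjI)
  fix C assume C: "0 \<le> C" "\<forall>u. norm (U u) \<le> C * row_weight r u ^ e"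
  show "\<exists>C\<ge>0. \<forall>u. norm (c * U u) \<le> C * row_weight r u ^ e"
    using C by (intro exI[of _ "norm c * C"]) (auto simp: norm_mult mult.assoc intro!: mult_left_mono)
qed auto

text \<open>Injectivity makes every column count at most once, and the remaining columns contribute
  factors at least 1.\<close>

lemma prod_column_weight_le:
  assumes d: "inj_on d {..<l}" "d ` {..<l} \<subseteq> {..<m}"
  shows "(\<Prod>a<l. \<Prod>i<r. 1 + norm (u (i, d a))) \<le> row_weight r u"
proof -
  have "(\<Prod>a<l. \<Prod>i<r. 1 + norm (u (i, d a))) = (\<Prod>i<r. \<Prod>j\<in>d ` {..<l}. 1 + norm (u (i, j)))"
    by (subst prod.swap) (simp add: prod.reindex[OF d(1)])
  also have "\<dots> \<le> (\<Prod>i<r. \<Prod>j<m. 1 + norm (u (i, j)))"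
    using d(2) by (intro prod_mono conjI prod_nonneg prod_ge_1_mono2) auto
  also have "\<dots> = row_weight r u"
    by (simp add: row_weight_def rows_def prod.cartesian_product)
  finally show ?thesis .
qed

text \<open>The selection \<open>s\<close> enters through conjugated entries and \<open>t\<close>
  through unconjugated ones, each costing at most one \<open>row_weight\<close>. A minor thus has
  degree 2 and a product of two minors degree 4, which finite fourth moments just cover.\<close>

lemma minor_row_fun:
  assumes c: "inj_on c {..<k}" "c ` {..<k} \<subseteq> {..<m}"
    and s: "inj_on s {..<l}" "s ` {..<l} \<subseteq> {..<k}" and t: "inj_on t {..<l}" "t ` {..<l} \<subseteq> {..<k}"
  shows "row_fun 2 r (\<lambda>u. Determinant.det (Matrix.mat l l (\<lambda>(a, b). gram_pencil u r c k \<mu> $$ (s a, t b))))"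
  unfolding row_fun_def
proof (intro conjI allI)
  define e where "e u a b = (\<Sum>i<r. cnj (u (i, c a)) * u (i, c b)) - (if a = b then \<mu> else 0)" for u :: "nat \<times> nat \<Rightarrow> complex" and a b
  have e: "gram_pencil u r c k \<mu> $$ (a, b) = e u a b" if "a < k" "b < k" for u a b
    using that by (simp add: gram_pencil_def gram_def e_def)
  have ck: "c a < m" if "a < k" for a using c(2) that by auto
  have sk: "s a < k" "t a < k" if "a < l" for a using s(2) t(2) that by auto
  have det: "Determinant.det (Matrix.mat l l (\<lambda>(a, b). gram_pencil u r c k \<mu> $$ (s a, t b))) =
     (\<Sum>\<sigma> | \<sigma> permutes {0..<l}. signof \<sigma> * (\<Prod>a = 0..<l. e u (s a) (t (\<sigma> a))))" for u
    unfolding det_def'[OF mat_carrier]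
  proof (intro sum.cong refl arg_cong2[where f = "(*)"] prod.cong)
    fix \<sigma> a assume \<sigma>: "\<sigma> \<in> {\<sigma>. \<sigma> permutes {0..<l}}" and a: "a \<in> {0..<l}"
    then have "\<sigma> a < l" using permutes_in_image[of \<sigma> "{0..<l}" a] by auto
    then show "Matrix.mat l l (\<lambda>(a, b). gram_pencil u r c k \<mu> $$ (s a, t b)) $$ (a, \<sigma> a) = e u (s a) (t (\<sigma> a))"
      using a sk by (simp add: e)
  qed
  have meas: "(\<lambda>u. e u a b) \<in> borel_measurable (PiM (rows r) (\<lambda>_. borel))" if "a < k" "b < k" for a b
    unfolding e_def using ck that
    by (intro borel_measurable_diff borel_measurable_sum borel_measurable_times borel_measurable_const
        measurable_compose[OF _ cnj_measurable] measurable_component_singleton) (auto simp: rows_def)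
  show "(\<lambda>u. Determinant.det (Matrix.mat l l (\<lambda>(a, b). gram_pencil u r c k \<mu> $$ (s a, t b)))) \<in> borel_measurable (PiM (rows r) (\<lambda>_. borel))"
    unfolding det
  proof (intro borel_measurable_sum borel_measurable_times borel_measurable_const borel_measurable_prod)
    fix \<sigma> a assume \<sigma>: "\<sigma> \<in> {\<sigma>. \<sigma> permutes {0..<l}}" and a: "a \<in> {0..<l}"
    then have "\<sigma> a < l" using permutes_in_image[of \<sigma> "{0..<l}" a] by auto
    then show "(\<lambda>u. e u (s a) (t (\<sigma> a))) \<in> borel_measurable (PiM (rows r) (\<lambda>_. borel))"
      using a sk by (intro meas) auto
  qed
  fix u
  have res: "e (restrict u (rows r)) a b = e u a b" if "a < k" "b < k" for a b
    unfolding e_def using ck that by (intro arg_cong2[where f = "(-)"] sum.cong) (auto simp: rows_def)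
  show "Determinant.det (Matrix.mat l l (\<lambda>(a, b). gram_pencil (restrict u (rows r)) r c k \<mu> $$ (s a, t b))) =
     Determinant.det (Matrix.mat l l (\<lambda>(a, b). gram_pencil u r c k \<mu> $$ (s a, t b)))"
    by (rule arg_cong[of _ _ Determinant.det], rule eq_matI) (use sk in \<open>auto simp: e res\<close>)
next
  have cs: "inj_on (\<lambda>a. c (s a)) {..<l}" "(\<lambda>a. c (s a)) ` {..<l} \<subseteq> {..<m}"
    using comp_inj_on[OF s(1) inj_on_subset[OF c(1) s(2)]] s(2) c(2) by (auto simp: o_def)
  have ct: "inj_on (\<lambda>a. c (t a)) {..<l}" "(\<lambda>a. c (t a)) ` {..<l} \<subseteq> {..<m}"
    using comp_inj_on[OF t(1) inj_on_subset[OF c(1) t(2)]] t(2) c(2) by (auto simp: o_def)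
  define C where "C = fact l * (1 + norm \<mu>) ^ l"
  have C: "0 \<le> C" by (simp add: C_def)
  have "norm (Determinant.det (Matrix.mat l l (\<lambda>(a, b). gram_pencil u r c k \<mu> $$ (s a, t b)))) \<le> C * row_weight r u ^ 2" for u
  proof -
    have "norm (Determinant.det (Matrix.mat l l (\<lambda>(a, b). gram_pencil u r c k \<mu> $$ (s a, t b)))) \<le>
      fact l * (1 + norm \<mu>) ^ l * ((\<Prod>a<l. \<Prod>i<r. 1 + norm (u (i, c (s a)))) * (\<Prod>a<l. \<Prod>i<r. 1 + norm (u (i, c (t a)))))"
    proof (rule norm_det_le)
      fix a b assume ab: "a < l" "b < l"
      then have "s a < k" "t b < k" using s(2) t(2) by auto
      from norm_gram_pencil_le[OF this, of u r c \<mu>] ab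
      show "norm (Matrix.mat l l (\<lambda>(a, b). gram_pencil u r c k \<mu> $$ (s a, t b)) $$ (a, b)) \<le>
         (1 + norm \<mu>) * ((\<Prod>i<r. 1 + norm (u (i, c (s a)))) * (\<Prod>i<r. 1 + norm (u (i, c (t b)))))" by simp
    qed (auto intro!: prod_nonneg)
    also have "\<dots> \<le> fact l * (1 + norm \<mu>) ^ l * (row_weight r u * row_weight r u)"
      by (intro mult_left_mono mult_mono prod_column_weight_le[OF cs] prod_column_weight_le[OF ct]
          prod_nonneg row_weight_nonneg) auto
    finally show ?thesis by (simp add: C_def power2_eq_square)
  qed
  then show "\<exists>C\<ge>0. \<forall>u. norm (Determinant.det (Matrix.mat l l (\<lambda>(a, b). gram_pencil u r c k \<mu> $$ (s a, t b)))) \<le> C * row_weight r u ^ 2"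
    using C by blast
qed

lemma gram_poly_row_fun:
  assumes c: "inj_on c {..<k}" "c ` {..<k} \<subseteq> {..<m}"
  shows "row_fun 2 r (\<lambda>u. poly (gram_poly u r c k) \<mu>)"
proof -
  have "Matrix.mat k k (\<lambda>(a, b). gram_pencil u r c k \<mu> $$ (a, b)) = gram_pencil u r c k \<mu>" for u
    by (rule eq_matI) (use gram_pencil_carrier[of u r c k \<mu>] in auto)
  then show ?thesis
    using minor_row_fun[OF c, of "\<lambda>a. a" k "\<lambda>a. a" r \<mu>] by (simp add: poly_gram_poly)
qed

lemma cofactor_row_fun:
  assumes c: "inj_on c {..<k}" "c ` {..<k} \<subseteq> {..<m}" and ab: "a < k" "b < k"
  shows "row_fun 2 r (\<lambda>u. cofactor (gram_pencil u r c k \<mu>) a b)"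
proof -
  let ?s = "\<lambda>a i. if i < a then i else Suc i"
  have s: "inj_on (?s a) {..<k - 1}" "?s a ` {..<k - 1} \<subseteq> {..<k}" for a
    by (auto simp: inj_on_def split: if_splits)
  have "mat_delete (gram_pencil u r c k \<mu>) a b = Matrix.mat (k - 1) (k - 1) (\<lambda>(i, j). gram_pencil u r c k \<mu> $$ (?s a i, ?s b j))" for u
    using gram_pencil_carrier[of u r c k \<mu>] by (simp add: mat_delete_def)
  then show ?thesis unfolding cofactor_def
    using row_fun_cmult[OF minor_row_fun[OF c s[of a] s[of b], of r \<mu>]] by simp
qed

text \<open>The columns are selected by \<open>c\<close> because the recursion passes to minors; the
  value will turn out to depend on \<open>c\<close> only through its length k.\<close>

definition corr :: "nat \<Rightarrow> (nat \<Rightarrow> nat) \<Rightarrow> nat \<Rightarrow> complex \<Rightarrow> complex \<Rightarrow> complex" where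
  "corr r c k \<mu> \<nu> = expectation (\<lambda>\<omega>. poly (gram_poly (array \<omega>) r c k) \<mu> * poly (gram_poly (array \<omega>) r c k) \<nu>)"

context
  fixes r k :: nat and c :: "nat \<Rightarrow> nat"
  assumes r: "r < n" and c: "inj_on c {..<k}" "c ` {..<k} \<subseteq> {..<m}"
begin

definition gdet :: "complex \<Rightarrow> (nat \<times> nat \<Rightarrow> complex) \<Rightarrow> complex" where
  "gdet \<mu> u = poly (gram_poly u r c k) \<mu>"

definition gcof :: "complex \<Rightarrow> nat \<Rightarrow> nat \<Rightarrow> (nat \<times> nat \<Rightarrow> complex) \<Rightarrow> complex" where
  "gcof \<mu> a b u = cofactor (gram_pencil u r c k \<mu>) a b"

text \<open>What remains of the two-point product after averaging row \<open>r\<close> as if it were Gaussian.\<close>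

definition gaussian_part :: "complex \<Rightarrow> complex \<Rightarrow> (nat \<times> nat \<Rightarrow> complex) \<Rightarrow> complex" where
  "gaussian_part \<mu> \<nu> u = gdet \<mu> u * gdet \<nu> u + (\<Sum>p<k. gcof \<mu> p p u * gdet \<nu> u) + (\<Sum>p<k. gdet \<mu> u * gcof \<nu> p p u)
     + (\<Sum>p<k. \<Sum>s<k. gcof \<mu> p p u * gcof \<nu> s s u) + (\<Sum>p<k. \<Sum>q<k. gcof \<mu> p q u * gcof \<nu> q p u)"

lemma gdet_row_fun: "row_fun 2 r (gdet \<mu>)"
  unfolding gdet_def[abs_def] by (rule gram_poly_row_fun[OF c])

lemma gcof_row_fun: "a < k \<Longrightarrow> b < k \<Longrightarrow> row_fun 2 r (gcof \<mu> a b)"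
  unfolding gcof_def[abs_def] by (rule cofactor_row_fun[OF c])

lemma has_expectation:
  assumes "row_fun 2 r U" "row_fun 2 r V"
  shows "has_bochner_integral M (\<lambda>\<omega>. U (array \<omega>) * V (array \<omega>)) (expectation (\<lambda>\<omega>. U (array \<omega>) * V (array \<omega>)))"
  using row_fun_integrable[OF row_fun_mult[OF assms] less_imp_le[OF r]]
  by (rule has_bochner_integral_integrable)

lemma has_expectation_second:
  assumes "row_fun 2 r U" "row_fun 2 r V" "p < k" "q < k"
  shows "has_bochner_integral M (\<lambda>\<omega>. U (array \<omega>) * V (array \<omega>) * (cnj (array \<omega> (r, c p)) * array \<omega> (r, c q)))
    (expectation (\<lambda>\<omega>. U (array \<omega>) * V (array \<omega>)) * of_bool (p = q))"
proof -
  have "c p < m" "c q < m" using c(2) assms by auto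
  note * = row_fun_mult_second[OF row_fun_mult[OF assms(1,2)] r this]
  have "c p = c q \<longleftrightarrow> p = q" using inj_on_eq_iff[OF c(1)] assms by auto
  with * show ?thesis by (simp add: has_bochner_integral_iff)
qed

lemma has_expectation_fourth:
  assumes "row_fun 2 r U" "row_fun 2 r V" "p < k" "q < k" "s < k" "t < k"
  shows "has_bochner_integral M (\<lambda>\<omega>. U (array \<omega>) * V (array \<omega>) *
      (cnj (array \<omega> (r, c p)) * array \<omega> (r, c q) * (cnj (array \<omega> (r, c s)) * array \<omega> (r, c t))))
    (expectation (\<lambda>\<omega>. U (array \<omega>) * V (array \<omega>)) *
      (of_bool (p = q \<and> s = t) + of_bool (p = t \<and> q = s) + of_real \<kappa> * of_bool (p = q \<and> q = s \<and> s = t)))"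
proof -
  have cm: "c p < m" "c q < m" "c s < m" "c t < m" using c(2) assms by auto
  note * = row_fun_mult_fourth[OF row_fun_mult[OF assms(1,2)] r cm]
  have "c i = c j \<longleftrightarrow> i = j" if "i < k" "j < k" for i j using inj_on_eq_iff[OF c(1)] that by auto
  then have "c p = c q \<longleftrightarrow> p = q" "c s = c t \<longleftrightarrow> s = t" "c p = c t \<longleftrightarrow> p = t" "c q = c s \<longleftrightarrow> q = s"
    using assms by auto
  with * show ?thesis by (simp add: has_bochner_integral_iff)
qed

lemmas has_expectations =
  has_expectation[OF gdet_row_fun gdet_row_fun] has_expectation[OF gcof_row_fun gdet_row_fun]
  has_expectation[OF gdet_row_fun gcof_row_fun] has_expectation[OF gcof_row_fun gcof_row_fun]
  has_expectation_second[OF gcof_row_fun gdet_row_fun] has_expectation_second[OF gdet_row_fun gcof_row_fun]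
  has_expectation_fourth[OF gcof_row_fun gcof_row_fun]

text \<open>The \<kappa> pattern forces all four column indices to agree. Its contribution is a sum
  of products of diagonal cofactors, each the same correlation with one column less and without the
  new row.\<close>

lemma corr_Suc:
  "corr (Suc r) c k \<mu> \<nu> = expectation (\<lambda>\<omega>. gaussian_part \<mu> \<nu> (array \<omega>))
     + of_real \<kappa> * (\<Sum>a<k. corr r (c \<circ> insert_index a) (k - 1) \<mu> \<nu>)"
proof -
  define E where "E U V = expectation (\<lambda>\<omega>. U (array \<omega>) * V (array \<omega>))" for U V :: "(nat \<times> nat \<Rightarrow> complex) \<Rightarrow> complex"
  define v where "v p q \<omega> = cnj (array \<omega> (r, c p)) * array \<omega> (r, c q)" for p q \<omega>
  have expand: "poly (gram_poly (array \<omega>) (Suc r) c k) \<mu> * poly (gram_poly (array \<omega>) (Suc r) c k) \<nu> =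
      gdet \<mu> (array \<omega>) * gdet \<nu> (array \<omega>)
      + (\<Sum>p<k. \<Sum>q<k. gcof \<mu> p q (array \<omega>) * gdet \<nu> (array \<omega>) * v p q \<omega>)
      + (\<Sum>p<k. \<Sum>q<k. gdet \<mu> (array \<omega>) * gcof \<nu> p q (array \<omega>) * v p q \<omega>)
      + (\<Sum>p<k. \<Sum>q<k. \<Sum>s<k. \<Sum>t<k. gcof \<mu> p q (array \<omega>) * gcof \<nu> s t (array \<omega>) * (v p q \<omega> * v s t \<omega>))" for \<omega>
  proof -
    define X where "X \<mu> = (\<Sum>p<k. \<Sum>q<k. v p q \<omega> * gcof \<mu> p q (array \<omega>))" for \<mu>
    have P: "poly (gram_poly (array \<omega>) (Suc r) c k) \<mu> = gdet \<mu> (array \<omega>) + X \<mu>" for \<mu>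
      by (simp add: gram_poly_Suc gdet_def X_def v_def gcof_def)
    have "X \<mu> * gdet \<nu> (array \<omega>) = (\<Sum>p<k. \<Sum>q<k. gcof \<mu> p q (array \<omega>) * gdet \<nu> (array \<omega>) * v p q \<omega>)"
      unfolding X_def sum_distrib_right by (intro sum.cong refl) (simp only: mult_ac)
    moreover have "gdet \<mu> (array \<omega>) * X \<nu> = (\<Sum>p<k. \<Sum>q<k. gdet \<mu> (array \<omega>) * gcof \<nu> p q (array \<omega>) * v p q \<omega>)"
      unfolding X_def sum_distrib_left by (intro sum.cong refl) (simp only: mult_ac)
    moreover have "X \<mu> * X \<nu> = (\<Sum>p<k. \<Sum>q<k. \<Sum>s<k. \<Sum>t<k. gcof \<mu> p q (array \<omega>) * gcof \<nu> s t (array \<omega>) * (v p q \<omega> * v s t \<omega>))"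
      unfolding X_def[of \<mu>] sum_distrib_right unfolding X_def sum_distrib_left
      by (intro sum.cong refl) (simp only: mult_ac)
    ultimately show ?thesis unfolding P by (simp only: distrib_left distrib_right add.assoc)
  qed
  have "has_bochner_integral M (\<lambda>\<omega>. poly (gram_poly (array \<omega>) (Suc r) c k) \<mu> * poly (gram_poly (array \<omega>) (Suc r) c k) \<nu>)
    (E (gdet \<mu>) (gdet \<nu>)
      + (\<Sum>p<k. \<Sum>q<k. E (gcof \<mu> p q) (gdet \<nu>) * of_bool (p = q))
      + (\<Sum>p<k. \<Sum>q<k. E (gdet \<mu>) (gcof \<nu> p q) * of_bool (p = q))
      + (\<Sum>p<k. \<Sum>q<k. \<Sum>s<k. \<Sum>t<k. E (gcof \<mu> p q) (gcof \<nu> s t) *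
          (of_bool (p = q \<and> s = t) + of_bool (p = t \<and> q = s) + of_real \<kappa> * of_bool (p = q \<and> q = s \<and> s = t))))"
    unfolding expand E_def v_def
    by (intro has_bochner_integral_add has_bochner_integral_sum has_expectations; simp)
  then have 1: "corr (Suc r) c k \<mu> \<nu> = E (gdet \<mu>) (gdet \<nu>) + (\<Sum>p<k. E (gcof \<mu> p p) (gdet \<nu>)) + (\<Sum>p<k. E (gdet \<mu>) (gcof \<nu> p p))
     + ((\<Sum>p<k. \<Sum>s<k. E (gcof \<mu> p p) (gcof \<nu> s s)) + (\<Sum>p<k. \<Sum>q<k. E (gcof \<mu> p q) (gcof \<nu> q p)) + of_real \<kappa> * (\<Sum>p<k. E (gcof \<mu> p p) (gcof \<nu> p p)))"
    unfolding corr_def sum_fourth_moment by (simp add: has_bochner_integral_iff sum_of_bool_eq)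
  have "has_bochner_integral M (\<lambda>\<omega>. gaussian_part \<mu> \<nu> (array \<omega>))
    (E (gdet \<mu>) (gdet \<nu>) + (\<Sum>p<k. E (gcof \<mu> p p) (gdet \<nu>)) + (\<Sum>p<k. E (gdet \<mu>) (gcof \<nu> p p))
     + (\<Sum>p<k. \<Sum>s<k. E (gcof \<mu> p p) (gcof \<nu> s s)) + (\<Sum>p<k. \<Sum>q<k. E (gcof \<mu> p q) (gcof \<nu> q p)))"
    unfolding gaussian_part_def E_def
    by (intro has_bochner_integral_add has_bochner_integral_sum has_expectations; simp)
  then have 2: "expectation (\<lambda>\<omega>. gaussian_part \<mu> \<nu> (array \<omega>)) = E (gdet \<mu>) (gdet \<nu>) + (\<Sum>p<k. E (gcof \<mu> p p) (gdet \<nu>)) + (\<Sum>p<k. E (gdet \<mu>) (gcof \<nu> p p))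
     + (\<Sum>p<k. \<Sum>s<k. E (gcof \<mu> p p) (gcof \<nu> s s)) + (\<Sum>p<k. \<Sum>q<k. E (gcof \<mu> p q) (gcof \<nu> q p))"
    by (simp add: has_bochner_integral_iff)
  have 3: "E (gcof \<mu> p p) (gcof \<nu> p p) = corr r (c \<circ> insert_index p) (k - 1) \<mu> \<nu>" if "p < k" for p
    unfolding E_def corr_def gcof_def cofactor_gram_pencil_diagonal[OF that] ..
  show ?thesis unfolding 1 2 using 3 by simp
qed

text \<open>By \<open>sum_cofactor_product\<close> only the gram polynomial and its derivative
  remain. The right-hand side is (1 - d/d\<mu>) (1 - d/d\<nu>) applied to (\<mu> - \<nu>) P(\<mu>)
  P(\<nu>), with \<open>pCons 0 P\<close> standing for z P(z).\<close>

lemma gaussian_part_eq: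
  "(\<mu> - \<nu>) * gaussian_part \<mu> \<nu> u =
     poly (lagD (pCons 0 (gram_poly u r c k))) \<mu> * poly (lagD (gram_poly u r c k)) \<nu>
     - poly (lagD (gram_poly u r c k)) \<mu> * poly (lagD (pCons 0 (gram_poly u r c k))) \<nu>"
proof -
  define P where "P = gram_poly u r c k"
  define p where "p z = poly P z" for z
  define p' where "p' z = poly (pderiv P) z" for z
  define S where "S = (\<Sum>a<k. \<Sum>b<k. gcof \<mu> a b u * gcof \<nu> b a u)"
  have tr: "(\<Sum>a<k. gcof z a a u) = - p' z" for z
    by (simp add: gcof_def sum_cofactor_gram_pencil p'_def P_def)
  have S: "(\<mu> - \<nu>) * S = - p' \<mu> * p \<nu> - p \<mu> * (- p' \<nu>)"
  proof -
    have "(\<mu> - \<nu>) * S = (\<Sum>a<k. gcof \<mu> a a u) * p \<nu> - p \<mu> * (\<Sum>a<k. gcof \<nu> a a u)"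
      unfolding S_def p_def P_def gcof_def by (rule sum_cofactor_product)
    then show ?thesis by (simp only: tr)
  qed
  have exp: "gaussian_part \<mu> \<nu> u = p \<mu> * p \<nu> + (- p' \<mu>) * p \<nu> + p \<mu> * (- p' \<nu>) + (- p' \<mu>) * (- p' \<nu>) + S"
  proof -
    have eq: "gdet z u = p z" for z by (simp only: gdet_def p_def P_def)
    have "(\<Sum>a<k. gcof \<mu> a a u * gdet \<nu> u) = (\<Sum>a<k. gcof \<mu> a a u) * p \<nu>"
      by (simp only: eq sum_distrib_right)
    moreover have "(\<Sum>a<k. gdet \<mu> u * gcof \<nu> a a u) = p \<mu> * (\<Sum>a<k. gcof \<nu> a a u)"
      by (simp only: eq sum_distrib_left)
    moreover have "(\<Sum>a<k. \<Sum>b<k. gcof \<mu> a a u * gcof \<nu> b b u) = (\<Sum>a<k. gcof \<mu> a a u) * (\<Sum>a<k. gcof \<nu> a a u)"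
      by (simp only: sum_product)
    ultimately show ?thesis
      unfolding gaussian_part_def S_def[symmetric] eq[symmetric] tr[symmetric] by (simp only: eq)
  qed
  have "(\<mu> - \<nu>) * gaussian_part \<mu> \<nu> u = (\<mu> - \<nu>) * ((p \<mu> - p' \<mu>) * (p \<nu> - p' \<nu>)) + (\<mu> - \<nu>) * S"
    unfolding exp by (simp add: algebra_simps)
  also have "\<dots> = (\<mu> * (p \<mu> - p' \<mu>) - p \<mu>) * (p \<nu> - p' \<nu>) - (p \<mu> - p' \<mu>) * (\<nu> * (p \<nu> - p' \<nu>) - p \<nu>)"
    unfolding S by (simp add: algebra_simps)
  finally show ?thesis
    unfolding lagD_pCons P_def[symmetric] by (simp add: lagD_def p_def p'_def)
qed

text \<open>Expectation commutes with \<open>1 - d/d\<mu>\<close> because on polynomials of bounded degree this operator is a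
  finite combination of point evaluations.\<close>

lemma expectation_gaussian_part:
  assumes IH: "\<And>\<mu> \<nu>. (\<mu> - \<nu>) * corr r c k \<mu> \<nu> = cov_wronskian (of_real \<kappa>) r k \<mu> \<nu>"
  shows "(\<mu> - \<nu>) * expectation (\<lambda>\<omega>. gaussian_part \<mu> \<nu> (array \<omega>)) =
    (\<Sum>t\<le>k. of_real \<kappa> ^ t * of_nat (fact t * (r choose t) * (k choose t)) * lag_wronskian (Suc (r - t)) (k - t) \<mu> \<nu>)"
proof -
  obtain w :: "complex \<Rightarrow> nat \<Rightarrow> complex" where
    w: "\<And>p \<mu>. degree p \<le> Suc k \<Longrightarrow> poly (lagD p) \<mu> = (\<Sum>j\<le>Suc k. w \<mu> j * poly p (of_nat j))"
    using ex_interpolation_lagD[of "Suc k"] by blast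
  \<comment> \<open>The same weights \<open>w\<close> serve all polynomials of degree at most k + 1,
    so this functional can first be applied to the random polynomials and later to the Laguerre
    polynomials.\<close>
  have bil: "poly (lagD p) \<mu> * poly (lagD q) \<nu> - poly (lagD q) \<mu> * poly (lagD p) \<nu> =
     (\<Sum>j\<le>Suc k. \<Sum>l\<le>Suc k. w \<mu> j * w \<nu> l * (poly p (of_nat j) * poly q (of_nat l) - poly q (of_nat j) * poly p (of_nat l)))"
    if "degree p \<le> Suc k" "degree q \<le> Suc k" for p q
    unfolding w[OF that(1)] w[OF that(2)] sum_product sum_subtractf[symmetric]
    by (intro sum.cong refl) (simp add: algebra_simps)
  have deg: "degree (gram_poly u r c k) \<le> Suc k" "degree (pCons 0 (gram_poly u r c k)) \<le> Suc k" for u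
    using degree_gram_poly[of u r c k] by (auto intro: order_trans[OF degree_pCons_le])
  have "(\<mu> - \<nu>) * expectation (\<lambda>\<omega>. gaussian_part \<mu> \<nu> (array \<omega>)) = expectation (\<lambda>\<omega>. (\<mu> - \<nu>) * gaussian_part \<mu> \<nu> (array \<omega>))"
    by simp
  \<comment> \<open>At the nodes the antisymmetrised product of z P(z) and P is (j - l) P(j) P(l),
    the form to which \<open>IH\<close> applies; at j = l both sides vanish.\<close>
  also have "\<dots> = expectation (\<lambda>\<omega>. \<Sum>j\<le>Suc k. \<Sum>l\<le>Suc k. w \<mu> j * w \<nu> l *
      ((of_nat j - of_nat l) * (gdet (of_nat j) (array \<omega>) * gdet (of_nat l) (array \<omega>))))"
    unfolding gaussian_part_eq bil[OF deg(2,1)] by (simp add: gdet_def algebra_simps)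
  also have "\<dots> = (\<Sum>j\<le>Suc k. \<Sum>l\<le>Suc k. w \<mu> j * w \<nu> l * ((of_nat j - of_nat l) * corr r c k (of_nat j) (of_nat l)))"
    unfolding corr_def gdet_def[symmetric]
    by (intro has_bochner_integral_integral_eq has_bochner_integral_sum has_bochner_integral_mult_right
        has_expectations)
  also have "\<dots> = (\<Sum>j\<le>Suc k. \<Sum>l\<le>Suc k. w \<mu> j * w \<nu> l * (\<Sum>t\<le>k. of_real \<kappa> ^ t * of_nat (fact t * (r choose t) * (k choose t)) * lag_wronskian (r - t) (k - t) (of_nat j) (of_nat l)))"
    unfolding IH cov_wronskian_def ..
  also have "\<dots> = (\<Sum>t\<le>k. of_real \<kappa> ^ t * of_nat (fact t * (r choose t) * (k choose t)) * (\<Sum>j\<le>Suc k. \<Sum>l\<le>Suc k. w \<mu> j * w \<nu> l * lag_wronskian (r - t) (k - t) (of_nat j) (of_nat l)))"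
  proof -
    have swap: "(\<Sum>j\<le>Suc k. \<Sum>l\<le>Suc k. W j l * (\<Sum>t\<le>k. C t * L t j l)) = (\<Sum>t\<le>k. C t * (\<Sum>j\<le>Suc k. \<Sum>l\<le>Suc k. W j l * L t j l))"
      for W :: "nat \<Rightarrow> nat \<Rightarrow> complex" and C L
    proof -
      have "(\<Sum>j\<le>Suc k. \<Sum>l\<le>Suc k. W j l * (\<Sum>t\<le>k. C t * L t j l)) = (\<Sum>j\<le>Suc k. \<Sum>l\<le>Suc k. \<Sum>t\<le>k. C t * (W j l * L t j l))"
        unfolding sum_distrib_left by (intro sum.cong refl) (simp only: mult_ac)
      also have "\<dots> = (\<Sum>j\<le>Suc k. \<Sum>t\<le>k. \<Sum>l\<le>Suc k. C t * (W j l * L t j l))"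
        by (intro sum.cong refl sum.swap)
      also have "\<dots> = (\<Sum>t\<le>k. \<Sum>j\<le>Suc k. \<Sum>l\<le>Suc k. C t * (W j l * L t j l))"
        by (rule sum.swap)
      finally show ?thesis unfolding sum_distrib_left .
    qed
    show ?thesis
      by (rule swap[of "\<lambda>j l. w \<mu> j * w \<nu> l" "\<lambda>t. of_real \<kappa> ^ t * of_nat (fact t * (r choose t) * (k choose t))"
            "\<lambda>t j l. lag_wronskian (r - t) (k - t) (of_nat j) (of_nat l)"])
  qed
  \<comment> \<open>Reading \<open>bil\<close> backwards applies \<open>lagD\<close> in both
    variables to the Laguerre Wronskian, which raises its first index by one.\<close>
  also have "\<dots> = (\<Sum>t\<le>k. of_real \<kappa> ^ t * of_nat (fact t * (r choose t) * (k choose t)) * lag_wronskian (Suc (r - t)) (k - t) \<mu> \<nu>)"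
  proof (intro sum.cong refl arg_cong2[where f = "(*)"])
    fix t assume "t \<in> {..k}"
    have "degree (lag (r - t) (Suc (k - t)) :: complex poly) \<le> Suc k" "degree (lag (r - t) (k - t) :: complex poly) \<le> Suc k"
      by (rule order_trans[OF degree_lag]; simp)+
    from bil[OF this] show "(\<Sum>j\<le>Suc k. \<Sum>l\<le>Suc k. w \<mu> j * w \<nu> l * lag_wronskian (r - t) (k - t) (of_nat j) (of_nat l))
       = lag_wronskian (Suc (r - t)) (k - t) \<mu> \<nu>"
      by (simp only: lag_wronskian_def lag_Suc)
  qed
  finally show ?thesis .
qed

end

text \<open>The hypothesis must hold for arbitrary column selections, since the \<kappa> term calls
  it with one column removed, and for all \<mu>, \<nu>, since the Gaussian term calls it at the
  interpolation nodes.\<close>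

lemma corr_eq_cov_wronskian:
  assumes "r \<le> n" "inj_on c {..<k}" "c ` {..<k} \<subseteq> {..<m}"
  shows "(\<mu> - \<nu>) * corr r c k \<mu> \<nu> = cov_wronskian (of_real \<kappa>) r k \<mu> \<nu>"
  using assms
proof (induction r arbitrary: c k \<mu> \<nu>)
  case 0
  then show ?case
    by (simp add: corr_def poly_gram_poly_0 cov_wronskian_0 power_mult_distrib[symmetric] prob_space)
next
  case (Suc r)
  then have r: "r < n" by simp
  have IH: "(\<mu> - \<nu>) * corr r c k \<mu> \<nu> = cov_wronskian (of_real \<kappa>) r k \<mu> \<nu>" for \<mu> \<nu>
    by (rule Suc.IH) (use Suc.prems in auto)
  have IH': "(\<mu> - \<nu>) * corr r (c \<circ> insert_index a) (k - 1) \<mu> \<nu> = cov_wronskian (of_real \<kappa>) r (k - 1) \<mu> \<nu>" if a: "a < k" for a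
  proof (rule Suc.IH)
    have ins: "insert_index a ` {..<k - 1} \<subseteq> {..<k}" by (auto simp: insert_index_def)
    show "inj_on (c \<circ> insert_index a) {..<k - 1}"
      by (intro comp_inj_on insert_index_inj_on inj_on_subset[OF Suc.prems(2) ins])
    show "(c \<circ> insert_index a) ` {..<k - 1} \<subseteq> {..<m}"
      unfolding image_comp[symmetric] using ins Suc.prems(3) by blast
  qed (use r in simp)
  have "(\<mu> - \<nu>) * corr (Suc r) c k \<mu> \<nu> = (\<mu> - \<nu>) * expectation (\<lambda>\<omega>. gaussian_part r k c \<mu> \<nu> (array \<omega>))
     + of_real \<kappa> * (\<Sum>a<k. (\<mu> - \<nu>) * corr r (c \<circ> insert_index a) (k - 1) \<mu> \<nu>)"
    unfolding corr_Suc[OF r Suc.prems(2,3)] by (simp only: distrib_left sum_distrib_left mult.left_commute)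
  also have "(\<Sum>a<k. (\<mu> - \<nu>) * corr r (c \<circ> insert_index a) (k - 1) \<mu> \<nu>) = of_nat k * cov_wronskian (of_real \<kappa>) r (k - 1) \<mu> \<nu>"
    using IH' by simp
  finally show ?case
    unfolding expectation_gaussian_part[OF r Suc.prems(2,3) IH] cov_wronskian_Suc by (simp only: mult.assoc)
qed

text \<open>Christoffel-Darboux turns each Wronskian into \<mu> - \<nu> times a kernel with factor
  (n - t)! (m - t)!. Together with t! (n choose t) (m choose t) this gives n! m! / t!.\<close>

lemma corr_eq_series:
  assumes n: "n = m + \<alpha>"
  shows "corr n id m \<mu> \<nu> = fact n * fact m * (\<Sum>t\<le>m. of_real \<kappa> ^ t / fact t * lag_kernel \<alpha> (m - t) \<mu> \<nu>)"
proof -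
  define K where "K \<mu> = fact n * fact m * (\<Sum>t\<le>m. of_real \<kappa> ^ t / fact t * lag_kernel \<alpha> (m - t) \<mu> \<nu>)" for \<mu>
  have id: "inj_on id {..<m}" "id ` {..<m} \<subseteq> {..<m}" by auto
  have off: "corr n id m \<mu> \<nu> = K \<mu>" if "\<mu> \<noteq> \<nu>" for \<mu>
  proof -
    have "(\<mu> - \<nu>) * corr n id m \<mu> \<nu> = cov_wronskian (of_real \<kappa>) n m \<mu> \<nu>"
      by (rule corr_eq_cov_wronskian[OF order_refl id])
    also have "\<dots> = (\<Sum>t\<le>m. (\<mu> - \<nu>) * (fact n * fact m * (of_real \<kappa> ^ t / fact t * lag_kernel \<alpha> (m - t) \<mu> \<nu>)))"
      unfolding cov_wronskian_def
    proof (rule sum.cong)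
      fix t assume t: "t \<in> {..m}"
      then have nt: "n - t = m - t + \<alpha>" and tn: "t \<le> n" "t \<le> m" using n by auto
      have 1: "of_nat (n choose t) = (fact n / (fact t * fact (n - t)) :: complex)"
        "of_nat (m choose t) = (fact m / (fact t * fact (m - t)) :: complex)"
        using tn by (simp_all add: binomial_fact)
      have "lag_wronskian (n - t) (m - t) \<mu> \<nu> = (\<mu> - \<nu>) * lag_kernel \<alpha> (m - t) \<mu> \<nu> * (fact (n - t) * fact (m - t))"
        unfolding nt by (rule lag_kernel_christoffel_darboux[symmetric])
      then show "of_real \<kappa> ^ t * of_nat (fact t * (n choose t) * (m choose t)) * lag_wronskian (n - t) (m - t) \<mu> \<nu>
        = (\<mu> - \<nu>) * (fact n * fact m * (of_real \<kappa> ^ t / fact t * lag_kernel \<alpha> (m - t) \<mu> \<nu>))"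
        by (simp add: 1)
    qed simp
    also have "\<dots> = (\<mu> - \<nu>) * K \<mu>" by (simp only: K_def sum_distrib_left)
    finally show ?thesis using that by simp
  qed
  \<comment> \<open>Division by \<mu> - \<nu> is impossible here. Interpolation shows the
    correlation to be a polynomial in its first argument, so both sides are continuous there and
    agree in the limit.\<close>
  have "corr n id m \<nu> \<nu> = K \<nu>"
  proof -
    from ex_interpolation_basis[of m] obtain b :: "nat \<Rightarrow> complex poly"
      where b: "\<And>p. degree p \<le> m \<Longrightarrow> p = (\<Sum>j\<le>m. Polynomial.smult (poly p (of_nat j)) (b j))" by blast
    have int: "integrable M (\<lambda>\<omega>. poly (gram_poly (array \<omega>) n id m) z * poly (gram_poly (array \<omega>) n id m) \<nu>)" for z
      by (rule row_fun_integrable[OF row_fun_mult[OF gram_poly_row_fun[OF id] gram_poly_row_fun[OF id]] order_refl])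
    have "corr n id m z \<nu> = (\<Sum>j\<le>m. poly (b j) z * corr n id m (of_nat j) \<nu>)" for z
    proof -
      have "poly (gram_poly (array \<omega>) n id m) z = (\<Sum>j\<le>m. poly (b j) z * poly (gram_poly (array \<omega>) n id m) (of_nat j))" for \<omega>
        by (subst b[OF degree_gram_poly]) (simp add: poly_sum mult.commute)
      then have "corr n id m z \<nu> = expectation (\<lambda>\<omega>. \<Sum>j\<le>m. poly (b j) z * (poly (gram_poly (array \<omega>) n id m) (of_nat j) * poly (gram_poly (array \<omega>) n id m) \<nu>))"
        unfolding corr_def by (simp add: sum_distrib_right mult.assoc)
      also have "\<dots> = (\<Sum>j\<le>m. poly (b j) z * corr n id m (of_nat j) \<nu>)"
        unfolding corr_def using int by (subst Bochner_Integration.integral_sum) auto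
      finally show ?thesis .
    qed
    then have "(\<lambda>z. corr n id m z \<nu>) = (\<lambda>z. \<Sum>j\<le>m. poly (b j) z * corr n id m (of_nat j) \<nu>)" by blast
    then have "isCont (\<lambda>z. corr n id m z \<nu>) \<nu>" by (simp add: continuous_intros)
    then have lim: "((\<lambda>z. corr n id m z \<nu>) \<longlongrightarrow> corr n id m \<nu> \<nu>) (at \<nu>)" by (simp add: isCont_def)
    have "isCont K \<nu>" unfolding K_def lag_kernel_def by (intro continuous_intros) auto
    then have "(K \<longlongrightarrow> K \<nu>) (at \<nu>)" by (simp add: isCont_def)
    then have "((\<lambda>z. corr n id m z \<nu>) \<longlongrightarrow> K \<nu>) (at \<nu>)"
      by (rule Lim_transform_eventually) (use off in \<open>auto simp: eventually_at_filter\<close>)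
    with lim show ?thesis by (rule tendsto_unique[OF trivial_limit_at])
  qed
  with off show ?thesis unfolding K_def by metis
qed

end

section \<open>From the random matrix to the entries, and the conclusion\<close>

lemma sample_covariance_eq_gram:
  assumes A: "A \<in> carrier_mat n m"
  shows "sample_covariance A = gram (\<lambda>ij. A $$ ij) n id m"
proof (rule eq_matI)
  have adj: "mat_adjoint A \<in> carrier_mat m n"
    using A by (simp add: mat_adjoint_def mat_of_rows_def)
  show "dim_row (sample_covariance A) = dim_row (gram (\<lambda>ij. A $$ ij) n id m)"
    "dim_col (sample_covariance A) = dim_col (gram (\<lambda>ij. A $$ ij) n id m)"
    using A adj by (auto simp: sample_covariance_def gram_def)
  fix a b assume "a < dim_row (gram (\<lambda>ij. A $$ ij) n id m)" "b < dim_col (gram (\<lambda>ij. A $$ ij) n id m)"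
  then have ab: "a < m" "b < m" by (auto simp: gram_def)
  have "mat_adjoint A $$ (a, i) = cnj (A $$ (i, a))" if "i < n" for i
    using A ab that by (simp add: mat_adjoint_def mat_of_rows_index)
  then show "sample_covariance A $$ (a, b) = gram (\<lambda>ij. A $$ ij) n id m $$ (a, b)"
    using A adj ab by (auto simp: sample_covariance_def gram_def scalar_prod_def atLeast0LessThan intro!: sum.cong)
qed

lemma char_det_sample_covariance:
  assumes A: "A \<in> carrier_mat n m"
  shows "char_det (sample_covariance A) \<mu> = poly (gram_poly (\<lambda>ij. A $$ ij) n id m) \<mu>"
  unfolding char_det_def sample_covariance_eq_gram[OF A] poly_gram_poly gram_pencil_def
  by (simp add: gram_def)

lemma (in prob_space) integrable_power_le:
  fixes R :: "'a \<Rightarrow> real"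
  assumes R: "random_variable borel R" and int: "integrable M (\<lambda>\<omega>. R \<omega> ^ 4)" and k: "k \<le> 4"
  shows "integrable M (\<lambda>\<omega>. R \<omega> ^ k)"
proof (rule Bochner_Integration.integrable_bound)
  show "integrable M (\<lambda>\<omega>. 1 + R \<omega> ^ 4)" using int by simp
  show "(\<lambda>\<omega>. R \<omega> ^ k) \<in> borel_measurable M" using R by measurable
  have "\<bar>t\<bar> ^ k \<le> 1 + t ^ 4" for t :: real
  proof (cases "\<bar>t\<bar> \<le> 1")
    case True
    then have "\<bar>t\<bar> ^ k \<le> 1" by (intro power_le_one) auto
    moreover have "0 \<le> t ^ 4" by simp
    ultimately show ?thesis by linarith
  next
    case False
    then have "\<bar>t\<bar> ^ k \<le> \<bar>t\<bar> ^ 4" using k by (intro power_increasing) auto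
    then show ?thesis by simp
  qed
  moreover have "0 \<le> t ^ 4" for t :: real by simp
  ultimately show "AE \<omega> in M. norm (R \<omega> ^ k) \<le> norm (1 + R \<omega> ^ 4)"
    by (intro AE_I2) (simp add: power_abs add_nonneg_nonneg)
qed

text \<open>The origin of \<open>b_star\<close>: E |x|^4 = b + 2 (1/2) (1/2) + b = 2 + 2 (b - 3/4).
  The second moment E x^2 vanishes because real and imaginary parts have equal variance and are
  uncorrelated.\<close>

lemma iid_entries_random_matrix:
  assumes Q: "real_distribution Q" "integrable Q (\<lambda>x. x ^ 4)" "prob_space.expectation Q (\<lambda>x. x) = 0"
    "prob_space.variance Q (\<lambda>x. x) = 1 / 2" "b = prob_space.expectation Q (\<lambda>x. x ^ 4)"
    and X: "iid_complex_random_matrix Q n m M X"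
  shows "iid_entries M (\<lambda>ij \<omega>. X \<omega> $$ ij) n m (2 * (b - 3 / 4))"
proof -
  interpret Q: real_distribution Q by (rule Q(1))
  interpret prob_space M using X by (simp add: iid_complex_random_matrix_def)
  have m2: "Q.expectation (\<lambda>x. x ^ 2) = 1 / 2" using Q(3,4) by simp
  have mom: "integrable M (\<lambda>\<omega>. R \<omega> ^ 4)" "expectation R = 0" "expectation (\<lambda>\<omega>. R \<omega> ^ 2) = 1 / 2" "expectation (\<lambda>\<omega>. R \<omega> ^ 4) = b"
    if R: "random_variable borel R" "distr M borel R = Q" for R
  proof -
    have "integrable (distr M borel R) (\<lambda>x. x ^ 4)" using Q(2) R(2) by simp
    then show "integrable M (\<lambda>\<omega>. R \<omega> ^ 4)" using R(1) by (simp add: integrable_distr_eq)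
    have "expectation (\<lambda>\<omega>. g (R \<omega>)) = Q.expectation g" if "g \<in> borel_measurable borel" for g :: "real \<Rightarrow> real"
      unfolding R(2)[symmetric] by (rule integral_distr[symmetric, OF R(1) that])
    from this[of "\<lambda>x. x"] this[of "\<lambda>x. x ^ 2"] this[of "\<lambda>x. x ^ 4"]
    show "expectation R = 0" "expectation (\<lambda>\<omega>. R \<omega> ^ 2) = 1 / 2" "expectation (\<lambda>\<omega>. R \<omega> ^ 4) = b"
      using Q(3,5) m2 by simp_all
  qed
  show ?thesis
  proof (intro iid_entries.intro iid_entries_axioms.intro)
    show "prob_space M" by (rule prob_space_axioms)
    show "indep_vars (\<lambda>_. borel) (\<lambda>ij \<omega>. X \<omega> $$ ij) ({..<n} \<times> {..<m})"
      using X by (simp add: iid_complex_random_matrix_def)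
    fix ij assume ij: "ij \<in> {..<n} \<times> {..<m}"
    define R where "R = (\<lambda>\<omega>. Re (X \<omega> $$ ij))"
    define I where "I = (\<lambda>\<omega>. Im (X \<omega> $$ ij))"
    have z: "X \<omega> $$ ij = of_real (R \<omega>) + \<i> * of_real (I \<omega>)" for \<omega> by (simp add: R_def I_def complex_eq_iff)
    have ind: "indep_var borel R borel I" and dR: "distr M borel R = Q" and dI: "distr M borel I = Q"
      using X ij unfolding iid_complex_random_matrix_def R_def I_def by blast+
    have rv: "random_variable borel R" "random_variable borel I"
      using indep_var_rv1[OF ind] indep_var_rv2[OF ind] by auto
    note momR = mom[OF rv(1) dR] and momI = mom[OF rv(2) dI]
    note iR = integrable_power_le[OF rv(1) momR(1)] and iI = integrable_power_le[OF rv(2) momI(1)]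
    have int: "integrable M R" "integrable M I" "integrable M (\<lambda>\<omega>. R \<omega> ^ 2)" "integrable M (\<lambda>\<omega>. I \<omega> ^ 2)"
      using iR[of 1] iI[of 1] iR[of 2] iI[of 2] by simp_all
    have RI: "integrable M (\<lambda>\<omega>. R \<omega> * I \<omega>)" "expectation (\<lambda>\<omega>. R \<omega> * I \<omega>) = 0"
      using indep_var_integrable[OF ind int(1,2)] indep_var_lebesgue_integral[OF ind int(1,2)] momR(2) by simp_all
    have ind2: "indep_var borel (\<lambda>\<omega>. R \<omega> ^ 2) borel (\<lambda>\<omega>. I \<omega> ^ 2)"
      using indep_var_compose[OF ind, of "\<lambda>x. x ^ 2" borel "\<lambda>x. x ^ 2" borel] by (simp add: o_def)
    have RI2: "integrable M (\<lambda>\<omega>. R \<omega> ^ 2 * I \<omega> ^ 2)" "expectation (\<lambda>\<omega>. R \<omega> ^ 2 * I \<omega> ^ 2) = 1 / 4"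
      using indep_var_integrable[OF ind2 int(3,4)] indep_var_lebesgue_integral[OF ind2 int(3,4)] momR(3) momI(3) by simp_all
    have sq: "(r\<^sup>2 + s\<^sup>2)\<^sup>2 = r ^ 4 + 2 * (r ^ 2 * s ^ 2) + s ^ 4" for r s :: real
      by (simp add: power2_eq_square power4_eq_xxxx algebra_simps)
    have int22: "integrable M (\<lambda>\<omega>. ((R \<omega>)\<^sup>2 + (I \<omega>)\<^sup>2)\<^sup>2)"
      unfolding sq using momR(1) momI(1) RI2(1) by simp
    have E22: "expectation (\<lambda>\<omega>. ((R \<omega>)\<^sup>2 + (I \<omega>)\<^sup>2)\<^sup>2) = 2 + 2 * (b - 3 / 4)"
      unfolding sq using momR momI RI2 by simp
    have "norm (X \<omega> $$ ij) ^ 4 = ((R \<omega>)\<^sup>2 + (I \<omega>)\<^sup>2)\<^sup>2" for \<omega>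
    proof -
      have "norm (X \<omega> $$ ij) ^ 4 = ((norm (X \<omega> $$ ij))\<^sup>2)\<^sup>2" by simp
      then show ?thesis by (simp only: cmod_power2 R_def I_def)
    qed
    then show "integrable M (\<lambda>\<omega>. norm (X \<omega> $$ ij) ^ 4)" using int22 by simp
    have E: "expectation (\<lambda>\<omega>. complex_of_real (F \<omega>) + \<i> * complex_of_real (G \<omega>)) = of_real (expectation F) + \<i> * of_real (expectation G)"
      if "integrable M F" "integrable M G" for F G
      using that by simp
    show "expectation (\<lambda>\<omega>. X \<omega> $$ ij) = 0"
      unfolding z E[OF int(1,2)] using momR(2) momI(2) by simp
    have "(X \<omega> $$ ij) ^ 2 = of_real ((R \<omega>)\<^sup>2 - (I \<omega>)\<^sup>2) + \<i> * of_real (2 * (R \<omega> * I \<omega>))" for \<omega>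
      unfolding z by (simp add: power2_eq_square complex_eq_iff)
    then show "expectation (\<lambda>\<omega>. (X \<omega> $$ ij) ^ 2) = 0"
      using E[of "\<lambda>\<omega>. (R \<omega>)\<^sup>2 - (I \<omega>)\<^sup>2" "\<lambda>\<omega>. 2 * (R \<omega> * I \<omega>)"] int RI momR(3) momI(3) by simp
    have 11: "X \<omega> $$ ij * cnj (X \<omega> $$ ij) = of_real ((R \<omega>)\<^sup>2 + (I \<omega>)\<^sup>2)" for \<omega>
      unfolding z by (simp add: power2_eq_square complex_eq_iff)
    have "expectation (\<lambda>\<omega>. (R \<omega>)\<^sup>2 + (I \<omega>)\<^sup>2) = 1"
      using int momR(3) momI(3) by simp
    then show "expectation (\<lambda>\<omega>. X \<omega> $$ ij * cnj (X \<omega> $$ ij)) = 1"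
      unfolding 11 integral_complex_of_real by simp
    have 22: "(X \<omega> $$ ij) ^ 2 * cnj (X \<omega> $$ ij) ^ 2 = of_real (((R \<omega>)\<^sup>2 + (I \<omega>)\<^sup>2)\<^sup>2)" for \<omega>
      unfolding power_mult_distrib[symmetric] 11 by simp
    show "expectation (\<lambda>\<omega>. (X \<omega> $$ ij) ^ 2 * cnj (X \<omega> $$ ij) ^ 2) = of_real (2 + 2 * (b - 3 / 4))"
      unfolding 22 integral_complex_of_real E22 ..
  qed
qed

text \<open>With s = N^(1/3) the base of the power factorises as (4 N + p s) (4 N + q s), the
  product of the two edge points, and the exponent is minus half their sum.\<close>

lemma Z_factor_edge:
  assumes "edge \<mu> N \<ge> 2" "edge \<nu> N \<ge> 2"
  shows "2 powr (4/3) * real N powr (1/3) * Z_factor \<alpha> N (2 powr (4/3) * \<mu>) (2 powr (4/3) * \<nu>) =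
    edge_weight \<alpha> N (edge \<mu> N) (edge \<nu> N)"
proof -
  define s where "s = real N powr (1/3)"
  define p q where "p = 2 powr (4/3) * \<mu>" and "q = 2 powr (4/3) * \<nu>"
  have s2: "real N powr (2/3) = s * s" by (simp add: s_def powr_add[symmetric])
  have s4: "real N powr (4/3) = real N * s"
    using powr_add[of "real N" 1 "1/3"] by (simp add: s_def)
  have e: "edge \<mu> N = 4 * real N + p * s" "edge \<nu> N = 4 * real N + q * s"
    by (simp_all add: edge_def p_def q_def s_def)
  have 1: "16 * real N ^ 2 + 4 * (p + q) * real N powr (4/3) + p * q * real N powr (2/3) = edge \<mu> N * edge \<nu> N"
    unfolding s2 s4 e by (simp add: algebra_simps power2_eq_square)
  have 2: "- 4 * real N - 1/2 * (p + q) * s = - (edge \<mu> N + edge \<nu> N) / 2"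
    unfolding e by (simp add: algebra_simps)
  show ?thesis
    unfolding Z_factor_def edge_weight_def p_def[symmetric] q_def[symmetric] 1 s_def[symmetric] 2 ..
qed

theorem theorem5p1:
  fixes Q :: "real measure" and b :: real and \<alpha> :: nat and \<mu> \<nu> :: real
    and M :: "nat \<Rightarrow> nat \<Rightarrow> 'a measure"
    and X :: "nat \<Rightarrow> nat \<Rightarrow> 'a \<Rightarrow> complex mat"
    and f :: "nat \<Rightarrow> nat \<Rightarrow> complex \<Rightarrow> complex \<Rightarrow> complex"
    and b_star :: real
  assumes "real_distribution Q"
    and "integrable Q (\<lambda>x. x ^ 4)"
    and "prob_space.expectation Q (\<lambda>x. x) = 0"
    and "prob_space.variance Q (\<lambda>x. x) = 1 / 2"
    and "b = prob_space.expectation Q (\<lambda>x. x ^ 4)"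
    and "b_star = 2 * (b - 3 / 4)"
    and "\<And>n m. m \<le> n \<Longrightarrow> iid_complex_random_matrix Q n m (M n m) (X n m)"
    and "\<And>n m \<mu> \<nu>. f n m \<mu> \<nu> = second_order_correlation (M n m) (X n m) \<mu> \<nu>"
  shows "(\<lambda>N. let n = N; m = N - \<alpha> in
            complex_of_real
              (2 powr (4/3) * real N powr (1/3)
               * Z_factor \<alpha> N (2 powr (4/3) * \<mu>) (2 powr (4/3) * \<nu>))
            * (f n m (complex_of_real (4 * real N + 2 powr (4/3) * \<mu> * real N powr (1/3)))
                     (complex_of_real (4 * real N + 2 powr (4/3) * \<nu> * real N powr (1/3)))
               / (fact n * fact m)))
         \<longlonglongrightarrow> complex_of_real (exp b_star * Airy_kernel \<mu> \<nu>)"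
proof -
  \<comment> \<open>An exact identity for each N \<ge> \<alpha>: all probability is used up here,
    before any limit is taken.\<close>
  have series: "f N (N - \<alpha>) (complex_of_real x) (complex_of_real y) / (fact N * fact (N - \<alpha>)) =
      complex_of_real (\<Sum>j\<le>N - \<alpha>. b_star ^ j / fact j * lag_kernel \<alpha> (N - \<alpha> - j) x y)"
    if N: "\<alpha> \<le> N" for N x y
  proof -
    define m where "m = N - \<alpha>"
    have m: "m \<le> N" "N = m + \<alpha>" using N by (auto simp: m_def)
    note iid = assms(7)[OF m(1)]
    have carrier: "X N m \<omega> \<in> carrier_mat N m" if "\<omega> \<in> space (M N m)" for \<omega>
      using iid that by (simp add: iid_complex_random_matrix_def)
    interpret iid_entries "M N m" "\<lambda>ij \<omega>. X N m \<omega> $$ ij" N m b_star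
      unfolding assms(6) by (rule iid_entries_random_matrix[OF assms(1-5) iid])
    have "f N m (complex_of_real x) (complex_of_real y) = corr N id m (complex_of_real x) (complex_of_real y)"
      unfolding assms(8) second_order_correlation_def corr_def array_def[abs_def]
      by (rule Bochner_Integration.integral_cong) (simp_all add: char_det_sample_covariance[OF carrier])
    also have "\<dots> = fact N * fact m * complex_of_real (\<Sum>j\<le>m. b_star ^ j / fact j * lag_kernel \<alpha> (m - j) x y)"
      unfolding corr_eq_series[OF m(2)] lag_kernel_of_real by simp
    finally show ?thesis by (simp add: m_def)
  qed
  have "(\<lambda>N. complex_of_real (edge_weight \<alpha> N (edge \<mu> N) (edge \<nu> N) *
      (\<Sum>j\<le>N - \<alpha>. b_star ^ j / fact j * lag_kernel \<alpha> (N - \<alpha> - j) (edge \<mu> N) (edge \<nu> N))))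
    \<longlonglongrightarrow> complex_of_real (exp b_star * Airy_kernel \<mu> \<nu>)"
    by (intro tendsto_of_real lag_kernel_edge_series_asymp)
  then show ?thesis
  proof (rule Lim_transform_eventually)
    show "\<forall>\<^sub>F N in sequentially. complex_of_real (edge_weight \<alpha> N (edge \<mu> N) (edge \<nu> N) *
      (\<Sum>j\<le>N - \<alpha>. b_star ^ j / fact j * lag_kernel \<alpha> (N - \<alpha> - j) (edge \<mu> N) (edge \<nu> N))) =
      (let n = N; m = N - \<alpha> in
            complex_of_real
              (2 powr (4/3) * real N powr (1/3)
               * Z_factor \<alpha> N (2 powr (4/3) * \<mu>) (2 powr (4/3) * \<nu>))
            * (f n m (complex_of_real (4 * real N + 2 powr (4/3) * \<mu> * real N powr (1/3)))
                     (complex_of_real (4 * real N + 2 powr (4/3) * \<nu> * real N powr (1/3)))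
               / (fact n * fact m)))"
      \<comment> \<open>Only for N \<ge> \<alpha> is \<open>N - \<alpha>\<close> a genuine
        difference, with N = m + \<alpha> as the series formula requires.\<close>
      using edge_ge_2[of \<mu>] edge_ge_2[of \<nu>] eventually_ge_at_top[of \<alpha>]
    proof eventually_elim
      case (elim N)
      show ?case
        unfolding Let_def Z_factor_edge[OF elim(1,2)] edge_def[symmetric] series[OF elim(3)] of_real_mult ..
    qed
  qed
qed

end
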